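(* Let $(S,\mathcal{S},\mu)$ be an atomless measure space and let $\xi$ be a random measure on $S$ that is $\mu$-swap-invariant under a probability measure $\mathbf{P}$. (i) For each $\xi$-integrable $\mu$-sequence $(A_n)_{n\ge 1}$ there exists an integrable random variable $X$ such that $\xi(A_n)/\mu(A_n)\to X$ almost surely as $n\to\infty$. (ii) Assume that the measures $\mu$ and $\mathbf{E}_{\mathbf{P}}\,\xi$ are $\sigma$-finite. Further assume that there exist a $\mu$-sequence $(A_n)_{n\ge1}$ with constant increments and limit $A=\bigcup_{n} A_n$, and a random variable $X$, such that $\mu(S\setminus A)=\infty$, $\xi(A_n)/\mu(A_n)\to X$ in $L^1(\mathbf{P})$ as $n\to\infty$, and $\mathbf{E}_{\mathbf{P}}X>0$. Then $\xi(B_n)/\mu(B_n)\to X$ in $L^1(\mathbf{P})$ for each $\mu$-sequence $(B_n)_{n\ge1}$. (iii) Under the same conditions as in (ii), there exists a random measure $\eta$ on $S$ that is $\mu$-exchangeable under the probability measure $\mathbf{Q}$ defined by $$\frac{\mathrm{d}\mathbf{Q}}{\mathrm{d}\mathbf{P}}=\frac{X}{\mathbf{E}_{\mathbf{P}}X}$$ such that $\xi=X\eta$ $\mathbf{P}$-almost surely.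
   Context: A random measure $\xi$ on a measurable space $(S,\mathcal{S})$, defined over a probability space $(\Omega,\mathcal{F},\mathbf{P})$, is a map $\xi:\Omega\times\mathcal{S}\to[0,\infty]$ such that $\xi(M)=\xi(\cdot,M)$ is measurable for each $M\in\mathcal{S}$ and $\xi(\omega,\cdot)$ is a measure for each $\omega\in\Omega$. Its intensity measure is $M\mapsto\mathbf{E}\,\xi(M)$. Atomless: an atom of $\mu$ is a measurable set $M$ with $\mu(M)>0$ such that every measurable $C\subset M$ satisfies $\mu(C)=0$ or $\mu(C)=\mu(M)$; $\mu$ is atomless if it has no atoms. $\mu$-swap-invariant: $\mathbf{E}\,\big|\sum_{j=1}^n u_j\xi(A_j)\big|=\mathbf{E}\,\big|\sum_{j=1}^n u_j\xi(B_j)\big|$ for all $n\ge1$, $u\in\mathbb{R}^n$, disjoint $A_1,\dots,A_n\in\mathcal{S}$ and disjoint $B_1,\dots,B_n\in\mathcal{S}$ such that $\mu(A_j)=\mu(B_j)$, $\mathbf{E}\,\xi(A_j)<\infty$ and $\mathbf{E}\,\xi(B_j)<\infty$ for $1\le j\le n$. $\mu$-exchangeable: $(\xi(A_1),\dots,\xi(A_n))$ and $(\xi(B_1),\dots,\xi(B_n))$ are equal in distribution for all $n\ge 1$, all disjoint $A_1,\dots,A_n\in\mathcal{S}$ and all disjoint $B_1,\dots,B_n\in\mathcal{S}$ with $\mu(A_j)=\mu(B_j)$ for $1\le j\le n$. A $\mu$-sequence is an increasing sequence $A_n\in\mathcal{S}$ ($n\ge1$) with $\mu(A_n)<\infty$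 for all $n$ and $\mu(A_n)\to\infty$. Put $\Delta A_1=A_1$ and $\Delta A_n=A_n\setminus A_{n-1}$ for $n\ge2$. The $\mu$-sequence has constant increments if $\mu(\Delta A_n)=c$ for all $n\ge1$ and some $c\in(0,\infty)$. It is $\xi$-integrable if $\mathbf{E}\,\xi(A_n)<\infty$ for all $n\ge1$. $\mathbf{E}_{\mathbf{P}}$ denotes expectation with respect to $\mathbf{P}$. *)

theory Defs
  imports "HOL-Probability.Probability"
begin

definition atom_of :: "'s measure \<Rightarrow> 's set \<Rightarrow> bool" where
  "atom_of M A \<longleftrightarrow> A \<in> sets M \<and> emeasure M A > 0 \<and>
     (\<forall>C\<in>sets M. C \<subseteq> A \<longrightarrow> emeasure M C = 0 \<or> emeasure M C = emeasure M A)"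

definition atomless :: "'s measure \<Rightarrow> bool" where
  "atomless M \<longleftrightarrow> (\<nexists>A. atom_of M A)"

text \<open>In all definitions below, \<open>M\<close> is the measure space \<open>(S, \<S>, \<mu>)\<close>. Only the measurable
  space underlying \<open>P\<close> and \<open>M\<close> matters for being a random measure.\<close>

definition random_measure :: "'w measure \<Rightarrow> 's measure \<Rightarrow> ('w \<Rightarrow> 's measure) \<Rightarrow> bool" where
  "random_measure P M \<xi> \<longleftrightarrow> (\<forall>\<omega>\<in>space P. sets (\<xi> \<omega>) = sets M) \<and>
     (\<forall>A\<in>sets M. (\<lambda>\<omega>. emeasure (\<xi> \<omega>) A) \<in> borel_measurable P)"

definition intensity :: "'w measure \<Rightarrow> 's measure \<Rightarrow> ('w \<Rightarrow> 's measure) \<Rightarrow> 's measure" where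
  "intensity P M \<xi> = measure_of (space M) (sets M) (\<lambda>A. \<integral>\<^sup>+\<omega>. emeasure (\<xi> \<omega>) A \<partial>P)"

lemma sets_intensity [simp]: "sets (intensity P M \<xi>) = sets M"
  by (simp add: intensity_def)

lemma space_intensity [simp]: "space (intensity P M \<xi>) = space M"
  by (simp add: intensity_def)

lemma emeasure_intensity:
  fixes M :: "'s measure"
  assumes "random_measure P M \<xi>" and "A \<in> sets M"
  shows "emeasure (intensity P M \<xi>) A = (\<integral>\<^sup>+\<omega>. emeasure (\<xi> \<omega>) A \<partial>P)"
proof (rule emeasure_measure_of[OF intensity_def])
  show "sets M \<subseteq> Pow (space M)"
    by (rule sets.space_closed)
  show "A \<in> sets (intensity P M \<xi>)"
    using assms(2) by simp
  show "positive (sets (intensity P M \<xi>)) (\<lambda>A. \<integral>\<^sup>+\<omega>. emeasure (\<xi> \<omega>) A \<partial>P)"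
    by (simp add: positive_def)
  show "countably_additive (sets (intensity P M \<xi>)) (\<lambda>A. \<integral>\<^sup>+\<omega>. emeasure (\<xi> \<omega>) A \<partial>P)"
  proof (rule countably_additiveI)
    fix F :: "nat \<Rightarrow> 's set"
    assume F: "range F \<subseteq> sets (intensity P M \<xi>)" "disjoint_family F"
    have "(\<Sum>i. \<integral>\<^sup>+\<omega>. emeasure (\<xi> \<omega>) (F i) \<partial>P) = (\<integral>\<^sup>+\<omega>. (\<Sum>i. emeasure (\<xi> \<omega>) (F i)) \<partial>P)"
      using assms(1) F(1) by (intro nn_integral_suminf[symmetric]) (auto simp: random_measure_def)
    also have "\<dots> = (\<integral>\<^sup>+\<omega>. emeasure (\<xi> \<omega>) (\<Union>i. F i) \<partial>P)"
      using assms(1) F by (intro nn_integral_cong suminf_emeasure) (auto simp: random_measure_def)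
    finally show "(\<Sum>i. \<integral>\<^sup>+\<omega>. emeasure (\<xi> \<omega>) (F i) \<partial>P) = (\<integral>\<^sup>+\<omega>. emeasure (\<xi> \<omega>) (\<Union>i. F i) \<partial>P)" .
  qed
qed

text \<open>Since \<open>\<xi>(A\<^sub>j)\<close> and \<open>\<xi>(B\<^sub>j)\<close> have finite expectation below, they are almost surely finite, and
  the real-valued \<^const>\<open>measure\<close> differs from \<^const>\<open>emeasure\<close> on a null set only. The values
  \<open>\<mu>(A\<^sub>j) = \<mu>(B\<^sub>j)\<close> may be infinite.\<close>

definition swap_invariant :: "'w measure \<Rightarrow> 's measure \<Rightarrow> ('w \<Rightarrow> 's measure) \<Rightarrow> bool" where
  "swap_invariant P M \<xi> \<longleftrightarrow>
     (\<forall>(n::nat) (u :: nat \<Rightarrow> real) A B. n \<ge> 1 \<longrightarrow>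
        (\<forall>j<n. A j \<in> sets M \<and> B j \<in> sets M) \<longrightarrow>
        disjoint_family_on A {..<n} \<longrightarrow> disjoint_family_on B {..<n} \<longrightarrow>
        (\<forall>j<n. emeasure M (A j) = emeasure M (B j) \<and>
           (\<integral>\<^sup>+\<omega>. emeasure (\<xi> \<omega>) (A j) \<partial>P) < \<infinity> \<and> (\<integral>\<^sup>+\<omega>. emeasure (\<xi> \<omega>) (B j) \<partial>P) < \<infinity>) \<longrightarrow>
        (\<integral>\<omega>. \<bar>\<Sum>j<n. u j * measure (\<xi> \<omega>) (A j)\<bar> \<partial>P) =
        (\<integral>\<omega>. \<bar>\<Sum>j<n. u j * measure (\<xi> \<omega>) (B j)\<bar> \<partial>P))"

definition exchangeable :: "'w measure \<Rightarrow> 's measure \<Rightarrow> ('w \<Rightarrow> 's measure) \<Rightarrow> bool" where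
  "exchangeable P M \<xi> \<longleftrightarrow>
     (\<forall>(n::nat) A B. n \<ge> 1 \<longrightarrow>
        (\<forall>j<n. A j \<in> sets M \<and> B j \<in> sets M) \<longrightarrow>
        disjoint_family_on A {..<n} \<longrightarrow> disjoint_family_on B {..<n} \<longrightarrow>
        (\<forall>j<n. emeasure M (A j) = emeasure M (B j)) \<longrightarrow>
        distr P (\<Pi>\<^sub>M j\<in>{..<n}. borel) (\<lambda>\<omega>. \<lambda>j\<in>{..<n}. emeasure (\<xi> \<omega>) (A j)) =
        distr P (\<Pi>\<^sub>M j\<in>{..<n}. borel) (\<lambda>\<omega>. \<lambda>j\<in>{..<n}. emeasure (\<xi> \<omega>) (B j)))"

text \<open>Sequences start at index 0 here: \<open>A 0\<close> is the first set \<open>A\<^sub>1\<close>.\<close>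

definition mu_sequence :: "'s measure \<Rightarrow> (nat \<Rightarrow> 's set) \<Rightarrow> bool" where
  "mu_sequence M A \<longleftrightarrow> range A \<subseteq> sets M \<and> incseq A \<and>
     (\<forall>n. emeasure M (A n) < \<infinity>) \<and> (\<lambda>n. emeasure M (A n)) \<longlonglongrightarrow> \<infinity>"

definition increment :: "(nat \<Rightarrow> 's set) \<Rightarrow> nat \<Rightarrow> 's set" where
  "increment A n = (case n of 0 \<Rightarrow> A 0 | Suc m \<Rightarrow> A (Suc m) - A m)"

definition constant_increments :: "'s measure \<Rightarrow> (nat \<Rightarrow> 's set) \<Rightarrow> bool" where
  "constant_increments M A \<longleftrightarrow> (\<exists>c. 0 < c \<and> c < \<infinity> \<and> (\<forall>n. emeasure M (increment A n) = c))"

definition integrable_sequence :: "'w measure \<Rightarrow> ('w \<Rightarrow> 's measure) \<Rightarrow> (nat \<Rightarrow> 's set) \<Rightarrow> bool" where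
  "integrable_sequence P \<xi> A \<longleftrightarrow> (\<forall>n. (\<integral>\<^sup>+\<omega>. emeasure (\<xi> \<omega>) (A n) \<partial>P) < \<infinity>)"

text \<open>The quotient \<open>\<xi>(A\<^sub>n) / \<mu>(A\<^sub>n)\<close> is extended real-valued: truncating it by \<^const>\<open>measure\<close> would
  turn \<open>\<xi>(A\<^sub>n) = \<infinity>\<close> into \<open>0\<close>. Division by \<open>\<mu>(A\<^sub>n) = 0\<close> occurs for finitely many \<open>n\<close> only if
  \<open>A\<close> is a \<open>\<mu>\<close>-sequence.\<close>

definition measure_ratio :: "'s measure \<Rightarrow> ('w \<Rightarrow> 's measure) \<Rightarrow> (nat \<Rightarrow> 's set) \<Rightarrow> nat \<Rightarrow> 'w \<Rightarrow> ereal" where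
  "measure_ratio M \<xi> A n \<omega> = enn2ereal (emeasure (\<xi> \<omega>) (A n) / emeasure M (A n))"

text \<open>Convergence in \<open>L\<^sup>1(P)\<close> of extended real-valued random variables. For large \<open>n\<close> the integral is
  finite, so that \<open>Y n\<close> is then itself integrable.\<close>

definition tendsto_L1 :: "'w measure \<Rightarrow> (nat \<Rightarrow> 'w \<Rightarrow> ereal) \<Rightarrow> ('w \<Rightarrow> real) \<Rightarrow> bool" where
  "tendsto_L1 P Y X \<longleftrightarrow> (\<forall>n. Y n \<in> borel_measurable P) \<and> integrable P X \<and>
     (\<lambda>n. \<integral>\<^sup>+\<omega>. e2ennreal \<bar>Y n \<omega> - ereal (X \<omega>)\<bar> \<partial>P) \<longlonglongrightarrow> 0"

end

theory Submission
  imports Defs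
begin

text \<open>For an integrable weight \<open>W \<ge> 0\<close> and integrable \<open>Y\<^sub>j \<ge> 0\<close>, the numbers
  \<open>E \<bar>t W + \<Sum>\<^sub>j u\<^sub>j Y\<^sub>j\<bar>\<close> determine the law of the vector of ratios \<open>Y\<^sub>j / W\<close> under the measure \<open>W dP\<close>: they give
  the law of every linear combination of the ratios, hence all moments of the variables
  \<open>exp (- Y\<^sub>j / W)\<close>. With \<open>W = \<xi>(K)\<close>, swap-invariance turns into exchangeability of \<open>\<xi> / \<xi>(K)\<close> off \<open>K\<close>.
  There the quotients \<open>\<xi>(A\<^sub>n - K) / \<mu>(A\<^sub>n - K)\<close>, divided by \<open>\<xi>(K)\<close>, form a reversed martingale under \<open>\<xi>(K) dP\<close>, which proves convergence on
  \<open>{\<xi>(K) > 0}\<close>; letting \<open>K\<close> run through all \<open>A\<^sub>k\<close> yields (i).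

  For (ii), \<open>\<sigma>\<close>-finiteness gives \<open>E \<xi> = E X \<cdot> \<mu>\<close>, and the \<open>L\<^sup>1\<close> distance of \<open>\<xi>(C) / \<mu>(C)\<close> and
  \<open>\<xi>(D) / \<mu>(D)\<close> for \<open>C \<subseteq> D\<close> depends on \<open>\<mu>(C)\<close> and \<open>\<mu>(D)\<close> only; so \<open>\<xi>(B) / \<mu>(B)\<close> is close to \<open>X\<close> as soon as
  \<open>\<mu>(B)\<close> is large. Consequently \<open>W = X\<close> is admissible as a weight as well, and \<open>\<eta> = \<xi> / X\<close> is
  exchangeable under \<open>X dP\<close>, which is (iii).\<close>

text \<open>Swap-invariance speaks of homogeneous linear combinations only. The constant
  \<open>t\<close> in \<open>E \<bar>t + Z\<bar>\<close>, whose variation reveals the law of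
  \<open>Z\<close>, is missing, and this forces the change of measure: in
  \<open>\<bar>t W + Z\<bar> = W \<bar>t + Z / W\<bar>\<close> a weight, which is the mass of a
  disjoint set or a limit of such masses, supplies the constant. The price is that the weighted law
  says nothing about the event \<open>W = 0\<close>. In (i) this event is dealt with by varying the
  weight. In (iii) it has to be shown that \<xi> vanishes there, for which the integrals over the
  event are recovered from the same absolute moments by letting \<open>t\<close> grow. Atomlessness
  enters through one principle: a nonnegative additive function of sets that depends on their
  measure alone is a multiple of the measure. With it the reversed martingale identity follows from
  exchangeability without any conditional expectation. Constant increments ensure that the sum of
  two values \<open>\<mu>(A n)\<close>, \<open>\<mu>(A m)\<close> is again such a value, so that a
  union of two sets can be enlarged to a set as big as some \<open>A k\<close>.\<close>

section \<open>Atomless measures\<close>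

text \<open>A set that is not an atom splits into two parts of positive measure, and one of them has
  at most half of the measure. Iterating this beats every \<open>e\<close>.\<close>

lemma atomless_small_subset:
  assumes M: "atomless M" and D: "D \<in> sets M" "emeasure M D < \<infinity>" "0 < measure M D" and e: "0 < e"
  obtains C where "C \<in> sets M" "C \<subseteq> D" "0 < measure M C" "measure M C < e"
proof -
  have halve: "\<exists>C\<in>sets M. C \<subseteq> E \<and> 0 < measure M C \<and> measure M C \<le> measure M E / 2"
    if E: "E \<in> sets M" "E \<subseteq> D" "0 < measure M E" for E
  proof -
    have fin: "emeasure M F < \<infinity>" if "F \<subseteq> D" "F \<in> sets M" for F
      using emeasure_mono[OF that(1) D(1)] D(2) by (rule order.strict_trans1)
    have fin': "emeasure M F = ennreal (measure M F)" if "F \<subseteq> D" "F \<in> sets M" for F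
      using fin[OF that] by (intro emeasure_eq_ennreal_measure) auto
    have "\<not> atom_of M E"
      using M by (auto simp: atomless_def)
    then obtain C where C: "C \<in> sets M" "C \<subseteq> E" "emeasure M C \<noteq> 0" "emeasure M C \<noteq> emeasure M E"
      using E fin'[of E] by (auto simp: atom_of_def)
    have CD: "C \<subseteq> D" "E - C \<subseteq> D"
      using C E by auto
    have sub: "measure M (E - C) = measure M E - measure M C"
      using measure_Diff[of M E C] C E fin[of E] by auto
    have "0 < measure M C"
      using C(3) fin'[OF CD(1) C(1)] by (metis ennreal_0 measure_nonneg order_le_imp_less_or_eq)
    moreover have "measure M C < measure M E"
      using C(4) fin'[OF CD(1) C(1)] fin'[OF E(2,1)] measure_nonneg[of M "E - C"] sub by force
    ultimately show ?thesis
    proof (cases "measure M C \<le> measure M E / 2")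
      case False
      with \<open>measure M C < measure M E\<close> show ?thesis
        using C E sub by (intro bexI[of _ "E - C"]) auto
    qed (use C in auto)
  qed
  have "\<exists>C\<in>sets M. C \<subseteq> D \<and> 0 < measure M C \<and> measure M C \<le> measure M D / 2 ^ n" for n
  proof (induction n)
    case (Suc n)
    then obtain E where E: "E \<in> sets M" "E \<subseteq> D" "0 < measure M E" "measure M E \<le> measure M D / 2 ^ n"
      by auto
    from halve[OF E(1,2,3)] obtain C where "C \<in> sets M" "C \<subseteq> E" "0 < measure M C" "measure M C \<le> measure M E / 2"
      by auto
    then show ?case
      using E by (intro bexI[of _ C]) auto
  qed (use D in auto)
  moreover obtain n where "measure M D / e < 2 ^ n"
    using real_arch_pow[of 2 "measure M D / e"] by auto
  then have "measure M D / 2 ^ n < e"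
    using e by (simp add: field_simps)
  ultimately show ?thesis
    by (meson that order.strict_trans1)
qed

text \<open>Greedy construction: each step adds a set whose measure is at least half of what is
  still possible, so that what could be added at the end would have been added before.\<close>

theorem atomless_subset_of_measure:
  assumes M: "atomless M" and D: "D \<in> sets M" "emeasure M D < \<infinity>" and t: "0 \<le> t" "t \<le> measure M D"
  obtains C where "C \<in> sets M" "C \<subseteq> D" "measure M C = t"
proof -
  have fin: "F \<in> fmeasurable M" if "F \<subseteq> D" "F \<in> sets M" for F
    using D that by (intro fmeasurableI2[of D M F] fmeasurableI) auto
  have fin': "emeasure M F \<noteq> \<top>" if "F \<subseteq> D" "F \<in> sets M" for F
    using fin[OF that] by (rule fmeasurableD2)
  define adm where "adm C E \<longleftrightarrow> E \<in> sets M \<and> E \<subseteq> D - C \<and> measure M C + measure M E \<le> t" for C E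
  define s where "s C = Sup (measure M ` Collect (adm C))" for C
  define step where "step C = (SOME E. adm C E \<and> s C / 2 \<le> measure M E)" for C
  define Cs where "Cs n = ((\<lambda>C. C \<union> step C) ^^ n) {}" for n
  have bdd: "bdd_above (measure M ` Collect (adm C))" for C
    by (rule bdd_aboveI[of _ t]) (auto simp: adm_def intro: order_trans[rotated])
  have le_s: "measure M E \<le> s C" if "adm C E" for C E
    unfolding s_def using that bdd by (auto intro: cSup_upper)
  \<comment> \<open>The supremum \<open>s C\<close> need not be attained, so only half of it is
    demanded; if it is not positive, the empty set will do.\<close>
  have step: "adm C (step C) \<and> s C / 2 \<le> measure M (step C)"
    if C: "C \<in> sets M" "C \<subseteq> D" "measure M C \<le> t" for C
    unfolding step_def
  proof (rule someI_ex)
    have emp: "adm C {}"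
      using C by (auto simp: adm_def)
    show "\<exists>E. adm C E \<and> s C / 2 \<le> measure M E"
    proof (cases "s C > 0")
      case True
      then have "s C / 2 < Sup (measure M ` Collect (adm C))"
        by (simp add: s_def)
      then obtain E where "adm C E" "s C / 2 < measure M E"
        using less_cSup_iff[OF _ bdd, of C "s C / 2"] emp by auto
      then show ?thesis by (auto intro: less_imp_le)
    next
      case False
      then show ?thesis using emp by (intro exI[of _ "{}"]) auto
    qed
  qed
  have Cs_Suc: "Cs (Suc n) = Cs n \<union> step (Cs n)" for n
    by (simp add: Cs_def)
  have Suc_measure: "measure M (C \<union> E) = measure M C + measure M E"
    if "C \<in> sets M" "C \<subseteq> D" "adm C E" for C E
  proof (rule measure_Union)
    show "emeasure M E \<noteq> \<infinity>"
      using that fin'[of E] by (auto simp: adm_def)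
  qed (use that fin' in \<open>auto simp: adm_def\<close>)
  have inv: "Cs n \<in> sets M \<and> Cs n \<subseteq> D \<and> measure M (Cs n) \<le> t" for n
  proof (induction n)
    case 0
    then show ?case using t by (simp add: Cs_def)
  next
    case (Suc n)
    then have "adm (Cs n) (step (Cs n))" using step by auto
    with Suc show ?case
      using Suc_measure[of "Cs n" "step (Cs n)"] by (auto simp: adm_def Cs_Suc)
  qed
  have adm: "adm (Cs n) (step (Cs n))" "s (Cs n) / 2 \<le> measure M (step (Cs n))" for n
    using step inv by auto
  have meas_Suc: "measure M (Cs (Suc n)) = measure M (Cs n) + measure M (step (Cs n))" for n
    unfolding Cs_Suc using inv[of n] adm(1)[of n] by (intro Suc_measure) auto
  define C where "C = (\<Union>n. Cs n)"
  have C: "C \<in> sets M" "C \<subseteq> D"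
    using inv by (auto simp: C_def)
  have "incseq Cs"
    by (rule incseq_SucI) (auto simp: Cs_Suc)
  then have lim: "(\<lambda>n. measure M (Cs n)) \<longlonglongrightarrow> measure M C"
    using inv fin'[OF C(2,1)] unfolding C_def by (intro Lim_measure_incseq) auto
  then have "measure M C \<le> t"
    using inv by (intro LIMSEQ_le_const2) auto
  moreover have "\<not> measure M C < t"
  proof
    assume less: "measure M C < t"
    have "measure M (D - C) = measure M D - measure M C"
      using C D by (intro measure_Diff) auto
    with less t have "0 < measure M (D - C)" by auto
    moreover have "emeasure M (D - C) < \<infinity>"
      using fin'[of "D - C"] C D by (auto simp: less_top)
    ultimately obtain E where E: "E \<in> sets M" "E \<subseteq> D - C" "0 < measure M E" "measure M E < t - measure M C"
      using atomless_small_subset[OF M, of "D - C" "t - measure M C"] C D less by auto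
    \<comment> \<open>The set \<open>E\<close> left over at the end was admissible at every stage,
      so every increment is at least half of its measure. But the increments of a convergent
      sequence tend to 0.\<close>
    have "measure M E / 2 \<le> measure M (step (Cs n))" for n
    proof -
      have "measure M (Cs n) \<le> measure M C"
        using inv fin[OF C(2,1)] by (intro measure_mono_fmeasurable) (auto simp: C_def)
      then have "adm (Cs n) E"
        using E by (auto simp: adm_def C_def)
      from le_s[OF this] adm(2)[of n] show ?thesis by simp
    qed
    then have "measure M E / 2 \<le> measure M (Cs (Suc n)) - measure M (Cs n)" for n
      using meas_Suc by simp
    moreover have "(\<lambda>n. measure M (Cs (Suc n)) - measure M (Cs n)) \<longlonglongrightarrow> measure M C - measure M C"
      using lim LIMSEQ_Suc[OF lim] by (intro tendsto_diff)
    ultimately have "measure M E / 2 \<le> 0"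
      by (intro LIMSEQ_le_const[of _ _ "measure M E / 2"]) auto
    with E show False by simp
  qed
  ultimately show ?thesis
    using that C by force
qed

lemma atomless_between:
  assumes M: "atomless M" and sets: "L \<in> sets M" "U \<in> sets M" "L \<subseteq> U" "emeasure M U < \<infinity>"
    and t: "measure M L \<le> t" "t \<le> measure M U"
  obtains C where "C \<in> sets M" "L \<subseteq> C" "C \<subseteq> U" "measure M C = t"
proof -
  have fin: "F \<in> fmeasurable M" if "F \<subseteq> U" "F \<in> sets M" for F
    using sets that by (intro fmeasurableI2[of U M F] fmeasurableI) auto
  have fin': "emeasure M F \<noteq> \<top>" if "F \<subseteq> U" "F \<in> sets M" for F
    using fin[OF that] by (rule fmeasurableD2)
  have "measure M (U - L) = measure M U - measure M L"
    using sets fin' by (intro measure_Diff) auto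
  then obtain E where E: "E \<in> sets M" "E \<subseteq> U - L" "measure M E = t - measure M L"
    using atomless_subset_of_measure[OF M, of "U - L" "t - measure M L"] sets fin'[of "U - L"] t
    by (auto simp: less_top)
  have "measure M (L \<union> E) = measure M L + measure M E"
    using E sets fin'[of L] fin'[of E] by (intro measure_Union) auto
  then show ?thesis
    using E sets by (intro that[of "L \<union> E"]) auto
qed

section \<open>Cauchy's equation and set functions of the measure\<close>

text \<open>Nonnegativity makes an additive function monotone, which takes the place of continuity
  in Cauchy's equation. The product form of the conclusion covers \<open>L = 0\<close>.\<close>

lemma additive_on_interval_linear:
  fixes \<phi> :: "real \<Rightarrow> real"
  assumes add: "\<And>s t. 0 \<le> s \<Longrightarrow> 0 \<le> t \<Longrightarrow> s + t \<le> L \<Longrightarrow> \<phi> (s + t) = \<phi> s + \<phi> t"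
    and nonneg: "\<And>t. 0 \<le> t \<Longrightarrow> t \<le> L \<Longrightarrow> 0 \<le> \<phi> t"
    and t: "0 \<le> t" "t \<le> L"
  shows "L * \<phi> t = t * \<phi> L"
proof (cases "L = 0")
  case False
  then have L: "L > 0" using t by simp
  have mult: "\<phi> (real p * s) = real p * \<phi> s" if "0 \<le> s" "real p * s \<le> L" for p s
    using that(2)
  proof (induction p)
    case 0
    then show ?case using add[of 0 0] L by simp
  next
    case (Suc p)
    have "\<phi> (s + real p * s) = \<phi> s + \<phi> (real p * s)"
      using Suc that(1) by (intro add) (auto simp: algebra_simps)
    with Suc that(1) show ?case by (auto simp: algebra_simps)
  qed
  have mono: "\<phi> s \<le> \<phi> r" if "0 \<le> s" "s \<le> r" "r \<le> L" for s r
    using add[of s "r - s"] nonneg[of "r - s"] that by auto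
  have lower: "(r / L) * \<phi> L - \<phi> L / real (Suc q) \<le> \<phi> r" if r: "0 \<le> r" "r \<le> L" for r q
  proof -
    \<comment> \<open>Grid of mesh \<open>L / n\<close>: \<open>p\<close> counts the whole meshes
      that fit below \<open>r\<close>, so at most one mesh, worth \<open>\<phi> L / n\<close>, is
      lost.\<close>
    define n where "n = real (Suc q)"
    define p where "p = nat \<lfloor>n * r / L\<rfloor>"
    have n: "n > 0" by (simp add: n_def)
    have "n * r / L - 1 \<le> real p" "real p \<le> n * r / L"
      using r L n by (auto simp: p_def)
    then have p: "real p * (L / n) \<le> r" "(n * r / L - 1) / n \<le> real p / n"
      using n L by (simp add: field_simps, intro divide_right_mono) auto
    have "(n * r / L - 1) / n * \<phi> L \<le> real p / n * \<phi> L"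
      using p nonneg[of L] L by (intro mult_right_mono) auto
    also have "\<phi> L = n * \<phi> (L / n)"
      using mult[of "L / n" "Suc q"] L n unfolding n_def[symmetric] by simp
    also have "real p / n * (n * \<phi> (L / n)) = real p * \<phi> (L / n)"
      using n by simp
    also have "\<dots> = \<phi> (real p * (L / n))"
      using p r L n by (intro mult[symmetric]) auto
    also have "\<dots> \<le> \<phi> r"
      using p r L n by (intro mono) auto
    finally show ?thesis
      using n mult[of "L / n" "Suc q"] L unfolding n_def[symmetric]
      by (simp add: diff_divide_distrib left_diff_distrib)
  qed
  have lower': "(r / L) * \<phi> L \<le> \<phi> r" if "0 \<le> r" "r \<le> L" for r
  proof (rule LIMSEQ_le_const2)
    show "(\<lambda>q. (r / L) * \<phi> L - \<phi> L / real (Suc q)) \<longlonglongrightarrow> (r / L) * \<phi> L"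
      by real_asymp
  qed (use lower[OF that] in auto)
  \<comment> \<open>The lower bound at \<open>L - t\<close> is the upper bound at
    \<open>t\<close>.\<close>
  have "\<phi> t + \<phi> (L - t) = \<phi> L"
    using add[of t "L - t"] t by auto
  moreover have "((L - t) / L) * \<phi> L = \<phi> L - (t / L) * \<phi> L"
    using L by (simp add: field_simps)
  ultimately have "\<phi> t = (t / L) * \<phi> L"
    using lower'[of t] lower'[of "L - t"] t by linarith
  then show ?thesis using L by simp
qed (use t in auto)

text \<open>By \<open>eq\<close>, \<nu> is a function \<phi> of the measure. Every value between 0
  and \<open>measure M D\<close> is taken by a subset of \<open>D\<close>, so \<phi> satisfies
  Cauchy's equation on this interval. The lemma serves for expected masses, for the martingale
  identity and for the event \<open>W = 0\<close>.\<close>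

lemma additive_linear_in_measure:
  fixes \<nu> :: "'s set \<Rightarrow> real"
  assumes M: "atomless M" and D: "D \<in> sets M" "emeasure M D < \<infinity>"
    and nonneg: "\<And>C. C \<in> sets M \<Longrightarrow> C \<subseteq> D \<Longrightarrow> 0 \<le> \<nu> C"
    and add: "\<And>C C'. C \<in> sets M \<Longrightarrow> C' \<in> sets M \<Longrightarrow> C \<union> C' \<subseteq> D \<Longrightarrow> C \<inter> C' = {} \<Longrightarrow> \<nu> (C \<union> C') = \<nu> C + \<nu> C'"
    and eq: "\<And>C C'. C \<in> sets M \<Longrightarrow> C' \<in> sets M \<Longrightarrow> C \<union> C' \<subseteq> D \<Longrightarrow> measure M C = measure M C' \<Longrightarrow> \<nu> C = \<nu> C'"
    and C: "C \<in> sets M" "C \<subseteq> D"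
  shows "measure M D * \<nu> C = measure M C * \<nu> D"
proof -
  have fin: "F \<in> fmeasurable M" if "F \<subseteq> D" "F \<in> sets M" for F
    using D that by (intro fmeasurableI2[of D M F] fmeasurableI) auto
  have fin': "emeasure M F \<noteq> \<top>" if "F \<subseteq> D" "F \<in> sets M" for F
    using fin[OF that] by (rule fmeasurableD2)
  define \<phi> where "\<phi> t = \<nu> (SOME C. C \<in> sets M \<and> C \<subseteq> D \<and> measure M C = t)" for t
  have \<phi>: "\<phi> (measure M C) = \<nu> C" if "C \<in> sets M" "C \<subseteq> D" for C
  proof -
    define C' where "C' = (SOME E. E \<in> sets M \<and> E \<subseteq> D \<and> measure M E = measure M C)"
    have "C' \<in> sets M \<and> C' \<subseteq> D \<and> measure M C' = measure M C"
      unfolding C'_def using that by (rule_tac someI[of _ C]) auto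
    then show ?thesis
      unfolding \<phi>_def C'_def[symmetric] using that by (intro eq) auto
  qed
  have "measure M D * \<phi> (measure M C) = measure M C * \<phi> (measure M D)"
  proof (rule additive_on_interval_linear)
    fix s t :: real assume st: "0 \<le> s" "0 \<le> t" "s + t \<le> measure M D"
    obtain U where U: "U \<in> sets M" "U \<subseteq> D" "measure M U = s + t"
      using st by (auto intro: atomless_subset_of_measure[OF M D, of "s + t"])
    have "emeasure M U < \<infinity>" "s \<le> measure M U"
      using fin[OF U(2,1)] U st by (auto simp: fmeasurable_def)
    from atomless_subset_of_measure[OF M U(1) this(1) st(1) this(2)]
    obtain V where V: "V \<in> sets M" "V \<subseteq> U" "measure M V = s" .
    have "measure M (U - V) = t"
      using measure_Diff[OF _ U(1) V(1,2)] fmeasurableD2[OF fin[OF U(2,1)]] U(3) V(3) by simp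
    moreover have "\<nu> (V \<union> (U - V)) = \<nu> V + \<nu> (U - V)"
      using U V by (intro add) auto
    moreover have "V \<union> (U - V) = U"
      using V by auto
    ultimately show "\<phi> (s + t) = \<phi> s + \<phi> t"
      using U V \<phi>[of U] \<phi>[of V] \<phi>[of "U - V"] by (simp add: subset_trans[of _ U D] Diff_subset)
  next
    fix t :: real assume "0 \<le> t" "t \<le> measure M D"
    then obtain C where "C \<in> sets M" "C \<subseteq> D" "measure M C = t"
      by (rule atomless_subset_of_measure[OF M D])
    then show "0 \<le> \<phi> t"
      using \<phi>[of C] nonneg[of C] by auto
  next
    show "measure M C \<le> measure M D"
      by (rule measure_mono_fmeasurable[OF C(2,1) fin[OF order_refl D(1)]])
  qed auto
  then show ?thesis
    using \<phi>[of C] \<phi>[of D] C D by auto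
qed

section \<open>Laws determined by absolute moments of linear combinations\<close>

text \<open>Uniqueness in the Hausdorff moment problem: polynomials are uniformly dense in the
  continuous functions on the unit interval, and these determine the distribution function.\<close>

lemma finite_measure_eqI_moments:
  fixes N N' :: "real measure"
  assumes fin: "finite_measure N" "finite_measure N'"
    and sets[measurable_cong]: "sets N = sets borel" "sets N' = sets borel"
    and unit: "AE x in N. x \<in> {0..1}" "AE x in N'. x \<in> {0..1}"
    and moments: "\<And>k::nat. (\<integral>x. x ^ k \<partial>N) = (\<integral>x. x ^ k \<partial>N')"
  shows "N = N'"
proof -
  interpret N: finite_measure N by fact
  interpret N': finite_measure N' by fact
  have int_pow: "integrable N (\<lambda>x. x ^ k)" "integrable N' (\<lambda>x. x ^ k)" for k :: nat
    by (auto intro!: N.integrable_const_bound[where B=1] N'.integrable_const_bound[where B=1]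
        eventually_mono[OF unit(1)] eventually_mono[OF unit(2)] simp: power_le_one)
  have cont_eq: "(\<integral>x. f x \<partial>N) = (\<integral>x. f x \<partial>N')" if f: "continuous_on UNIV f" for f :: "real \<Rightarrow> real"
  proof -
    have [measurable]: "f \<in> borel_measurable borel"
      using f by (rule borel_measurable_continuous_onI)
    have "bounded (f ` {0..1})"
      using f by (intro compact_imp_bounded compact_continuous_image) (auto intro: continuous_on_subset)
    then obtain b where b: "\<And>x. x \<in> {0..1} \<Longrightarrow> \<bar>f x\<bar> \<le> b"
      unfolding bounded_iff by (metis image_eqI real_norm_def)
    have int_f: "integrable N f" "integrable N' f"
      using b by (auto intro!: N.integrable_const_bound[where B=b] N'.integrable_const_bound[where B=b]
        eventually_mono[OF unit(1)] eventually_mono[OF unit(2)])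
    have "\<bar>(\<integral>x. f x \<partial>N) - (\<integral>x. f x \<partial>N')\<bar> \<le> e * (measure N (space N) + measure N' (space N'))"
      if "e > 0" for e
    proof -
      obtain g where g: "real_polynomial_function g" "\<And>x. x \<in> {0..1} \<Longrightarrow> \<bar>f x - g x\<bar> < e"
        using Stone_Weierstrass_real_polynomial_function[of "{0..1::real}" f e] f \<open>e > 0\<close>
        by (auto intro: continuous_on_subset)
      obtain a m where gs: "g = (\<lambda>x. \<Sum>i\<le>m. a i * x ^ i)"
        using g(1) by (auto simp: real_polynomial_function_iff_sum)
      have int_g: "integrable N g" "integrable N' g"
        using int_pow by (auto simp: gs)
      have "(\<integral>x. g x \<partial>N) = (\<integral>x. g x \<partial>N')"
        using int_pow moments by (simp add: gs)
      moreover have "\<bar>(\<integral>x. f x \<partial>N) - (\<integral>x. g x \<partial>N)\<bar> \<le> e * measure N (space N)"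
      proof -
        have "\<bar>(\<integral>x. f x \<partial>N) - (\<integral>x. g x \<partial>N)\<bar> = \<bar>\<integral>x. f x - g x \<partial>N\<bar>"
          using int_f int_g by simp
        also have "\<dots> \<le> (\<integral>x. \<bar>f x - g x\<bar> \<partial>N)"
          by (rule integral_abs_bound)
        also have "\<dots> \<le> (\<integral>x. e \<partial>N)"
          using g int_f int_g by (intro integral_mono_AE eventually_mono[OF unit(1)]) (auto intro: less_imp_le)
        finally show ?thesis by (simp add: mult.commute)
      qed
      moreover have "\<bar>(\<integral>x. f x \<partial>N') - (\<integral>x. g x \<partial>N')\<bar> \<le> e * measure N' (space N')"
      proof -
        have "\<bar>(\<integral>x. f x \<partial>N') - (\<integral>x. g x \<partial>N')\<bar> = \<bar>\<integral>x. f x - g x \<partial>N'\<bar>"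
          using int_f int_g by simp
        also have "\<dots> \<le> (\<integral>x. \<bar>f x - g x\<bar> \<partial>N')"
          by (rule integral_abs_bound)
        also have "\<dots> \<le> (\<integral>x. e \<partial>N')"
          using g int_f int_g by (intro integral_mono_AE eventually_mono[OF unit(2)]) (auto intro: less_imp_le)
        finally show ?thesis by (simp add: mult.commute)
      qed
      ultimately show ?thesis by (simp add: distrib_left)
    qed
    note close = this
    define C where "C = measure N (space N) + measure N' (space N')"
    have C: "0 \<le> C"
      by (simp add: C_def)
    have "\<bar>(\<integral>x. f x \<partial>N) - (\<integral>x. f x \<partial>N')\<bar> \<le> 0 + e" if "e > 0" for e
    proof -
      \<comment> \<open>Division by \<open>C + 1\<close> since \<open>C\<close> is 0 for two zero
        measures.\<close>
      have "\<bar>(\<integral>x. f x \<partial>N) - (\<integral>x. f x \<partial>N')\<bar> \<le> e / (C + 1) * C"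
        using close[of "e / (C + 1)"] that C by (simp add: C_def[symmetric])
      also have "\<dots> \<le> e"
        using that C by (simp add: pos_divide_le_eq)
      finally show ?thesis by simp
    qed
    then have "\<bar>(\<integral>x. f x \<partial>N) - (\<integral>x. f x \<partial>N')\<bar> \<le> 0"
      by (rule field_le_epsilon)
    then show ?thesis by simp
  qed
  have "measure N {..a} = measure N' {..a}" for a
  proof -
    \<comment> \<open>Continuous ramps that fall from 1 at \<open>a\<close> to 0 at
      \<open>a + 1 / l\<close> and decrease to the indicator of \<open>{..a}\<close>.\<close>
    define f where "f l x = max 0 (min 1 (1 - real l * (x - a)))" for l :: nat and x
    have [measurable]: "f l \<in> borel_measurable borel" for l
      unfolding f_def by measurable
    have lim: "(\<lambda>l. f l x) \<longlonglongrightarrow> indicator {..a} x" for x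
    proof (cases "x \<le> a")
      case True
      then have "f l x = 1" for l
        using mult_nonneg_nonpos[of "real l" "x - a"] by (auto simp: f_def)
      then show ?thesis using True by simp
    next
      case False
      then have "eventually (\<lambda>l. real l \<ge> 1 / (x - a)) sequentially"
        using filterlim_real_sequentially by (auto simp: filterlim_at_top)
      then have "eventually (\<lambda>l. f l x = indicator {..a} x) sequentially"
        by eventually_elim (use False in \<open>auto simp: f_def field_simps\<close>)
      then show ?thesis by (rule tendsto_eventually)
    qed
    have "(\<lambda>l. \<integral>x. f l x \<partial>N) \<longlonglongrightarrow> (\<integral>x. indicator {..a} x \<partial>N)"
      by (rule integral_dominated_convergence[where w="\<lambda>_. 1"]) (use lim in \<open>auto simp: f_def\<close>)
    moreover have "(\<lambda>l. \<integral>x. f l x \<partial>N') \<longlonglongrightarrow> (\<integral>x. indicator {..a} x \<partial>N')"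
      by (rule integral_dominated_convergence[where w="\<lambda>_. 1"]) (use lim in \<open>auto simp: f_def\<close>)
    moreover have "(\<integral>x. f l x \<partial>N) = (\<integral>x. f l x \<partial>N')" for l
      unfolding f_def by (intro cont_eq continuous_intros)
    ultimately have "(\<integral>x. indicator {..a} x \<partial>N) = (\<integral>x. indicator {..a} x \<partial>N' :: real)"
      by (simp only: LIMSEQ_unique)
    then show ?thesis
      unfolding Bochner_Integration.integral_indicator
      by (simp add: sets_eq_imp_space_eq[OF sets(1)] sets_eq_imp_space_eq[OF sets(2)])
  qed
  then show ?thesis
    using fin sets sets_eq_imp_space_eq[OF sets(1)] sets_eq_imp_space_eq[OF sets(2)]
    by (intro cdf_unique') (auto simp: cdf_def fun_eq_iff finite_borel_measure_def finite_borel_measure_axioms_def)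
qed

text \<open>The convex function mapping \<open>t\<close> to the integral of
  \<open>\<bar>t + Z\<bar>\<close> has at \<open>- s\<close> the left derivative
  \<open>Q(space) - 2 Q(Z \<le> s)\<close>, so it determines the distribution function of
  \<open>Z\<close>.\<close>

lemma distr_eqI_abs_moments:
  fixes Z Z' :: "'w \<Rightarrow> real"
  assumes Q: "finite_measure Q" and int: "integrable Q Z" "integrable Q Z'"
    and eq: "\<And>t. (\<integral>\<omega>. \<bar>t + Z \<omega>\<bar> \<partial>Q) = (\<integral>\<omega>. \<bar>t + Z' \<omega>\<bar> \<partial>Q)"
  shows "distr Q borel Z = distr Q borel Z'"
proof -
  interpret finite_measure Q by fact
  have [measurable]: "Z \<in> borel_measurable Q" "Z' \<in> borel_measurable Q"
    using int by auto
  \<comment> \<open>The negative of the difference quotient of \<open>\<bar>t + z\<bar>\<close> from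
    the left at \<open>t = - s\<close>. It is bounded by 1, which gives dominated
    convergence.\<close>
  define d where "d z s n = real (Suc n) * (\<bar>z - s - 1 / real (Suc n)\<bar> - \<bar>z - s\<bar>)" for z s :: real and n
  have lim: "(\<lambda>n. d z s n) \<longlonglongrightarrow> 2 * indicator {..s} z - 1" for z s
  proof (cases "z \<le> s")
    case True
    then have "d z s n = real (Suc n) * (1 / real (Suc n))" for n
      unfolding d_def using divide_nonneg_pos[of 1 "real (Suc n)"]
      by (intro arg_cong[of _ _ "(*) (real (Suc n))"]) linarith
    then have "d z s n = 1" for n by simp
    then show ?thesis using True by simp
  next
    case False
    then have "eventually (\<lambda>n. real n \<ge> 1 / (z - s)) sequentially"
      using filterlim_real_sequentially by (auto simp: filterlim_at_top)
    then have "eventually (\<lambda>n. d z s n = -1) sequentially"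
    proof eventually_elim
      case (elim n)
      then have "z - s \<ge> 1 / real (Suc n)"
        using False by (auto simp: field_simps)
      then have "d z s n = real (Suc n) * (- (1 / real (Suc n)))"
        unfolding d_def using divide_nonneg_pos[of 1 "real (Suc n)"] False
        by (intro arg_cong[of _ _ "(*) (real (Suc n))"]) linarith
      then show ?case by simp
    qed
    then show ?thesis using False by (intro tendsto_eventually) auto
  qed
  have bound: "\<bar>d z s n\<bar> \<le> 1" for z s n
  proof -
    have "\<bar>\<bar>z - s - 1 / real (Suc n)\<bar> - \<bar>z - s\<bar>\<bar> \<le> 1 / real (Suc n)"
      by (rule order_trans[OF abs_triangle_ineq3]) simp
    then have "real (Suc n) * \<bar>\<bar>z - s - 1 / real (Suc n)\<bar> - \<bar>z - s\<bar>\<bar> \<le> 1"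
      by (simp add: field_simps)
    then show ?thesis
      by (simp add: d_def abs_mult)
  qed
  have cdf: "(\<lambda>n. \<integral>\<omega>. d (Y \<omega>) s n \<partial>Q) \<longlonglongrightarrow> 2 * measure Q {\<omega>\<in>space Q. Y \<omega> \<le> s} - measure Q (space Q)"
    if [measurable]: "Y \<in> borel_measurable Q" for Y :: "'w \<Rightarrow> real" and s
  proof -
    have "(\<lambda>n. \<integral>\<omega>. d (Y \<omega>) s n \<partial>Q) \<longlonglongrightarrow> (\<integral>\<omega>. 2 * indicator {\<omega>\<in>space Q. Y \<omega> \<le> s} \<omega> - 1 \<partial>Q)"
    proof (rule integral_dominated_convergence[where w="\<lambda>_. 1"])
      show "AE \<omega> in Q. (\<lambda>n. d (Y \<omega>) s n) \<longlonglongrightarrow> 2 * indicator {\<omega>\<in>space Q. Y \<omega> \<le> s} \<omega> - 1"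
        using lim by (intro AE_I2) (auto simp: indicator_def split: if_splits)
      show "(\<lambda>\<omega>. d (Y \<omega>) s n) \<in> borel_measurable Q" for n
        unfolding d_def by measurable
    qed (use bound in auto)
    also have "(\<integral>\<omega>. 2 * indicator {\<omega>\<in>space Q. Y \<omega> \<le> s} \<omega> - 1 \<partial>Q)
        = (\<integral>\<omega>. 2 * indicator {\<omega>\<in>space Q. Y \<omega> \<le> s} \<omega> \<partial>Q) - (\<integral>\<omega>. (1::real) \<partial>Q)"
      by (intro Bochner_Integration.integral_diff integrable_mult_right integrable_real_indicator)
        (auto simp: less_top[symmetric])
    also have "\<dots> = 2 * measure Q ({\<omega>\<in>space Q. Y \<omega> \<le> s} \<inter> space Q) - measure Q (space Q)"
      by (simp only: Bochner_Integration.integral_mult_right_zero Bochner_Integration.integral_indicator lebesgue_integral_const) simp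
    also have "{\<omega>\<in>space Q. Y \<omega> \<le> s} \<inter> space Q = {\<omega>\<in>space Q. Y \<omega> \<le> s}"
      by blast
    finally show ?thesis .
  qed
  have d_eq: "(\<integral>\<omega>. d (Z \<omega>) s n \<partial>Q) = (\<integral>\<omega>. d (Z' \<omega>) s n \<partial>Q)" for s n
    using int eq[of "- s - 1 / real (Suc n)"] eq[of "- s"]
    by (simp add: d_def algebra_simps)
  have "measure Q {\<omega>\<in>space Q. Z \<omega> \<le> s} = measure Q {\<omega>\<in>space Q. Z' \<omega> \<le> s}" for s
    using LIMSEQ_unique[OF cdf[of Z s] cdf[of Z' s, folded d_eq]] by simp
  then show ?thesis
    by (intro cdf_unique')
      (auto simp: cdf_def fun_eq_iff finite_borel_measure_def finite_borel_measure_axioms_def measure_distr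
        vimage_def Int_def conj_commute intro!: finite_measure_distr)
qed

text \<open>Brings the measure of a rectangle into the form of the integrals that the induction of
  the next lemma ends with.\<close>

lemma emeasure_distr_vector:
  fixes U :: "nat \<Rightarrow> 'w \<Rightarrow> real" and A :: "nat \<Rightarrow> real set"
  assumes Q: "finite_measure Q" and U: "\<And>j. j < n \<Longrightarrow> U j \<in> borel_measurable Q" and A: "\<And>j. j < n \<Longrightarrow> A j \<in> sets borel"
  shows "emeasure (distr Q (\<Pi>\<^sub>M j\<in>{..<n}. borel) (\<lambda>\<omega>. \<lambda>j\<in>{..<n}. U j \<omega>)) (Pi\<^sub>E {..<n} A)
    = ennreal (\<integral>\<omega>. (\<Prod>j<n. indicator (A j) (U j \<omega>)) \<partial>Q)"
proof -
  interpret finite_measure Q by fact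
  let ?S = "{\<omega>\<in>space Q. \<forall>j<n. U j \<omega> \<in> A j}"
  have vimage: "(\<lambda>\<omega>. \<lambda>j\<in>{..<n}. U j \<omega>) -` (Pi\<^sub>E {..<n} A) \<inter> space Q = ?S"
    by (simp add: PiE_iff vimage_def Int_def Ball_def conj_commute cong: conj_cong)
  have meas_U: "(\<lambda>\<omega>. \<lambda>j\<in>{..<n}. U j \<omega>) \<in> measurable Q (\<Pi>\<^sub>M j\<in>{..<n}. borel)"
    using U by (intro measurable_restrict) auto
  have PiE: "Pi\<^sub>E {..<n} A \<in> sets (\<Pi>\<^sub>M j\<in>{..<n}. borel)"
    using A by (intro sets_PiM_I_finite) auto
  have S: "?S \<inter> space Q = ?S"
    by (rule Int_absorb2) blast
  have "measure Q ?S = (\<integral>\<omega>. indicator ?S \<omega> \<partial>Q)"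
    using Bochner_Integration.integral_indicator[of Q ?S] unfolding S by (rule sym)
  also have "\<dots> = (\<integral>\<omega>. (\<Prod>j<n. indicator (A j) (U j \<omega>)) \<partial>Q)"
  proof (intro Bochner_Integration.integral_cong refl)
    fix \<omega> assume \<omega>: "\<omega> \<in> space Q"
    show "indicator ?S \<omega> = (\<Prod>j<n. indicator (A j) (U j \<omega>) :: real)"
    proof (cases "\<forall>j<n. U j \<omega> \<in> A j")
      case True
      then show ?thesis using \<omega> by simp
    next
      case False
      then obtain j where "j < n" "U j \<omega> \<notin> A j" by blast
      then have "(\<Prod>j<n. indicator (A j) (U j \<omega>) :: real) = 0"
        by (intro prod_zero) (auto intro!: bexI[of _ j])
      with False show ?thesis by simp
    qed
  qed
  finally show ?thesis
    unfolding emeasure_distr[OF meas_U PiE] vimage emeasure_eq_measure by simp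
qed

text \<open>The laws of the linear combinations give the multivariate Laplace transform at all
  integer points, that is, the mixed moments of the variables \<open>exp (- Y j)\<close>.
  Nonnegativity keeps these in the unit interval, where moments determine a law, and the coordinates
  can be treated one after the other.\<close>

lemma distr_vector_eqI_abs_moments:
  fixes Y Y' :: "nat \<Rightarrow> 'w \<Rightarrow> real"
  assumes Q: "finite_measure Q"
    and int: "\<And>j. j < n \<Longrightarrow> integrable Q (Y j)" "\<And>j. j < n \<Longrightarrow> integrable Q (Y' j)"
    and nonneg: "\<And>j \<omega>. 0 \<le> Y j \<omega>" "\<And>j \<omega>. 0 \<le> Y' j \<omega>"
    and eq: "\<And>t u. (\<integral>\<omega>. \<bar>t + (\<Sum>j<n. u j * Y j \<omega>)\<bar> \<partial>Q) = (\<integral>\<omega>. \<bar>t + (\<Sum>j<n. u j * Y' j \<omega>)\<bar> \<partial>Q)"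
  shows "distr Q (\<Pi>\<^sub>M j\<in>{..<n}. borel) (\<lambda>\<omega>. \<lambda>j\<in>{..<n}. Y j \<omega>) = distr Q (\<Pi>\<^sub>M j\<in>{..<n}. borel) (\<lambda>\<omega>. \<lambda>j\<in>{..<n}. Y' j \<omega>)"
proof -
  interpret finite_measure Q by fact
  have meas: "Y j \<in> borel_measurable Q" "Y' j \<in> borel_measurable Q" if "j < n" for j
    using int[OF that] by auto
  \<comment> \<open>Interpolates between the two kinds of data: the first \<open>m\<close>
    coordinates are tested by indicators, the others still by powers of \<open>exp (- U j)\<close>.
    The case \<open>m = 0\<close> is the Laplace transform, \<open>m = n\<close> is a
    rectangle.\<close>
  define F where "F U m A k \<omega> = (\<Prod>j<m. indicator (A j) (U j \<omega>)) * (\<Prod>j\<in>{m..<n}. exp (- U j \<omega>) ^ k j)"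
    for U :: "nat \<Rightarrow> 'w \<Rightarrow> real" and m and A :: "nat \<Rightarrow> real set" and k :: "nat \<Rightarrow> nat" and \<omega>
  have "(\<integral>\<omega>. F Y m A k \<omega> \<partial>Q) = (\<integral>\<omega>. F Y' m A k \<omega> \<partial>Q)"
    if "m \<le> n" "\<And>j. j < m \<Longrightarrow> A j \<in> sets borel" for m A k
    using that
  proof (induction m arbitrary: A k)
    case 0
    have F0: "F U 0 A k \<omega> = exp (- (\<Sum>j<n. real (k j) * U j \<omega>))" for U \<omega>
      unfolding F_def sum_negf[symmetric]
      by (subst exp_sum) (simp_all add: atLeast0LessThan exp_of_nat_mult[symmetric])
    have "distr Q borel (\<lambda>\<omega>. \<Sum>j<n. real (k j) * Y j \<omega>) = distr Q borel (\<lambda>\<omega>. \<Sum>j<n. real (k j) * Y' j \<omega>)"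
      by (rule distr_eqI_abs_moments[OF Q _ _ eq]) (auto intro!: int)
    then have "(\<integral>z. exp (- z) \<partial>distr Q borel (\<lambda>\<omega>. \<Sum>j<n. real (k j) * Y j \<omega>))
        = (\<integral>z. exp (- z) \<partial>distr Q borel (\<lambda>\<omega>. \<Sum>j<n. real (k j) * Y' j \<omega>))"
      by simp
    then show ?case
      using meas by (simp add: integral_distr F0)
  next
    case (Suc m)
    define w where "w U \<omega> = (\<Prod>j<m. indicator (A j) (U j \<omega>)) * (\<Prod>j\<in>{Suc m..<n}. exp (- U j \<omega>) ^ k j)"
      for U :: "nat \<Rightarrow> 'w \<Rightarrow> real" and \<omega>
    \<comment> \<open>The law of \<open>exp (- U m)\<close> weighted by the factors of all other
      coordinates. Its \<open>l\<close>-th moment is an instance of the induction hypothesis with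
      \<open>k(m := l)\<close>.\<close>
    define N where "N U = distr (density Q (w U)) borel (\<lambda>\<omega>. exp (- U m \<omega>))" for U
    have m: "m < n" using Suc by simp
    have split: "{m..<n} = insert m {Suc m..<n}"
      using m by auto
    have wF: "F U m A (k(m := l)) \<omega> = w U \<omega> * exp (- U m \<omega>) ^ l" for U l \<omega>
      unfolding F_def w_def split by (simp add: mult_ac)
    have N: "finite_measure (N U) \<and> sets (N U) = sets borel \<and> (AE x in N U. x \<in> {0..1})
        \<and> (\<forall>g\<in>borel_measurable borel. (\<integral>x. g x \<partial>N U) = (\<integral>\<omega>. w U \<omega> * g (exp (- U m \<omega>)) \<partial>Q))"
      if U: "\<And>j. j < n \<Longrightarrow> U j \<in> borel_measurable Q" "\<And>j \<omega>. 0 \<le> U j \<omega>" for U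
    proof -
      have [measurable]: "w U \<in> borel_measurable Q"
      proof -
        have "(\<lambda>\<omega>. indicator (A j) (U j \<omega>) :: real) \<in> borel_measurable Q" if "j < m" for j
          using that m Suc.prems by (intro measurable_compose[OF U(1) borel_measurable_indicator]) auto
        then show ?thesis
          unfolding w_def[abs_def] using U
          by (intro borel_measurable_times borel_measurable_prod borel_measurable_power borel_measurable_exp
            borel_measurable_uminus) auto
      qed
      have [measurable]: "U m \<in> borel_measurable Q"
        using U m by auto
      have w: "0 \<le> w U \<omega>" "w U \<omega> \<le> 1" for \<omega>
        unfolding w_def using U
        by (auto intro!: mult_nonneg_nonneg prod_nonneg mult_le_one prod_le_1 power_le_one)
      have "finite_measure (density Q (w U))"
      proof (rule finite_measureI)
        have "emeasure (density Q (w U)) (space (density Q (w U))) = (\<integral>\<^sup>+\<omega>. w U \<omega> \<partial>Q)"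
          by (simp add: emeasure_density cong: nn_integral_cong_simp)
        also have "\<dots> \<le> (\<integral>\<^sup>+\<omega>. 1 \<partial>Q)"
          using w by (intro nn_integral_mono) auto
        also have "\<dots> < \<infinity>"
          by (simp add: less_top[symmetric])
        finally show "emeasure (density Q (w U)) (space (density Q (w U))) \<noteq> \<infinity>"
          by simp
      qed
      then have "finite_measure (N U)"
        unfolding N_def by (rule finite_measure.finite_measure_distr) simp
      moreover have "AE x in N U. x \<in> {0..1}"
        unfolding N_def using U by (subst AE_distr_iff) auto
      moreover have "(\<integral>x. g x \<partial>N U) = (\<integral>\<omega>. w U \<omega> * g (exp (- U m \<omega>)) \<partial>Q)"
        if [measurable]: "g \<in> borel_measurable borel" for g :: "real \<Rightarrow> real"
        unfolding N_def using w by (simp add: integral_distr integral_density)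
      ultimately show ?thesis
        by (simp add: N_def)
    qed
    note NY = N[of Y, OF meas(1) nonneg(1)] and NY' = N[of Y', OF meas(2) nonneg(2)]
    note int_N = NY[THEN conjunct2, THEN conjunct2, THEN conjunct2, rule_format]
      NY'[THEN conjunct2, THEN conjunct2, THEN conjunct2, rule_format]
    have "N Y = N Y'"
    proof (rule finite_measure_eqI_moments)
      fix l :: nat
      have pow: "(\<lambda>x. x ^ l) \<in> borel_measurable (borel :: real measure)"
        by measurable
      have "(\<integral>x. x ^ l \<partial>N Y) = (\<integral>\<omega>. F Y m A (k(m := l)) \<omega> \<partial>Q)"
        unfolding wF by (rule int_N(1)[OF _ pow])
      also have "\<dots> = (\<integral>\<omega>. F Y' m A (k(m := l)) \<omega> \<partial>Q)"
        using Suc.prems by (intro Suc.IH) auto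
      also have "\<dots> = (\<integral>x. x ^ l \<partial>N Y')"
        unfolding wF by (rule int_N(2)[OF _ pow, symmetric])
      finally show "(\<integral>x. x ^ l \<partial>N Y) = (\<integral>x. x ^ l \<partial>N Y')" .
    qed (use NY NY' in \<open>blast+\<close>)
    \<comment> \<open>The logarithm undoes the exponential, so that integrating \<open>g\<close>
      turns coordinate \<open>m\<close> into an indicator factor.\<close>
    define g where "g x = (indicator (A m) (- ln x) :: real)" for x :: real
    have g: "g \<in> borel_measurable borel"
      using Suc.prems unfolding g_def by measurable
    have "(\<integral>\<omega>. w Y \<omega> * g (exp (- Y m \<omega>)) \<partial>Q) = (\<integral>x. g x \<partial>N Y)"
      by (rule int_N(1)[OF _ g, symmetric])
    also have "\<dots> = (\<integral>\<omega>. w Y' \<omega> * g (exp (- Y' m \<omega>)) \<partial>Q)"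
      unfolding \<open>N Y = N Y'\<close> by (rule int_N(2)[OF _ g])
    finally have "(\<integral>\<omega>. w Y \<omega> * g (exp (- Y m \<omega>)) \<partial>Q) = (\<integral>\<omega>. w Y' \<omega> * g (exp (- Y' m \<omega>)) \<partial>Q)" .
    then show ?case
      by (simp add: F_def w_def g_def mult_ac)
  qed
  note eq_F = this
  have eqF: "(\<integral>\<omega>. (\<Prod>j<n. indicator (A j) (Y j \<omega>)) \<partial>Q) = (\<integral>\<omega>. (\<Prod>j<n. indicator (A j) (Y' j \<omega>) :: real) \<partial>Q)"
    if "\<And>j. j < n \<Longrightarrow> A j \<in> sets borel" for A
    using eq_F[OF order_refl that] unfolding F_def by simp
  show ?thesis
  proof (rule measure_eqI_PiM_finite[where I="{..<n}" and M="\<lambda>_. borel" and A="\<lambda>_. Pi\<^sub>E {..<n} (\<lambda>_. UNIV)"])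
    fix A :: "nat \<Rightarrow> real set" assume A: "\<And>i. i \<in> {..<n} \<Longrightarrow> A i \<in> sets borel"
    then have A': "\<And>j. j < n \<Longrightarrow> A j \<in> sets borel"
      by simp
    show "emeasure (distr Q (\<Pi>\<^sub>M j\<in>{..<n}. borel) (\<lambda>\<omega>. \<lambda>j\<in>{..<n}. Y j \<omega>)) (Pi\<^sub>E {..<n} A)
        = emeasure (distr Q (\<Pi>\<^sub>M j\<in>{..<n}. borel) (\<lambda>\<omega>. \<lambda>j\<in>{..<n}. Y' j \<omega>)) (Pi\<^sub>E {..<n} A)"
    proof -
      have "emeasure (distr Q (\<Pi>\<^sub>M j\<in>{..<n}. borel) (\<lambda>\<omega>. \<lambda>j\<in>{..<n}. Y j \<omega>)) (Pi\<^sub>E {..<n} A)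
          = ennreal (\<integral>\<omega>. (\<Prod>j<n. indicator (A j) (Y j \<omega>)) \<partial>Q)"
        by (rule emeasure_distr_vector) (fact Q meas A')+
      also have "\<dots> = ennreal (\<integral>\<omega>. (\<Prod>j<n. indicator (A j) (Y' j \<omega>)) \<partial>Q)"
        by (rule arg_cong[OF eqF]) (fact A')
      also have "\<dots> = emeasure (distr Q (\<Pi>\<^sub>M j\<in>{..<n}. borel) (\<lambda>\<omega>. \<lambda>j\<in>{..<n}. Y' j \<omega>)) (Pi\<^sub>E {..<n} A)"
        by (rule emeasure_distr_vector[symmetric]) (fact Q meas A')+
      finally show ?thesis .
    qed
  next
    show "emeasure (distr Q (\<Pi>\<^sub>M j\<in>{..<n}. borel) (\<lambda>\<omega>. \<lambda>j\<in>{..<n}. Y j \<omega>)) (Pi\<^sub>E {..<n} (\<lambda>_. UNIV)) \<noteq> \<infinity>"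
    proof -
      have "emeasure (distr Q (\<Pi>\<^sub>M j\<in>{..<n}. borel) (\<lambda>\<omega>. \<lambda>j\<in>{..<n}. Y j \<omega>)) (Pi\<^sub>E {..<n} (\<lambda>_. UNIV))
          = ennreal (\<integral>\<omega>. (\<Prod>j<n. indicator UNIV (Y j \<omega>)) \<partial>Q)"
        by (rule emeasure_distr_vector) (fact Q meas sets.top | simp)+
      then show ?thesis by (simp only: ennreal_neq_top infinity_ennreal_def not_False_eq_True)
    qed
    have "Pi\<^sub>E {..<n} (\<lambda>_. UNIV :: real set) \<in> prod_algebra {..<n} (\<lambda>_. borel)"
      by (rule prod_algebraI_finite) simp_all
    then show "range (\<lambda>_::nat. Pi\<^sub>E {..<n} (\<lambda>_. UNIV :: real set)) \<subseteq> prod_algebra {..<n} (\<lambda>_. borel)"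
      by (rule_tac image_subsetI)
    show "(\<Union>i::nat. Pi\<^sub>E {..<n} (\<lambda>_. UNIV :: real set)) = space (\<Pi>\<^sub>M j\<in>{..<n}. borel)"
      by (simp add: space_PiM)
  qed (rule finite_lessThan sets_distr)+
qed

section \<open>Weights that may vanish\<close>

text \<open>As \<open>t\<close> grows, \<open>t * W\<close> dominates \<open>Z\<close> wherever
  \<open>W\<close> is positive. What survives of the symmetrised absolute value after subtracting
  \<open>2 * t * W\<close> is \<open>2 * \<bar>Z\<bar>\<close> on the event
  \<open>W = 0\<close>.\<close>

lemma integral_abs_on_zero_eq:
  fixes W Z Z' :: "'w \<Rightarrow> real"
  assumes W: "integrable P W" "\<And>\<omega>. 0 \<le> W \<omega>" and Z: "integrable P Z" "integrable P Z'"
    and eq: "\<And>t. (\<integral>\<omega>. \<bar>t * W \<omega> + Z \<omega>\<bar> \<partial>P) = (\<integral>\<omega>. \<bar>t * W \<omega> + Z' \<omega>\<bar> \<partial>P)"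
  shows "(\<integral>\<omega>. \<bar>Z \<omega>\<bar> * indicator {0} (W \<omega>) \<partial>P) = (\<integral>\<omega>. \<bar>Z' \<omega>\<bar> * indicator {0} (W \<omega>) \<partial>P)"
proof -
  \<comment> \<open>For \<open>t \<ge> 0\<close> this is
    \<open>2 * max 0 (\<bar>U \<omega>\<bar> - t * W \<omega>)\<close>: bounded by
    \<open>2 * \<bar>U \<omega>\<bar>\<close>, and eventually 0 where \<open>W\<close> is
    positive.\<close>
  define h where "h U t \<omega> = \<bar>t * W \<omega> + U \<omega>\<bar> + \<bar>- t * W \<omega> + U \<omega>\<bar> - 2 * t * W \<omega>" for U :: "'w \<Rightarrow> real" and t \<omega>
  have "(\<lambda>n. \<integral>\<omega>. h U (real n) \<omega> \<partial>P) \<longlonglongrightarrow> (\<integral>\<omega>. 2 * (\<bar>U \<omega>\<bar> * indicator {0} (W \<omega>)) \<partial>P)"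
    if U: "integrable P U" for U
  proof (rule integral_dominated_convergence[where w="\<lambda>\<omega>. 2 * \<bar>U \<omega>\<bar>"])
    have [measurable]: "W \<in> borel_measurable P" "U \<in> borel_measurable P"
      using W U by auto
    show "(\<lambda>\<omega>. 2 * (\<bar>U \<omega>\<bar> * indicator {0} (W \<omega>))) \<in> borel_measurable P"
      by measurable
    show "h U (real n) \<in> borel_measurable P" for n
      unfolding h_def by measurable
    show "integrable P (\<lambda>\<omega>. 2 * \<bar>U \<omega>\<bar>)"
      using U by auto
    show "AE \<omega> in P. norm (h U (real n) \<omega>) \<le> 2 * \<bar>U \<omega>\<bar>" for n
    proof (rule AE_I2)
      fix \<omega>
      have "0 \<le> real n * W \<omega>"
        using W by simp
      then show "norm (h U (real n) \<omega>) \<le> 2 * \<bar>U \<omega>\<bar>"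
        unfolding h_def real_norm_def mult_minus_left by linarith
    qed
    show "AE \<omega> in P. (\<lambda>n. h U (real n) \<omega>) \<longlonglongrightarrow> 2 * (\<bar>U \<omega>\<bar> * indicator {0} (W \<omega>))"
    proof (rule AE_I2)
      fix \<omega>
      show "(\<lambda>n. h U (real n) \<omega>) \<longlonglongrightarrow> 2 * (\<bar>U \<omega>\<bar> * indicator {0} (W \<omega>))"
      proof (cases "W \<omega> = 0")
        case True
        then show ?thesis by (simp add: h_def)
      next
        case False
        then have pos: "W \<omega> > 0"
          using W(2)[of \<omega>] by simp
        have "eventually (\<lambda>n. real n \<ge> \<bar>U \<omega>\<bar> / W \<omega>) sequentially"
          using filterlim_real_sequentially by (auto simp: filterlim_at_top)
        then have "eventually (\<lambda>n. h U (real n) \<omega> = 0) sequentially"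
        proof eventually_elim
          case (elim n)
          then have "\<bar>U \<omega>\<bar> \<le> real n * W \<omega>"
            using pos by (simp add: pos_divide_le_eq)
          then show ?case
            unfolding h_def mult_minus_left by linarith
        qed
        then show ?thesis using pos by (intro tendsto_eventually) auto
      qed
    qed
  qed
  from this[OF Z(1)] this[OF Z(2)]
  have lim: "(\<lambda>n. \<integral>\<omega>. h Z (real n) \<omega> \<partial>P) \<longlonglongrightarrow> 2 * (\<integral>\<omega>. \<bar>Z \<omega>\<bar> * indicator {0} (W \<omega>) \<partial>P)"
    "(\<lambda>n. \<integral>\<omega>. h Z' (real n) \<omega> \<partial>P) \<longlonglongrightarrow> 2 * (\<integral>\<omega>. \<bar>Z' \<omega>\<bar> * indicator {0} (W \<omega>) \<partial>P)"
    by simp_all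
  have h: "(\<integral>\<omega>. h U t \<omega> \<partial>P) = (\<integral>\<omega>. \<bar>t * W \<omega> + U \<omega>\<bar> \<partial>P) + (\<integral>\<omega>. \<bar>- t * W \<omega> + U \<omega>\<bar> \<partial>P) - (\<integral>\<omega>. 2 * t * W \<omega> \<partial>P)"
    if "integrable P U" for U t
    using that W unfolding h_def by (subst Bochner_Integration.integral_diff Bochner_Integration.integral_add; auto)+
  have "(\<integral>\<omega>. h Z (real n) \<omega> \<partial>P) = (\<integral>\<omega>. h Z' (real n) \<omega> \<partial>P)" for n
    unfolding h[OF Z(1)] h[OF Z(2)] eq ..
  with lim show ?thesis
    using LIMSEQ_unique by fastforce
qed

text \<open>The integrals over the set where \<open>W\<close> vanishes, which the density does not see, have to be
  cancelled on both sides.\<close>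

lemma distr_weighted_eqI_abs_moments:
  fixes Y Y' :: "nat \<Rightarrow> 'w \<Rightarrow> real" and W :: "'w \<Rightarrow> real"
  assumes W: "integrable P W" "\<And>\<omega>. 0 \<le> W \<omega>"
    and int: "\<And>j. j < n \<Longrightarrow> integrable P (Y j)" "\<And>j. j < n \<Longrightarrow> integrable P (Y' j)"
    and nonneg: "\<And>j \<omega>. 0 \<le> Y j \<omega>" "\<And>j \<omega>. 0 \<le> Y' j \<omega>"
    and eq: "\<And>t u. (\<integral>\<omega>. \<bar>t * W \<omega> + (\<Sum>j<n. u j * Y j \<omega>)\<bar> \<partial>P) = (\<integral>\<omega>. \<bar>t * W \<omega> + (\<Sum>j<n. u j * Y' j \<omega>)\<bar> \<partial>P)"
  shows "distr (density P W) (\<Pi>\<^sub>M j\<in>{..<n}. borel) (\<lambda>\<omega>. \<lambda>j\<in>{..<n}. Y j \<omega> / W \<omega>)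
    = distr (density P W) (\<Pi>\<^sub>M j\<in>{..<n}. borel) (\<lambda>\<omega>. \<lambda>j\<in>{..<n}. Y' j \<omega> / W \<omega>)"
proof (rule distr_vector_eqI_abs_moments[where Y="\<lambda>j \<omega>. Y j \<omega> / W \<omega>" and Y'="\<lambda>j \<omega>. Y' j \<omega> / W \<omega>"])
  have [measurable]: "W \<in> borel_measurable P"
    using W by auto
  show "finite_measure (density P W)"
  proof (rule finite_measureI)
    have "emeasure (density P W) (space (density P W)) = (\<integral>\<^sup>+\<omega>. W \<omega> \<partial>P)"
      by (simp add: emeasure_density cong: nn_integral_cong_simp)
    also have "\<dots> < \<infinity>"
      using W by (subst nn_integral_eq_integral) auto
    finally show "emeasure (density P W) (space (density P W)) \<noteq> \<infinity>"
      by simp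
  qed
  have int': "integrable (density P W) (\<lambda>\<omega>. U \<omega> / W \<omega>)" if U: "integrable P U" for U
  proof -
    have [measurable]: "U \<in> borel_measurable P"
      using U by auto
    \<comment> \<open>The product is \<open>U\<close> off the zeros of \<open>W\<close> and 0 on
      them, because \<open>x / 0 = 0\<close>.\<close>
    have "integrable P (\<lambda>\<omega>. W \<omega> * (U \<omega> / W \<omega>))"
      by (rule Bochner_Integration.integrable_bound[OF U]) auto
    then show ?thesis
      using W by (subst integrable_density) auto
  qed
  show "integrable (density P W) (\<lambda>\<omega>. Y j \<omega> / W \<omega>)" "integrable (density P W) (\<lambda>\<omega>. Y' j \<omega> / W \<omega>)" if "j < n" for j
    using int[OF that] by (auto intro: int')
  show "0 \<le> Y j \<omega> / W \<omega>" "0 \<le> Y' j \<omega> / W \<omega>" for j \<omega>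
    using W nonneg by auto
  fix t :: real and u :: "nat \<Rightarrow> real"
  define Z Z' where "Z \<omega> = (\<Sum>j<n. u j * Y j \<omega>)" and "Z' \<omega> = (\<Sum>j<n. u j * Y' j \<omega>)" for \<omega>
  have Z: "integrable P Z" "integrable P Z'"
    unfolding Z_def[abs_def] Z'_def[abs_def] using int by auto
  have eqZ: "(\<integral>\<omega>. \<bar>t * W \<omega> + Z \<omega>\<bar> \<partial>P) = (\<integral>\<omega>. \<bar>t * W \<omega> + Z' \<omega>\<bar> \<partial>P)" for t
    using eq by (simp add: Z_def Z'_def)
  have zero: "(\<integral>\<omega>. \<bar>Z \<omega>\<bar> * indicator {0} (W \<omega>) \<partial>P) = (\<integral>\<omega>. \<bar>Z' \<omega>\<bar> * indicator {0} (W \<omega>) \<partial>P)"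
    by (rule integral_abs_on_zero_eq[OF W Z eqZ])
  \<comment> \<open>The factor \<open>W\<close> cancels only where it is positive. Where it
    vanishes, the first integrand on the right is \<open>\<bar>U\<bar>\<close>, and the subtracted
    integral removes it.\<close>
  have dens: "(\<integral>\<omega>. \<bar>t + U \<omega> / W \<omega>\<bar> \<partial>density P W) = (\<integral>\<omega>. \<bar>t * W \<omega> + U \<omega>\<bar> \<partial>P) - (\<integral>\<omega>. \<bar>U \<omega>\<bar> * indicator {0} (W \<omega>) \<partial>P)"
    if U: "integrable P U" for U
  proof -
    have [measurable]: "U \<in> borel_measurable P"
      using U by auto
    have "integrable P (\<lambda>\<omega>. \<bar>U \<omega>\<bar> * indicator {0} (W \<omega>))"
      by (rule Bochner_Integration.integrable_bound[OF U]) (auto simp: indicator_def)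
    then have "(\<integral>\<omega>. \<bar>t * W \<omega> + U \<omega>\<bar> \<partial>P) - (\<integral>\<omega>. \<bar>U \<omega>\<bar> * indicator {0} (W \<omega>) \<partial>P)
        = (\<integral>\<omega>. \<bar>t * W \<omega> + U \<omega>\<bar> - \<bar>U \<omega>\<bar> * indicator {0} (W \<omega>) \<partial>P)"
      using U W by (intro Bochner_Integration.integral_diff[symmetric]) auto
    also have "\<dots> = (\<integral>\<omega>. W \<omega> * \<bar>t + U \<omega> / W \<omega>\<bar> \<partial>P)"
    proof (intro Bochner_Integration.integral_cong refl)
      fix \<omega>
      show "\<bar>t * W \<omega> + U \<omega>\<bar> - \<bar>U \<omega>\<bar> * indicator {0} (W \<omega>) = W \<omega> * \<bar>t + U \<omega> / W \<omega>\<bar>"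
      proof (cases "W \<omega> = 0")
        case False
        then have "t * W \<omega> + U \<omega> = W \<omega> * (t + U \<omega> / W \<omega>)"
          by (simp add: field_simps)
        then show ?thesis
          using False W(2)[of \<omega>] by (simp add: abs_mult)
      qed simp
    qed
    also have "\<dots> = (\<integral>\<omega>. \<bar>t + U \<omega> / W \<omega>\<bar> \<partial>density P W)"
      using W by (subst integral_density) auto
    finally show ?thesis ..
  qed
  have "(\<Sum>j<n. u j * (Y j \<omega> / W \<omega>)) = Z \<omega> / W \<omega>" "(\<Sum>j<n. u j * (Y' j \<omega> / W \<omega>)) = Z' \<omega> / W \<omega>" for \<omega>
    by (simp_all add: Z_def Z'_def sum_divide_distrib)
  then show "(\<integral>\<omega>. \<bar>t + (\<Sum>j<n. u j * (Y j \<omega> / W \<omega>))\<bar> \<partial>density P W) = (\<integral>\<omega>. \<bar>t + (\<Sum>j<n. u j * (Y' j \<omega> / W \<omega>))\<bar> \<partial>density P W)"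
    using dens[OF Z(1)] dens[OF Z(2)] eqZ zero by simp
qed

section \<open>Reversed martingales\<close>

text \<open>\<open>Inf S\<close> is the limes inferior, kept finite by \<open>nonneg\<close> and
  \<open>k\<close>. If values at or above \<open>b > Inf S\<close> recurred, the sequence would
  oscillate between two rationals chosen between \<open>Inf S\<close> and \<open>b\<close>.\<close>

lemma convergent_if_not_oscillating:
  fixes x :: "nat \<Rightarrow> real"
  assumes osc: "\<forall>a\<in>\<rat>. \<forall>b\<in>\<rat>. a < b \<longrightarrow> \<not> ((\<exists>\<^sub>F n in sequentially. b \<le> x n) \<and> (\<exists>\<^sub>F n in sequentially. x n \<le> a))"
    and nonneg: "\<And>n. 0 \<le> x n" and k: "\<exists>\<^sub>F n in sequentially. x n \<le> k"
  shows "convergent x"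
proof -
  define S where "S = {a. \<exists>\<^sub>F n in sequentially. x n \<le> a}"
  have S: "S \<noteq> {}" "bdd_below S"
  proof -
    show "S \<noteq> {}"
      using k by (auto simp: S_def)
    show "bdd_below S"
    proof (rule bdd_belowI[of _ 0])
      fix a assume "a \<in> S"
      then obtain n where "x n \<le> a"
        by (auto simp: S_def dest!: frequently_ex)
      with nonneg[of n] show "0 \<le> a" by simp
    qed
  qed
  have "x \<longlonglongrightarrow> Inf S"
  proof (rule order_tendstoI)
    fix a assume "a < Inf S"
    then have "a \<notin> S"
      using cInf_lower[OF _ S(2)] by force
    then show "\<forall>\<^sub>F n in sequentially. a < x n"
      by (simp add: S_def not_frequently not_le)
  next
    fix b assume "Inf S < b"
    then obtain s where s: "s \<in> S" "s < b"
      using cInf_less_iff[OF S] by auto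
    then obtain q where q: "q \<in> \<rat>" "s < q" "q < b"
      using Rats_dense_in_real[of s b] by auto
    then obtain p where p: "p \<in> \<rat>" "s < p" "p < q"
      using Rats_dense_in_real[of s q] by auto
    have "\<exists>\<^sub>F n in sequentially. x n \<le> p"
      using s(1) p(2) unfolding S_def by (auto elim!: frequently_elim1)
    with osc p q have "\<not> (\<exists>\<^sub>F n in sequentially. q \<le> x n)"
      by blast
    then show "\<forall>\<^sub>F n in sequentially. x n < b"
      using q(3) by (auto simp: not_frequently not_le elim!: eventually_mono)
  qed
  then show ?thesis
    by (rule convergentI)
qed

text \<open>A reversed martingale, without conditional expectations: \<open>R n\<close> is the projection of \<open>R m\<close> on
  the functions of \<open>R n, R (n + 1), \<dots>\<close>. Rectangles suffice for the maximal inequality.\<close>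

locale reverse_martingale = finite_measure Q for Q :: "'w measure" +
  fixes R :: "nat \<Rightarrow> 'w \<Rightarrow> real"
  assumes integrable: "integrable Q (R n)"
    and reverse: "\<lbrakk>m \<le> n; n \<le> N; \<And>j. G j \<in> sets borel\<rbrakk> \<Longrightarrow>
      (\<integral>\<omega>. R m \<omega> * indicator {\<omega>. \<forall>j\<in>{n..N}. R j \<omega> \<in> G j} \<omega> \<partial>Q)
      = (\<integral>\<omega>. R n \<omega> * indicator {\<omega>. \<forall>j\<in>{n..N}. R j \<omega> \<in> G j} \<omega> \<partial>Q)"
begin

lemma measurable_R [measurable]: "R n \<in> borel_measurable Q"
  using integrable by auto

text \<open>A Doob inequality in reversed time: split according to the last index \<open>n\<close>
  at which \<open>R\<close> is at most \<open>a\<close>. That event depends on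
  \<open>R n, ..., R N\<close> only, so \<open>R m\<close> may be replaced by \<open>R n\<close> on
  it, and there \<open>c - R n\<close> is at least \<open>c - a\<close>. The event \<open>H\<close>
  about the endpoint allows for a restriction to one side of a level.\<close>

lemma maximal_inequality:
  assumes H [measurable]: "H \<in> sets borel" and "m \<le> N"
  shows "(c - a) * measure Q {\<omega>\<in>space Q. R N \<omega> \<in> H \<and> (\<exists>n\<in>{m..N}. R n \<omega> \<le> a)}
    \<le> (\<integral>\<omega>. max 0 (c - R m \<omega>) * indicator H (R N \<omega>) \<partial>Q)"
proof -
  define T where "T n = {\<omega>\<in>space Q. R N \<omega> \<in> H \<and> R n \<omega> \<le> a \<and> (\<forall>j\<in>{n<..N}. a < R j \<omega>)}" for n
  have T [measurable]: "T n \<in> sets Q" for n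
    unfolding T_def by measurable
  have "{\<omega>\<in>space Q. R N \<omega> \<in> H \<and> (\<exists>n\<in>{m..N}. R n \<omega> \<le> a)} = (\<Union>n\<in>{m..N}. T n)"
  proof (intro equalityI subsetI)
    fix \<omega> assume \<omega>: "\<omega> \<in> {\<omega>\<in>space Q. R N \<omega> \<in> H \<and> (\<exists>n\<in>{m..N}. R n \<omega> \<le> a)}"
    define n where "n = Max {n\<in>{m..N}. R n \<omega> \<le> a}"
    have "n \<in> {n\<in>{m..N}. R n \<omega> \<le> a}"
      unfolding n_def using \<omega> by (intro Max_in) auto
    moreover have "a < R j \<omega>" if "j \<in> {n<..N}" for j
    proof (rule ccontr)
      assume "\<not> a < R j \<omega>"
      with that \<open>n \<in> _\<close> have "j \<in> {n\<in>{m..N}. R n \<omega> \<le> a}" by auto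
      then have "j \<le> n" unfolding n_def by (intro Max_ge) auto
      with that show False by simp
    qed
    ultimately show "\<omega> \<in> (\<Union>n\<in>{m..N}. T n)"
      using \<omega> by (auto simp: T_def)
  qed (auto simp: T_def)
  moreover have disj: "disjoint_family_on T {m..N}"
    unfolding disjoint_family_on_def
  proof (intro ballI impI)
    have "T i \<inter> T j = {}" if "i < j" "j \<le> N" for i j
    proof -
      have "a < R j \<omega>" if "\<omega> \<in> T i" for \<omega>
        using that \<open>i < j\<close> \<open>j \<le> N\<close> by (simp add: T_def)
      moreover have "R j \<omega> \<le> a" if "\<omega> \<in> T j" for \<omega>
        using that by (simp add: T_def)
      ultimately show ?thesis
        by fastforce
    qed
    then show "T i \<inter> T j = {}" if "i \<in> {m..N}" "j \<in> {m..N}" "i \<noteq> j" for i j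
      using that by (cases i j rule: linorder_cases) (auto simp: Int_commute)
  qed
  moreover have "measure Q (\<Union>n\<in>{m..N}. T n) = (\<Sum>n\<in>{m..N}. measure Q (T n))"
    using disj by (intro finite_measure_finite_Union) auto
  moreover have "(c - a) * measure Q (T n) \<le> (\<integral>\<omega>. max 0 (c - R m \<omega>) * indicator (T n) \<omega> \<partial>Q)"
    if n: "n \<in> {m..N}" for n
  proof -
    \<comment> \<open>Writes the event \<open>T n\<close> as a rectangle in the coordinates
      \<open>n, ..., N\<close>; the intersection takes care of \<open>n = N\<close>, where both
      conditions fall on one coordinate.\<close>
    define G where "G j = (if j = n then {..a} else {a<..}) \<inter> (if j = N then H else UNIV)" for j
    have G: "G j \<in> sets borel" for j
      by (auto simp: G_def)
    have ind: "indicator (T n) \<omega> = (indicator {\<omega>. \<forall>j\<in>{n..N}. R j \<omega> \<in> G j} \<omega> :: real)" if "\<omega> \<in> space Q" for \<omega>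
    proof -
      have "(\<forall>j\<in>{n..N}. R j \<omega> \<in> G j) \<longleftrightarrow> R N \<omega> \<in> H \<and> R n \<omega> \<le> a \<and> (\<forall>j\<in>{n<..N}. a < R j \<omega>)"
        using n by (force simp: G_def)
      then show ?thesis
        using that by (simp add: T_def indicator_def)
    qed
    have int: "integrable Q (\<lambda>\<omega>. R k \<omega> * indicator (T n) \<omega>)" for k
      using integrable by (intro integrable_real_mult_indicator) auto
    have int_c: "integrable Q (\<lambda>\<omega>. c * indicator (T n) \<omega>)" for c :: real
      by (intro integrable_mult_right integrable_real_indicator) (auto simp: less_top[symmetric])
    have Rm: "(\<integral>\<omega>. R m \<omega> * indicator (T n) \<omega> \<partial>Q) = (\<integral>\<omega>. R n \<omega> * indicator (T n) \<omega> \<partial>Q)"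
      using reverse[of m n N G] n G by (simp add: ind cong: Bochner_Integration.integral_cong)
    have "(c - a) * measure Q (T n) = (\<integral>\<omega>. (c - a) * indicator (T n) \<omega> \<partial>Q)"
      using sets.sets_into_space[OF T[of n]] by (simp add: Int_absorb2)
    also have "\<dots> \<le> (\<integral>\<omega>. c * indicator (T n) \<omega> - R n \<omega> * indicator (T n) \<omega> \<partial>Q)"
      using int int_c by (intro integral_mono) (auto simp: indicator_def T_def)
    also have "\<dots> = (\<integral>\<omega>. c * indicator (T n) \<omega> - R m \<omega> * indicator (T n) \<omega> \<partial>Q)"
      using int int_c Rm by simp
    also have "\<dots> \<le> (\<integral>\<omega>. max 0 (c - R m \<omega>) * indicator (T n) \<omega> \<partial>Q)"
      using int int_c integrable
      by (intro integral_mono Bochner_Integration.integrable_diff integrable_real_mult_indicator integrable_max)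
        (auto simp: indicator_def)
    finally show ?thesis .
  qed
  ultimately have "(c - a) * measure Q {\<omega>\<in>space Q. R N \<omega> \<in> H \<and> (\<exists>n\<in>{m..N}. R n \<omega> \<le> a)}
      \<le> (\<Sum>n\<in>{m..N}. \<integral>\<omega>. max 0 (c - R m \<omega>) * indicator (T n) \<omega> \<partial>Q)"
    by (simp only: sum_distrib_left) (rule sum_mono)
  also have "\<dots> = (\<integral>\<omega>. (\<Sum>n\<in>{m..N}. max 0 (c - R m \<omega>) * indicator (T n) \<omega>) \<partial>Q)"
    using integrable
    by (intro Bochner_Integration.integral_sum[symmetric] integrable_real_mult_indicator integrable_max) auto
  also have "\<dots> \<le> (\<integral>\<omega>. max 0 (c - R m \<omega>) * indicator H (R N \<omega>) \<partial>Q)"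
  proof (rule integral_mono)
    show "integrable Q (\<lambda>\<omega>. \<Sum>n\<in>{m..N}. max 0 (c - R m \<omega>) * indicator (T n) \<omega>)"
      using integrable by (intro Bochner_Integration.integrable_sum integrable_real_mult_indicator integrable_max) auto
    have "integrable Q (\<lambda>\<omega>. max 0 (c - R m \<omega>))"
      using integrable by (intro integrable_max) auto
    then show "integrable Q (\<lambda>\<omega>. max 0 (c - R m \<omega>) * indicator H (R N \<omega>))"
      by (rule Bochner_Integration.integrable_bound) (auto simp: indicator_def)
    fix \<omega>
    have "(\<Sum>n\<in>{m..N}. indicator (T n) \<omega>) = (indicator (\<Union>n\<in>{m..N}. T n) \<omega> :: real)"
      using disj by (intro indicator_UN_disjoint[symmetric]) auto
    also have "\<dots> \<le> indicator H (R N \<omega>)"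
      by (auto simp: indicator_def T_def)
    finally show "(\<Sum>n\<in>{m..N}. max 0 (c - R m \<omega>) * indicator (T n) \<omega>) \<le> max 0 (c - R m \<omega>) * indicator H (R N \<omega>)"
      by (simp only: sum_distrib_left[symmetric]) (intro mult_left_mono, auto)
  qed
  finally show ?thesis .
qed

end

lemma (in reverse_martingale) reverse_martingale_uminus: "reverse_martingale Q (\<lambda>n \<omega>. - R n \<omega>)"
proof
  fix m n N :: nat and G :: "nat \<Rightarrow> real set"
  assume mn: "m \<le> n" "n \<le> N" and G: "\<And>j. G j \<in> sets borel"
  have "uminus -` G j \<in> sets borel" for j
    using measurable_sets[of uminus borel borel "G j"] G by simp
  from reverse[OF mn this] show "(\<integral>\<omega>. - R m \<omega> * indicator {\<omega>. \<forall>j\<in>{n..N}. - R j \<omega> \<in> G j} \<omega> \<partial>Q)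
      = (\<integral>\<omega>. - R n \<omega> * indicator {\<omega>. \<forall>j\<in>{n..N}. - R j \<omega> \<in> G j} \<omega> \<partial>Q)"
    by simp
qed (use integrable in auto)

context reverse_martingale
begin

text \<open>The distance of \<open>R m\<close> to \<open>R N\<close> is measured by the Bregman divergence of the convex function
  \<open>x \<mapsto> \<bar>x - c\<bar>\<close>, whose expectation is the decrease of \<open>\<lambda>n. E \<bar>R n - c\<bar>\<close> from \<open>m\<close> to \<open>N\<close>.\<close>

lemma oscillation_bound:
  assumes "a < c" "c < b" "m \<le> N"
  shows "2 * min (b - c) (c - a) * measure Q {\<omega>\<in>space Q. (\<exists>n\<in>{m..N}. b \<le> R n \<omega>) \<and> (\<exists>n\<in>{m..N}. R n \<omega> \<le> a)}
    \<le> (\<integral>\<omega>. \<bar>R m \<omega> - c\<bar> \<partial>Q) - (\<integral>\<omega>. \<bar>R N \<omega> - c\<bar> \<partial>Q)"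
proof -
  interpret neg: reverse_martingale Q "\<lambda>n \<omega>. - R n \<omega>"
    by (rule reverse_martingale_uminus)
  \<comment> \<open>A path that visits both levels ends on one side of \<open>c\<close>, having been
    on the far side before. The part ending at or below \<open>c\<close> is phrased for
    \<open>- R\<close>, to which the maximal inequality applies as well.\<close>
  define A B where "A = {\<omega>\<in>space Q. R N \<omega> \<in> {c<..} \<and> (\<exists>n\<in>{m..N}. R n \<omega> \<le> a)}"
    and "B = {\<omega>\<in>space Q. - R N \<omega> \<in> {- c..} \<and> (\<exists>n\<in>{m..N}. - R n \<omega> \<le> - b)}"
  have [measurable]: "A \<in> sets Q" "B \<in> sets Q"
    unfolding A_def B_def by measurable
  \<comment> \<open>With \<open>x = R m\<close> and \<open>y = R N\<close>,
    \<open>2 * (f + g)\<close> is the divergence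
    \<open>\<bar>x - c\<bar> - \<bar>y - c\<bar> - sgn(y - c) (x - y)\<close>, the sign at
    \<open>y = c\<close> being taken as -1.\<close>
  define f g where "f \<omega> = max 0 (c - R m \<omega>) * indicator {c<..} (R N \<omega>)"
    and "g \<omega> = max 0 (R m \<omega> - c) * indicator {..c} (R N \<omega>)" for \<omega>
  have int_ind: "integrable Q (\<lambda>\<omega>. R k \<omega> * indicator K (R N \<omega>))" if [measurable]: "K \<in> sets borel" for K k
    by (rule Bochner_Integration.integrable_bound[OF integrable[of k]]) (auto simp: indicator_def)
  have int_c: "integrable Q (\<lambda>\<omega>. c * indicator K (R N \<omega>))" if [measurable]: "K \<in> sets borel" for K
    by (rule integrable_const_bound[where B="\<bar>c\<bar>"]) (auto simp: indicator_def)
  have int_max: "integrable Q (\<lambda>\<omega>. max 0 (c - R m \<omega>))" "integrable Q (\<lambda>\<omega>. max 0 (R m \<omega> - c))"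
    using integrable by (auto intro!: integrable_max)
  have int_fg: "integrable Q f" "integrable Q g"
    unfolding f_def[abs_def] g_def[abs_def]
    by (rule Bochner_Integration.integrable_bound[OF int_max(1)] Bochner_Integration.integrable_bound[OF int_max(2)];
      auto simp: indicator_def)+
  have A: "(c - a) * measure Q A \<le> (\<integral>\<omega>. f \<omega> \<partial>Q)"
    unfolding A_def f_def using assms by (intro maximal_inequality) auto
  have B: "(b - c) * measure Q B \<le> (\<integral>\<omega>. g \<omega> \<partial>Q)"
  proof -
    have "(- c - - b) * measure Q B \<le> (\<integral>\<omega>. max 0 (- c - - R m \<omega>) * indicator {- c..} (- R N \<omega>) \<partial>Q)"
      unfolding B_def using assms by (intro neg.maximal_inequality) auto
    also have "\<dots> = (\<integral>\<omega>. g \<omega> \<partial>Q)"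
      by (intro Bochner_Integration.integral_cong) (auto simp: g_def indicator_def)
    finally show ?thesis by simp
  qed
  have rev: "(\<integral>\<omega>. R m \<omega> * indicator K (R N \<omega>) \<partial>Q) = (\<integral>\<omega>. R N \<omega> * indicator K (R N \<omega>) \<partial>Q)"
    if "K \<in> sets borel" for K
  proof -
    have "indicator {\<omega>. \<forall>j\<in>{N..N}. R j \<omega> \<in> K} \<omega> = (indicator K (R N \<omega>) :: real)" for \<omega>
      by (simp add: indicator_def)
    then show ?thesis
      using reverse[of m N N "\<lambda>_. K"] that assms by simp
  qed
  \<comment> \<open>Expectation of the same sign of \<open>R N - c\<close> times
    \<open>R k - c\<close>. It is linear in \<open>R k\<close> on events of \<open>R N\<close>,
    hence the same for \<open>m\<close> and \<open>N\<close>.\<close>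
  define s where "s k = (\<integral>\<omega>. R k \<omega> * indicator {c<..} (R N \<omega>) - c * indicator {c<..} (R N \<omega>)
      - (R k \<omega> * indicator {..c} (R N \<omega>) - c * indicator {..c} (R N \<omega>)) \<partial>Q)" for k
  have int_s: "integrable Q (\<lambda>\<omega>. R k \<omega> * indicator {c<..} (R N \<omega>) - c * indicator {c<..} (R N \<omega>)
      - (R k \<omega> * indicator {..c} (R N \<omega>) - c * indicator {..c} (R N \<omega>)))" for k
    using int_ind int_c by (intro Bochner_Integration.integrable_diff) auto
  have "s m = s N"
    unfolding s_def using int_ind int_c by (simp add: rev)
  also have "s N = (\<integral>\<omega>. \<bar>R N \<omega> - c\<bar> \<partial>Q)"
    unfolding s_def by (intro Bochner_Integration.integral_cong) (auto simp: indicator_def)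
  finally have "(\<integral>\<omega>. \<bar>R m \<omega> - c\<bar> \<partial>Q) - (\<integral>\<omega>. \<bar>R N \<omega> - c\<bar> \<partial>Q) = (\<integral>\<omega>. \<bar>R m \<omega> - c\<bar> \<partial>Q) - s m"
    by simp
  also have "\<dots> = (\<integral>\<omega>. 2 * (f \<omega> + g \<omega>) \<partial>Q)"
  proof -
    have "integrable Q (\<lambda>\<omega>. \<bar>R m \<omega> - c\<bar>)"
      using integrable by auto
    from Bochner_Integration.integral_diff[OF this int_s[of m]] show ?thesis
      unfolding s_def
      by (rule trans[OF sym])
        (auto intro!: Bochner_Integration.integral_cong simp: f_def g_def indicator_def max_def)
  qed
  also have "\<dots> = 2 * ((\<integral>\<omega>. f \<omega> \<partial>Q) + (\<integral>\<omega>. g \<omega> \<partial>Q))"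
    using int_fg by simp
  finally have eq: "(\<integral>\<omega>. \<bar>R m \<omega> - c\<bar> \<partial>Q) - (\<integral>\<omega>. \<bar>R N \<omega> - c\<bar> \<partial>Q) = 2 * ((\<integral>\<omega>. f \<omega> \<partial>Q) + (\<integral>\<omega>. g \<omega> \<partial>Q))" .
  have "measure Q {\<omega>\<in>space Q. (\<exists>n\<in>{m..N}. b \<le> R n \<omega>) \<and> (\<exists>n\<in>{m..N}. R n \<omega> \<le> a)} \<le> measure Q (A \<union> B)"
    by (intro finite_measure_mono) (auto simp: A_def B_def not_less)
  also have "\<dots> \<le> measure Q A + measure Q B"
    by (rule measure_Un_le) auto
  finally have "min (b - c) (c - a) * measure Q {\<omega>\<in>space Q. (\<exists>n\<in>{m..N}. b \<le> R n \<omega>) \<and> (\<exists>n\<in>{m..N}. R n \<omega> \<le> a)}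
      \<le> min (b - c) (c - a) * (measure Q A + measure Q B)"
    using assms by (intro mult_left_mono) auto
  also have "\<dots> \<le> (c - a) * measure Q A + (b - c) * measure Q B"
    unfolding distrib_left by (intro add_mono mult_right_mono) auto
  finally show ?thesis
    using A B eq by (simp add: mult.assoc)
qed

text \<open>The means \<open>v n\<close> of \<open>\<bar>R n - c\<bar>\<close> decrease to a limit
  \<open>l\<close>. A path oscillating for ever does so after every index \<open>m\<close>, so the
  probability of this is bounded by a multiple of \<open>v m - l\<close>, for all
  \<open>m\<close>.\<close>

lemma AE_not_oscillating:
  assumes "a < b"
  shows "AE \<omega> in Q. \<not> ((\<exists>\<^sub>F n in sequentially. b \<le> R n \<omega>) \<and> (\<exists>\<^sub>F n in sequentially. R n \<omega> \<le> a))"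
proof -
  define c where "c = (a + b) / 2"
  have c: "a < c" "c < b"
    using assms by (auto simp: c_def)
  define d where "d = 2 * min (b - c) (c - a)"
  have d: "d > 0"
    using c by (auto simp: d_def)
  define v where "v n = (\<integral>\<omega>. \<bar>R n \<omega> - c\<bar> \<partial>Q)" for n
  define E where "E m N = {\<omega>\<in>space Q. (\<exists>n\<in>{m..N}. b \<le> R n \<omega>) \<and> (\<exists>n\<in>{m..N}. R n \<omega> \<le> a)}" for m N
  have E [measurable]: "E m N \<in> sets Q" for m N
    unfolding E_def by measurable
  have bound: "d * measure Q (E m N) \<le> v m - v N" if "m \<le> N" for m N
    unfolding d_def v_def E_def by (rule oscillation_bound[OF c that])
  have "decseq v"
  proof (rule decseq_SucI)
    fix n
    have "0 \<le> d * measure Q (E n (Suc n))"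
      using d by simp
    with bound[of n "Suc n"] show "v (Suc n) \<le> v n" by simp
  qed
  moreover have v_nonneg: "0 \<le> v n" for n
    by (simp add: v_def)
  ultimately obtain l where l: "v \<longlonglongrightarrow> l" "\<And>n. l \<le> v n"
    using decseq_convergent[of v 0] by auto
  define F where "F = {\<omega>\<in>space Q. (\<exists>\<^sub>F n in sequentially. b \<le> R n \<omega>) \<and> (\<exists>\<^sub>F n in sequentially. R n \<omega> \<le> a)}"
  have F [measurable]: "F \<in> sets Q"
    unfolding F_def frequently_sequentially by measurable
  have "d * measure Q F \<le> v m - l" for m
  proof -
    have "incseq (E m)"
      unfolding incseq_def E_def by force
    then have "(\<lambda>N. measure Q (E m N)) \<longlonglongrightarrow> measure Q (\<Union>N. E m N)"
      by (intro finite_Lim_measure_incseq) auto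
    then have "(\<lambda>N. d * measure Q (E m N)) \<longlonglongrightarrow> d * measure Q (\<Union>N. E m N)"
      by (intro tendsto_intros)
    moreover have "\<exists>M. \<forall>N\<ge>M. d * measure Q (E m N) \<le> v m - l"
    proof (intro exI[of _ m] allI impI)
      fix N assume "m \<le> N"
      from bound[OF this] l(2)[of N] show "d * measure Q (E m N) \<le> v m - l" by simp
    qed
    ultimately have "d * measure Q (\<Union>N. E m N) \<le> v m - l"
      by (rule LIMSEQ_le_const2)
    moreover have "F \<subseteq> (\<Union>N. E m N)"
    proof
      fix \<omega> assume "\<omega> \<in> F"
      then obtain n n' where "n \<ge> m" "b \<le> R n \<omega>" "n' \<ge> m" "R n' \<omega> \<le> a" "\<omega> \<in> space Q"
        unfolding F_def frequently_sequentially by blast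
      then have "\<exists>k\<in>{m..max n n'}. b \<le> R k \<omega>" "\<exists>k\<in>{m..max n n'}. R k \<omega> \<le> a" "\<omega> \<in> space Q"
        by (auto intro: bexI[of _ n] bexI[of _ n'])
      then have "\<omega> \<in> E m (max n n')"
        by (simp add: E_def)
      then show "\<omega> \<in> (\<Union>N. E m N)" by blast
    qed
    then have "measure Q F \<le> measure Q (\<Union>N. E m N)"
      by (intro finite_measure_mono) auto
    ultimately show ?thesis
      using d by (meson mult_left_mono less_imp_le order_trans)
  qed
  moreover have "(\<lambda>m. v m - l) \<longlonglongrightarrow> 0"
    using tendsto_diff[OF l(1) tendsto_const[of l]] by simp
  ultimately have "d * measure Q F \<le> 0"
    by (intro LIMSEQ_le_const) auto
  then have "measure Q F = 0"
    using d measure_nonneg[of Q F] by (simp add: mult_le_0_iff)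
  then have "F \<in> null_sets Q"
    by (simp add: null_sets_def emeasure_eq_measure)
  then show ?thesis
    by (rule AE_I') (auto simp: F_def)
qed

text \<open>Oscillation is excluded for all rational levels at once. Divergence to infinity is
  excluded by Fatou's lemma, as all \<open>R n\<close> have the same mean.\<close>

theorem AE_convergent:
  assumes nonneg: "\<And>n \<omega>. 0 \<le> R n \<omega>"
  shows "AE \<omega> in Q. convergent (\<lambda>n. R n \<omega>)"
proof -
  have "AE \<omega> in Q. \<forall>a\<in>\<rat>. \<forall>b\<in>\<rat>. a < b \<longrightarrow> \<not> ((\<exists>\<^sub>F n in sequentially. b \<le> R n \<omega>) \<and> (\<exists>\<^sub>F n in sequentially. R n \<omega> \<le> a))"
    using AE_not_oscillating by (auto simp: AE_ball_countable countable_rat)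
  moreover have "AE \<omega> in Q. liminf (\<lambda>n. ennreal (R n \<omega>)) \<noteq> \<infinity>"
  proof (rule nn_integral_PInf_AE)
    have "(\<integral>\<omega>. R n \<omega> \<partial>Q) = (\<integral>\<omega>. R 0 \<omega> \<partial>Q)" for n
      using reverse[of 0 n n "\<lambda>_. UNIV"] by simp
    then have "(\<integral>\<^sup>+\<omega>. R n \<omega> \<partial>Q) = ennreal (\<integral>\<omega>. R 0 \<omega> \<partial>Q)" for n
      using nonneg integrable by (subst nn_integral_eq_integral) auto
    then have "(\<integral>\<^sup>+\<omega>. liminf (\<lambda>n. ennreal (R n \<omega>)) \<partial>Q) \<le> ennreal (\<integral>\<omega>. R 0 \<omega> \<partial>Q)"
      using nn_integral_liminf[of "\<lambda>n \<omega>. ennreal (R n \<omega>)" Q] by (simp add: Liminf_const)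
    then show "(\<integral>\<^sup>+\<omega>. liminf (\<lambda>n. ennreal (R n \<omega>)) \<partial>Q) \<noteq> \<infinity>"
      by (auto simp: top_unique)
  qed measurable
  ultimately show ?thesis
  proof eventually_elim
    case (elim \<omega>)
    have "\<exists>k::nat. \<exists>\<^sub>F n in sequentially. R n \<omega> \<le> real k"
    proof (rule ccontr)
      assume "\<not> ?thesis"
      then have ev: "\<forall>\<^sub>F n in sequentially. real k < R n \<omega>" for k
        by (simp add: not_frequently not_le)
      have "\<forall>\<^sub>F n in sequentially. of_nat k \<le> ennreal (R n \<omega>)" for k
        by (rule eventually_mono[OF ev[of k]])
          (simp add: ennreal_of_nat_eq_real_of_nat ennreal_leI)
      then have "of_nat k \<le> liminf (\<lambda>n. ennreal (R n \<omega>))" for k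
        by (intro Liminf_bounded) auto
      then have "liminf (\<lambda>n. ennreal (R n \<omega>)) = \<infinity>"
        using SUP_least[of UNIV of_nat "liminf (\<lambda>n. ennreal (R n \<omega>))"]
        by (simp add: ennreal_SUP_of_nat_eq_top top_unique)
      with elim show False by simp
    qed
    with elim nonneg show ?case
      by (auto intro: convergent_if_not_oscillating)
  qed
qed

end

section \<open>Almost sure convergence\<close>

locale swap_invariant_measure = prob_space P for P :: "'w measure" +
  fixes M :: "'s measure" and \<xi> :: "'w \<Rightarrow> 's measure"
  assumes atomless: "atomless M" and random_measure: "random_measure P M \<xi>"
    and swap_invariant: "swap_invariant P M \<xi>"
begin

section \<open>Real-valued masses of integrable sets\<close>

text \<open>Real-valued, hence 0 where \<xi>(A) is infinite. For sets of finite expected mass this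
  is a null event, which is why additivity and monotonicity of \<open>mass\<close> hold almost
  surely only.\<close>

definition mass :: "'s set \<Rightarrow> 'w \<Rightarrow> real" where
  "mass A \<omega> = measure (\<xi> \<omega>) A"

definition integrable_sets :: "'s set set" where
  "integrable_sets = {A\<in>sets M. (\<integral>\<^sup>+\<omega>. emeasure (\<xi> \<omega>) A \<partial>P) < \<infinity>}"

lemma sets_\<xi>: "\<omega> \<in> space P \<Longrightarrow> sets (\<xi> \<omega>) = sets M"
  using random_measure by (simp add: random_measure_def)

lemma measurable_emeasure_\<xi> [measurable]: "A \<in> sets M \<Longrightarrow> (\<lambda>\<omega>. emeasure (\<xi> \<omega>) A) \<in> borel_measurable P"
  using random_measure by (simp add: random_measure_def)

lemma measurable_mass: "A \<in> sets M \<Longrightarrow> mass A \<in> borel_measurable P"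
  unfolding mass_def[abs_def] measure_def by measurable

lemma mass_nonneg [simp]: "0 \<le> mass A \<omega>"
  by (simp add: mass_def)

lemma integrable_sets_D: "A \<in> integrable_sets \<Longrightarrow> A \<in> sets M"
  by (simp add: integrable_sets_def)

lemma AE_finite:
  assumes "A \<in> integrable_sets"
  shows "AE \<omega> in P. emeasure (\<xi> \<omega>) A < \<infinity>"
proof -
  have "AE \<omega> in P. emeasure (\<xi> \<omega>) A \<noteq> \<infinity>"
    using assms by (intro nn_integral_PInf_AE) (auto simp: integrable_sets_def)
  then show ?thesis
    by eventually_elim (simp add: less_top)
qed

lemma AE_emeasure_eq:
  assumes "A \<in> integrable_sets"
  shows "AE \<omega> in P. emeasure (\<xi> \<omega>) A = ennreal (mass A \<omega>)"
  using AE_finite[OF assms] by eventually_elim (auto simp: mass_def emeasure_eq_ennreal_measure)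

lemma nn_integral_mass:
  assumes "A \<in> integrable_sets"
  shows "(\<integral>\<^sup>+\<omega>. ennreal (mass A \<omega>) \<partial>P) = (\<integral>\<^sup>+\<omega>. emeasure (\<xi> \<omega>) A \<partial>P)"
  using AE_emeasure_eq[OF assms] by (intro nn_integral_cong_AE) auto

lemma integrable_mass:
  assumes "A \<in> integrable_sets"
  shows "integrable P (mass A)"
proof (rule integrableI_nonneg)
  show "mass A \<in> borel_measurable P"
    using assms by (intro measurable_mass integrable_sets_D)
  show "(\<integral>\<^sup>+\<omega>. ennreal (mass A \<omega>) \<partial>P) < \<infinity>"
    using assms unfolding nn_integral_mass[OF assms] by (simp add: integrable_sets_def)
qed simp

lemma nn_integral_emeasure_eq:
  assumes "A \<in> integrable_sets"
  shows "(\<integral>\<^sup>+\<omega>. emeasure (\<xi> \<omega>) A \<partial>P) = ennreal (expectation (mass A))"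
  unfolding nn_integral_mass[OF assms, symmetric]
  using integrable_mass[OF assms] by (intro nn_integral_eq_integral) auto

lemma integrable_sets_subset:
  assumes A: "A \<in> integrable_sets" and B: "B \<in> sets M" "B \<subseteq> A"
  shows "B \<in> integrable_sets"
proof -
  have "(\<integral>\<^sup>+\<omega>. emeasure (\<xi> \<omega>) B \<partial>P) \<le> (\<integral>\<^sup>+\<omega>. emeasure (\<xi> \<omega>) A \<partial>P)"
    using A B by (intro nn_integral_mono emeasure_mono) (auto simp: sets_\<xi> integrable_sets_D)
  also have "\<dots> < \<infinity>"
    using A by (simp add: integrable_sets_def)
  finally show ?thesis
    using B by (simp add: integrable_sets_def)
qed

lemma mass_finite_Union:
  assumes I: "finite I" "disjoint_family_on F I" "\<And>i. i \<in> I \<Longrightarrow> F i \<in> integrable_sets"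
  shows "AE \<omega> in P. mass (\<Union>i\<in>I. F i) \<omega> = (\<Sum>i\<in>I. mass (F i) \<omega>)"
proof -
  have "AE \<omega> in P. \<forall>i\<in>I. emeasure (\<xi> \<omega>) (F i) < \<infinity>"
    using I AE_finite by (intro AE_finite_allI) auto
  then show ?thesis
    using AE_space
  proof eventually_elim
    case (elim \<omega>)
    then show ?case
      unfolding mass_def using I
      by (intro measure_finite_Union) (auto simp: sets_\<xi> integrable_sets_D less_top)
  qed
qed

lemma mass_Un:
  assumes "A \<in> integrable_sets" "B \<in> integrable_sets" "A \<inter> B = {}"
  shows "AE \<omega> in P. mass (A \<union> B) \<omega> = mass A \<omega> + mass B \<omega>"
  using AE_finite[OF assms(1)] AE_finite[OF assms(2)] AE_space
proof eventually_elim
  case (elim \<omega>)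
  then show ?case
    unfolding mass_def using assms by (intro measure_Union) (auto simp: sets_\<xi> integrable_sets_D)
qed

lemma mass_mono:
  assumes "A \<in> integrable_sets" "B \<in> sets M" "B \<subseteq> A"
  shows "AE \<omega> in P. mass B \<omega> \<le> mass A \<omega>"
  using AE_finite[OF assms(1)] AE_space
proof eventually_elim
  case (elim \<omega>)
  then show ?case
    unfolding mass_def using assms
    by (intro measure_mono_fmeasurable fmeasurableI) (auto simp: sets_\<xi> integrable_sets_D)
qed

lemma swap:
  fixes n :: nat and A B :: "nat \<Rightarrow> 's set"
  assumes "n \<ge> 1" "disjoint_family_on A {..<n}" "disjoint_family_on B {..<n}"
    and "\<And>j. j < n \<Longrightarrow> A j \<in> integrable_sets" "\<And>j. j < n \<Longrightarrow> B j \<in> integrable_sets"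
    and "\<And>j. j < n \<Longrightarrow> emeasure M (A j) = emeasure M (B j)"
  shows "expectation (\<lambda>\<omega>. \<bar>\<Sum>j<n. u j * mass (A j) \<omega>\<bar>) = expectation (\<lambda>\<omega>. \<bar>\<Sum>j<n. u j * mass (B j) \<omega>\<bar>)"
  using swap_invariant[unfolded swap_invariant_def, rule_format, of n A B u] assms
  unfolding mass_def integrable_sets_def by blast

lemma expectation_mass_cong:
  assumes "A \<in> integrable_sets" "B \<in> integrable_sets" "emeasure M A = emeasure M B"
  shows "expectation (mass A) = expectation (mass B)"
proof -
  have "expectation (\<lambda>\<omega>. \<bar>\<Sum>j<1::nat. 1 * mass A \<omega>\<bar>) = expectation (\<lambda>\<omega>. \<bar>\<Sum>j<1::nat. 1 * mass B \<omega>\<bar>)"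
    by (rule swap) (use assms in \<open>auto simp: disjoint_family_on_def\<close>)
  then show ?thesis by simp
qed

lemma expectation_mass_Un:
  assumes "A \<in> integrable_sets" "B \<in> integrable_sets" "A \<inter> B = {}"
  shows "expectation (mass (A \<union> B)) = expectation (mass A) + expectation (mass B)"
proof -
  have "expectation (mass (A \<union> B)) = expectation (\<lambda>\<omega>. mass A \<omega> + mass B \<omega>)"
    using mass_Un[OF assms] assms
    by (intro integral_cong_AE measurable_mass borel_measurable_add) (auto intro: integrable_sets_D)
  then show ?thesis
    using assms integrable_mass by simp
qed

lemma expectation_mass_linear:
  assumes D: "D \<in> integrable_sets" "emeasure M D < \<infinity>" and C: "C \<in> sets M" "C \<subseteq> D"
  shows "measure M D * expectation (mass C) = measure M C * expectation (mass D)"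
proof (rule additive_linear_in_measure[OF atomless])
  have sub: "C \<in> integrable_sets" if "C \<in> sets M" "C \<subseteq> D" for C
    using integrable_sets_subset[OF D(1) that] .
  show "D \<in> sets M"
    using D by (simp add: integrable_sets_D)
  show "0 \<le> expectation (mass C)" for C
    by simp
  fix C C' assume C: "C \<in> sets M" "C' \<in> sets M" "C \<union> C' \<subseteq> D"
  then have I: "C \<in> integrable_sets" "C' \<in> integrable_sets"
    using sub by auto
  show "expectation (mass (C \<union> C')) = expectation (mass C) + expectation (mass C')" if "C \<inter> C' = {}"
    using expectation_mass_Un[OF I that] .
  have "emeasure M C < \<infinity>" "emeasure M C' < \<infinity>"
    using C D emeasure_mono[of C D M] emeasure_mono[of C' D M] integrable_sets_D by (auto intro: le_less_trans)
  then show "expectation (mass C) = expectation (mass C')" if "measure M C = measure M C'"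
    using that I by (intro expectation_mass_cong) (auto simp: emeasure_eq_ennreal_measure)
qed (use D C in auto)

section \<open>Laws relative to the mass of a fixed set\<close>

text \<open>\<open>K\<close> is put in front of both families as one more disjoint set and is
  swapped with itself. Its term becomes the constant \<open>t\<close> after division by
  \<open>mass K\<close>.\<close>

lemma expectation_abs_swap_off:
  fixes n :: nat and C C' :: "nat \<Rightarrow> 's set" and t :: real and u :: "nat \<Rightarrow> real"
  assumes K: "K \<in> integrable_sets"
    and disj: "disjoint_family_on C {..<n}" "disjoint_family_on C' {..<n}"
    and C: "\<And>j. j < n \<Longrightarrow> C j \<in> integrable_sets \<and> C j \<inter> K = {}"
    and C': "\<And>j. j < n \<Longrightarrow> C' j \<in> integrable_sets \<and> C' j \<inter> K = {}"
    and eq: "\<And>j. j < n \<Longrightarrow> emeasure M (C j) = emeasure M (C' j)"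
  shows "expectation (\<lambda>\<omega>. \<bar>t * mass K \<omega> + (\<Sum>j<n. u j * mass (C j) \<omega>)\<bar>)
    = expectation (\<lambda>\<omega>. \<bar>t * mass K \<omega> + (\<Sum>j<n. u j * mass (C' j) \<omega>)\<bar>)"
proof -
  define F where "F D j = (case j of 0 \<Rightarrow> K | Suc i \<Rightarrow> D i)" for D :: "nat \<Rightarrow> 's set" and j
  have disj_F: "disjoint_family_on (F D) {..<Suc n}"
    if "disjoint_family_on D {..<n}" "\<And>j. j < n \<Longrightarrow> D j \<inter> K = {}" for D
    unfolding disjoint_family_on_def
  proof (intro ballI impI)
    fix i j assume ij: "i \<in> {..<Suc n}" "j \<in> {..<Suc n}" "i \<noteq> j"
    then show "F D i \<inter> F D j = {}"
      using that by (cases i; cases j) (auto simp: F_def disjoint_family_on_def Int_commute)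
  qed
  have F: "F D j \<in> integrable_sets" if "j < Suc n" "\<And>j. j < n \<Longrightarrow> D j \<in> integrable_sets" for D j
    using that K by (cases j) (auto simp: F_def)
  define v where "v j = (case j of 0 \<Rightarrow> t | Suc i \<Rightarrow> u i)" for j
  have sum: "(\<Sum>j<Suc n. v j * mass (F D j) \<omega>) = t * mass K \<omega> + (\<Sum>j<n. u j * mass (D j) \<omega>)" for D \<omega>
    by (simp only: sum.lessThan_Suc_shift) (simp add: v_def F_def)
  have "expectation (\<lambda>\<omega>. \<bar>\<Sum>j<Suc n. v j * mass (F C j) \<omega>\<bar>) = expectation (\<lambda>\<omega>. \<bar>\<Sum>j<Suc n. v j * mass (F C' j) \<omega>\<bar>)"
  proof (rule swap)
    show "emeasure M (F C j) = emeasure M (F C' j)" if "j < Suc n" for j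
      using that eq by (cases j) (auto simp: F_def)
  qed (use disj C C' in \<open>auto intro!: disj_F F\<close>)
  then show ?thesis
    unfolding sum .
qed

lemma distr_ratio_eq:
  fixes n :: nat and C C' :: "nat \<Rightarrow> 's set"
  assumes K: "K \<in> integrable_sets"
    and disj: "disjoint_family_on C {..<n}" "disjoint_family_on C' {..<n}"
    and C: "\<And>j. j < n \<Longrightarrow> C j \<in> integrable_sets \<and> C j \<inter> K = {}"
    and C': "\<And>j. j < n \<Longrightarrow> C' j \<in> integrable_sets \<and> C' j \<inter> K = {}"
    and eq: "\<And>j. j < n \<Longrightarrow> emeasure M (C j) = emeasure M (C' j)"
  shows "distr (density P (mass K)) (\<Pi>\<^sub>M j\<in>{..<n}. borel) (\<lambda>\<omega>. \<lambda>j\<in>{..<n}. mass (C j) \<omega> / mass K \<omega>)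
    = distr (density P (mass K)) (\<Pi>\<^sub>M j\<in>{..<n}. borel) (\<lambda>\<omega>. \<lambda>j\<in>{..<n}. mass (C' j) \<omega> / mass K \<omega>)"
proof (rule distr_weighted_eqI_abs_moments[where Y="\<lambda>j. mass (C j)" and Y'="\<lambda>j. mass (C' j)"])
  show "expectation (\<lambda>\<omega>. \<bar>t * mass K \<omega> + (\<Sum>j<n. u j * mass (C j) \<omega>)\<bar>)
      = expectation (\<lambda>\<omega>. \<bar>t * mass K \<omega> + (\<Sum>j<n. u j * mass (C' j) \<omega>)\<bar>)" for t u
    by (rule expectation_abs_swap_off) fact+
qed (use K C C' integrable_mass in auto)

text \<open>Fix an event \<open>Z\<close> described by \<open>R n, ..., R N\<close>, and integrate
  \<open>mass C / mass K\<close> over it for \<open>C \<subseteq> B n\<close>. Replacing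
  \<open>C\<close> by another subset of \<open>B n\<close> of equal measure does not change the
  joint law with the masses of \<open>B n, ..., B N\<close>. So the integral depends on the measure
  of \<open>C\<close> only, hence is proportional to it; comparing \<open>C = B m\<close> with
  \<open>C = B n\<close> gives the martingale identity.\<close>

lemma reverse_martingale_ratio:
  fixes B :: "nat \<Rightarrow> 's set"
  assumes K: "K \<in> integrable_sets"
    and B: "\<And>n. B n \<in> integrable_sets" "incseq B" "\<And>n. B n \<inter> K = {}"
    and fin: "\<And>n. emeasure M (B n) < \<infinity>" and pos: "\<And>n. 0 < measure M (B n)"
  shows "reverse_martingale (density P (mass K)) (\<lambda>n \<omega>. mass (B n) \<omega> / mass K \<omega> / measure M (B n))"
proof -
  have [measurable]: "mass K \<in> borel_measurable P"
    using K by (intro measurable_mass integrable_sets_D)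
  have meas_mass: "mass A \<in> borel_measurable P" if "A \<in> integrable_sets" for A
    using that by (intro measurable_mass integrable_sets_D)
  have [measurable]: "mass (B n) \<in> borel_measurable P" for n
    using B by (intro meas_mass)
  define R where "R n \<omega> = mass (B n) \<omega> / mass K \<omega> / measure M (B n)" for n \<omega>
  have [measurable]: "R n \<in> borel_measurable P" for n
    unfolding R_def by measurable
  interpret Q: finite_measure "density P (mass K)"
  proof (rule finite_measureI)
    have "emeasure (density P (mass K)) (space (density P (mass K))) = (\<integral>\<^sup>+\<omega>. mass K \<omega> \<partial>P)"
      by (simp add: emeasure_density cong: nn_integral_cong_simp)
    also have "\<dots> < \<infinity>"
      using integrable_mass[OF K] by (subst nn_integral_eq_integral) auto
    finally show "emeasure (density P (mass K)) (space (density P (mass K))) \<noteq> \<infinity>"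
      by simp
  qed
  \<comment> \<open>The density \<open>mass K\<close> cancels the denominator where it is positive
    and kills the integrand elsewhere, which leaves the indicator.\<close>
  have density: "(\<integral>\<omega>. mass A \<omega> / mass K \<omega> * indicator Z \<omega> \<partial>density P (mass K))
      = (\<integral>\<omega>. mass A \<omega> * (indicator Z \<omega> * indicator {0<..} (mass K \<omega>)) \<partial>P)"
    if [measurable]: "mass A \<in> borel_measurable P" "(\<lambda>\<omega>. indicator Z \<omega> :: real) \<in> borel_measurable P" for A Z
  proof (subst integral_density)
    show "(\<lambda>\<omega>. mass A \<omega> / mass K \<omega> * indicator Z \<omega>) \<in> borel_measurable P"
      by measurable
    show "(\<integral>\<omega>. mass K \<omega> *\<^sub>R (mass A \<omega> / mass K \<omega> * indicator Z \<omega>) \<partial>P)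
        = (\<integral>\<omega>. mass A \<omega> * (indicator Z \<omega> * indicator {0<..} (mass K \<omega>)) \<partial>P)"
      by (intro Bochner_Integration.integral_cong) (auto simp: indicator_def less_le)
  qed auto
  show ?thesis
    unfolding R_def[symmetric]
  proof
    fix n
    have "integrable P (\<lambda>\<omega>. mass K \<omega> * R n \<omega>)"
      by (rule Bochner_Integration.integrable_bound[OF integrable_divide[OF integrable_mass[OF B(1)[of n]], of "measure M (B n)"]])
        (auto simp: R_def)
    then show "integrable (density P (mass K)) (R n)"
      by (subst integrable_density) auto
  next
    fix m n N :: nat and G :: "nat \<Rightarrow> real set"
    assume mn: "m \<le> n" "n \<le> N" and G[measurable]: "\<And>j. G j \<in> sets borel"
    define Z where "Z = {\<omega>. \<forall>j\<in>{n..N}. R j \<omega> \<in> G j}"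
    have Z[measurable]: "(\<lambda>\<omega>. indicator Z \<omega> :: real) \<in> borel_measurable P"
      unfolding Z_def by measurable
    define \<nu> where "\<nu> C = (\<integral>\<omega>. mass C \<omega> / mass K \<omega> * indicator Z \<omega> \<partial>density P (mass K))" for C
    have sub: "C \<in> integrable_sets" if "C \<in> sets M" "C \<subseteq> B n" for C
      using integrable_sets_subset[OF B(1) that] .
    have "measure M (B n) * \<nu> (B m) = measure M (B m) * \<nu> (B n)"
    proof (rule additive_linear_in_measure[OF atomless])
      show "0 \<le> \<nu> C" for C
        unfolding \<nu>_def by (rule Bochner_Integration.integral_nonneg) simp
      fix C C' assume C: "C \<in> sets M" "C' \<in> sets M" "C \<union> C' \<subseteq> B n"
      then have I: "C \<in> integrable_sets" "C' \<in> integrable_sets" "C \<union> C' \<in> integrable_sets"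
        using sub by auto
      {
        assume disj: "C \<inter> C' = {}"
        let ?h = "\<lambda>\<omega>. indicator Z \<omega> * indicator {0<..} (mass K \<omega>) :: real"
        have int: "integrable P (\<lambda>\<omega>. mass A \<omega> * ?h \<omega>)" if "A \<in> integrable_sets" for A
        proof (rule Bochner_Integration.integrable_bound[OF integrable_mass[OF that]])
          have [measurable]: "mass A \<in> borel_measurable P"
            using that by (rule meas_mass)
          show "(\<lambda>\<omega>. mass A \<omega> * ?h \<omega>) \<in> borel_measurable P"
            by measurable
        qed (auto simp: indicator_def)
        have "\<nu> (C \<union> C') = (\<integral>\<omega>. mass (C \<union> C') \<omega> * ?h \<omega> \<partial>P)"
          unfolding \<nu>_def using I by (intro density meas_mass Z)
        also have "\<dots> = (\<integral>\<omega>. mass C \<omega> * ?h \<omega> + mass C' \<omega> * ?h \<omega> \<partial>P)"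
          using mass_Un[OF I(1,2) disj] int I
          by (intro integral_cong_AE borel_measurable_integrable Bochner_Integration.integrable_add)
            (auto elim!: eventually_mono simp: distrib_right)
        also have "\<dots> = \<nu> C + \<nu> C'"
          unfolding \<nu>_def using I
          by (subst Bochner_Integration.integral_add[OF int int]) (auto simp only: density[OF meas_mass Z])
        finally show "\<nu> (C \<union> C') = \<nu> C + \<nu> C'" .
      }
      assume eq: "measure M C = measure M C'"
      \<comment> \<open>The number of sets in the chain
        \<open>D \<subseteq> B n \<subseteq> ... \<subseteq> B N\<close>. Its successive differences
        \<open>F D\<close> are the disjoint sets to which swapping applies, and their measures
        depend on \<open>D\<close> only through \<open>measure M D\<close>.\<close>
      define L where "L = N - n + 2"
      define chain where "chain D i = (case i of 0 \<Rightarrow> D | Suc i \<Rightarrow> B (n + i))" for D i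
      define F where "F D = disjointed (chain D)" for D
      \<comment> \<open>Recovers the integrand from the ratios of the differences: coordinate 0
        belongs to \<open>D\<close>, and the first \<open>d + 2\<close> coordinates add up to the
        ratio of \<open>B (n + d)\<close>.\<close>
      define g where "g y = y 0 * indicator {y. \<forall>d\<in>{0..N-n}. (\<Sum>i<Suc (Suc d). y i) / measure M (B (n + d)) \<in> G (n + d)} y"
        for y :: "nat \<Rightarrow> real"
      have g: "g \<in> borel_measurable (\<Pi>\<^sub>M j\<in>{..<L}. borel)"
      proof -
        have [measurable]: "(\<lambda>y. y i :: real) \<in> borel_measurable (\<Pi>\<^sub>M j\<in>{..<L}. borel)" if "i < L" for i
          using measurable_component_singleton[of i "{..<L}" "\<lambda>_. borel"] that by simp
        have [measurable]: "(\<lambda>y. \<Sum>i<Suc (Suc d). y i :: real) \<in> borel_measurable (\<Pi>\<^sub>M j\<in>{..<L}. borel)" if "d \<in> {0..N-n}" for d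
          using that by (intro borel_measurable_sum) (auto simp: L_def)
        have "0 < L" by (simp add: L_def)
        then show ?thesis
          unfolding g_def by measurable
      qed
      have \<nu>: "\<nu> D = (\<integral>y. g y \<partial>distr (density P (mass K)) (\<Pi>\<^sub>M j\<in>{..<L}. borel) (\<lambda>\<omega>. \<lambda>j\<in>{..<L}. mass (F D j) \<omega> / mass K \<omega>))"
        and F: "disjoint_family_on (F D) {..<L}" "\<And>j. F D j \<in> integrable_sets" "\<And>j. F D j \<inter> K = {}"
        and F_meas: "\<And>j. emeasure M (F D j) = (if j = 0 then measure M D else if j = 1 then measure M (B n) - measure M D
          else measure M (B (n + j - 1)) - measure M (B (n + j - 2)))"
        if D: "D \<in> sets M" "D \<subseteq> B n" for D
      proof -
        have chain: "incseq (chain D)"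
        proof (rule incseq_SucI)
          show "chain D i \<subseteq> chain D (Suc i)" for i
            using D B(2) by (cases i) (auto simp: chain_def incseq_def)
        qed
        have chain_I: "chain D i \<in> integrable_sets" for i
          using D B sub by (cases i) (auto simp: chain_def)
        show FI: "F D j \<in> integrable_sets" for j
        proof -
          have "range (disjointed (chain D)) \<subseteq> sets M"
            using chain_I by (intro sets.range_disjointed_sets) (auto intro: integrable_sets_D)
          then show ?thesis
            unfolding F_def by (intro integrable_sets_subset[OF chain_I[of j]] disjointed_subset) auto
        qed
        have "chain D j \<inter> K = {}" for j
          using D B(3) by (cases j) (auto simp: chain_def)
        then show "F D j \<inter> K = {}" for j
          unfolding F_def using disjointed_subset[of "chain D" j] by blast
        show disj: "disjoint_family_on (F D) {..<L}"
          unfolding F_def using disjoint_family_disjointed by (rule disjoint_family_on_mono[OF subset_UNIV])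
        have F_Suc: "F D (Suc i) = chain D (Suc i) - chain D i" for i
          unfolding F_def using chain by (intro disjointed_mono)
        have F_0: "F D 0 = D"
          by (simp add: F_def disjointed_0 chain_def)
        have fin_chain: "emeasure M (chain D i) < \<infinity>" for i
          using D fin emeasure_mono[OF D(2), of M] integrable_sets_D[OF B(1)]
          by (cases i) (auto simp: chain_def intro: le_less_trans)
        have F_fin: "emeasure M (F D j) = ennreal (measure M (F D j))" for j
        proof -
          have "emeasure M (F D j) \<le> emeasure M (chain D j)"
            unfolding F_def using chain_I by (intro emeasure_mono disjointed_subset integrable_sets_D)
          then show ?thesis
            using fin_chain[of j] by (intro emeasure_eq_ennreal_measure) (auto simp: top_unique)
        qed
        show "emeasure M (F D j) = (if j = 0 then measure M D else if j = 1 then measure M (B n) - measure M D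
          else measure M (B (n + j - 1)) - measure M (B (n + j - 2)))" for j
        proof (cases j)
          case 0
          then show ?thesis using F_fin[of 0] by (simp add: F_0)
        next
          case (Suc i)
          have "measure M (F D j) = measure M (chain D (Suc i)) - measure M (chain D i)"
            unfolding Suc F_Suc using chain_I fin_chain[of "Suc i"] chain
            by (intro measure_Diff integrable_sets_D) (auto simp: incseq_Suc_iff)
          then show ?thesis
            unfolding F_fin using Suc by (cases i) (auto simp: chain_def)
        qed
        have "AE \<omega> in P. \<forall>d\<in>{0..N-n}. mass (B (n + d)) \<omega> = (\<Sum>i<Suc (Suc d). mass (F D i) \<omega>)"
        proof (rule AE_finite_allI)
          fix d
          have "(\<Union>i\<in>{..<Suc (Suc d)}. F D i) = (\<Union>i\<in>{..<Suc (Suc d)}. chain D i)"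
            unfolding F_def using finite_UN_disjointed_eq[of "chain D" "Suc (Suc d)"] by (simp add: atLeast0LessThan)
          also have "\<dots> = chain D (Suc d)"
          proof (intro equalityI UN_least)
            show "chain D i \<subseteq> chain D (Suc d)" if "i \<in> {..<Suc (Suc d)}" for i
              using that by (intro incseqD[OF chain]) auto
          qed auto
          also have "\<dots> = B (n + d)"
            by (simp add: chain_def)
          finally have "B (n + d) = (\<Union>i\<in>{..<Suc (Suc d)}. F D i)" ..
          moreover have "disjoint_family_on (F D) {..<Suc (Suc d)}"
            unfolding F_def using disjoint_family_disjointed by (rule disjoint_family_on_mono[OF subset_UNIV])
          ultimately show "AE \<omega> in P. mass (B (n + d)) \<omega> = (\<Sum>i<Suc (Suc d). mass (F D i) \<omega>)"
            using mass_finite_Union[of "{..<Suc (Suc d)}" "F D"] FI by simp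
        qed simp
        then have AE: "AE \<omega> in P. g (\<lambda>j\<in>{..<L}. mass (F D j) \<omega> / mass K \<omega>) = mass D \<omega> / mass K \<omega> * indicator Z \<omega>"
        proof eventually_elim
          case (elim \<omega>)
          let ?y = "\<lambda>j\<in>{..<L}. mass (F D j) \<omega> / mass K \<omega>"
          have "(\<Sum>i<Suc (Suc d). ?y i) / measure M (B (n + d)) = R (n + d) \<omega>" if d: "d \<in> {0..N-n}" for d
          proof -
            have "(\<Sum>i<Suc (Suc d). ?y i) = (\<Sum>i<Suc (Suc d). mass (F D i) \<omega>) / mass K \<omega>"
              unfolding sum_divide_distrib using d by (intro sum.cong) (auto simp: L_def)
            then show ?thesis
              using elim d by (simp only: R_def)
          qed
          then have "(\<forall>d\<in>{0..N-n}. (\<Sum>i<Suc (Suc d). ?y i) / measure M (B (n + d)) \<in> G (n + d))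
              \<longleftrightarrow> (\<forall>d\<in>{0..N-n}. R (n + d) \<omega> \<in> G (n + d))"
            by simp
          also have "\<dots> \<longleftrightarrow> \<omega> \<in> Z"
          proof
            assume *: "\<forall>d\<in>{0..N-n}. R (n + d) \<omega> \<in> G (n + d)"
            have "R j \<omega> \<in> G j" if "j \<in> {n..N}" for j
              using *[rule_format, of "j - n"] that by auto
            then show "\<omega> \<in> Z" by (simp add: Z_def)
          qed (use mn in \<open>auto simp: Z_def\<close>)
          finally show ?case
            by (simp add: g_def indicator_def F_0 L_def)
        qed
        have meas: "(\<lambda>\<omega>. \<lambda>j\<in>{..<L}. mass (F D j) \<omega> / mass K \<omega>) \<in> measurable (density P (mass K)) (\<Pi>\<^sub>M j\<in>{..<L}. borel)"
          using FI K by (intro measurable_restrict) (auto intro!: borel_measurable_divide meas_mass)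
        have "AE \<omega> in density P (mass K). mass D \<omega> / mass K \<omega> * indicator Z \<omega> = g (\<lambda>j\<in>{..<L}. mass (F D j) \<omega> / mass K \<omega>)"
          using AE by (subst AE_density) auto
        then have "\<nu> D = (\<integral>\<omega>. g (\<lambda>j\<in>{..<L}. mass (F D j) \<omega> / mass K \<omega>) \<partial>density P (mass K))"
          unfolding \<nu>_def using measurable_compose[OF meas g] D meas_mass[OF sub[OF D]] Z
          by (intro integral_cong_AE) auto
        also have "\<dots> = (\<integral>y. g y \<partial>distr (density P (mass K)) (\<Pi>\<^sub>M j\<in>{..<L}. borel) (\<lambda>\<omega>. \<lambda>j\<in>{..<L}. mass (F D j) \<omega> / mass K \<omega>))"
          by (rule integral_distr[OF meas g, symmetric])
        finally show "\<nu> D = (\<integral>y. g y \<partial>distr (density P (mass K)) (\<Pi>\<^sub>M j\<in>{..<L}. borel) (\<lambda>\<omega>. \<lambda>j\<in>{..<L}. mass (F D j) \<omega> / mass K \<omega>))" .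
      qed
      have "C \<subseteq> B n" "C' \<subseteq> B n"
        using C by auto
      with C show "\<nu> C = \<nu> C'"
        using eq by (subst (1 2) \<nu>) (auto intro!: arg_cong[where f="\<lambda>N. integral\<^sup>L N g"] distr_ratio_eq K F simp: F_meas)
    qed (use mn B fin in \<open>auto intro!: integrable_sets_D simp: incseq_def\<close>)
    then have "\<nu> (B m) / measure M (B m) = \<nu> (B n) / measure M (B n)"
      using pos[of m] pos[of n] by (simp add: field_simps)
    then show "(\<integral>\<omega>. R m \<omega> * indicator {\<omega>. \<forall>j\<in>{n..N}. R j \<omega> \<in> G j} \<omega> \<partial>density P (mass K))
        = (\<integral>\<omega>. R n \<omega> * indicator {\<omega>. \<forall>j\<in>{n..N}. R j \<omega> \<in> G j} \<omega> \<partial>density P (mass K))"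
    proof -
      have "(\<integral>\<omega>. R k \<omega> * indicator Z \<omega> \<partial>density P (mass K)) = \<nu> (B k) / measure M (B k)" for k
      proof -
        have "R k \<omega> * indicator Z \<omega> = mass (B k) \<omega> / mass K \<omega> * indicator Z \<omega> / measure M (B k)" for \<omega>
          by (simp add: R_def)
        then show ?thesis
          unfolding \<nu>_def by (simp only: Bochner_Integration.integral_divide_zero)
      qed
      with \<open>\<nu> (B m) / measure M (B m) = \<nu> (B n) / measure M (B n)\<close> show ?thesis
        unfolding Z_def[symmetric] by simp
    qed
  qed
qed

text \<open>The measure with density \<open>mass K\<close> does not charge the event
  \<open>mass K = 0\<close>, so convergence is obtained off this event only; there the constant
  factor \<open>mass K\<close> is harmless.\<close>

lemma AE_convergent_off:
  assumes K: "K \<in> integrable_sets"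
    and B: "\<And>n. B n \<in> integrable_sets" "incseq B" "\<And>n. B n \<inter> K = {}"
    and fin: "\<And>n. emeasure M (B n) < \<infinity>" and pos: "\<And>n. 0 < measure M (B n)"
  shows "AE \<omega> in P. 0 < mass K \<omega> \<longrightarrow> convergent (\<lambda>n. mass (B n) \<omega> / measure M (B n))"
proof -
  interpret reverse_martingale "density P (mass K)" "\<lambda>n \<omega>. mass (B n) \<omega> / mass K \<omega> / measure M (B n)"
    by (rule reverse_martingale_ratio) fact+
  have "AE \<omega> in density P (mass K). convergent (\<lambda>n. mass (B n) \<omega> / mass K \<omega> / measure M (B n))"
    by (rule AE_convergent) simp
  moreover have [measurable]: "mass K \<in> borel_measurable P"
    using K by (intro measurable_mass integrable_sets_D)
  ultimately have "AE \<omega> in P. 0 < mass K \<omega> \<longrightarrow> convergent (\<lambda>n. mass (B n) \<omega> / mass K \<omega> / measure M (B n))"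
    by (subst (asm) AE_density) auto
  then show ?thesis
  proof eventually_elim
    case (elim \<omega>)
    show ?case
    proof
      assume pos: "0 < mass K \<omega>"
      with elim obtain l where "(\<lambda>n. mass (B n) \<omega> / mass K \<omega> / measure M (B n)) \<longlonglongrightarrow> l"
        by (auto simp: convergent_def)
      then have "(\<lambda>n. mass K \<omega> * (mass (B n) \<omega> / mass K \<omega> / measure M (B n))) \<longlonglongrightarrow> mass K \<omega> * l"
        by (rule tendsto_mult_left)
      then show "convergent (\<lambda>n. mass (B n) \<omega> / measure M (B n))"
        using pos by (auto simp: convergent_def)
    qed
  qed
qed

section \<open>Convergence along \<mu>-sequences\<close>

lemma mu_sequence_measure:
  assumes "mu_sequence M A"
  shows "A n \<in> sets M" "incseq A" "emeasure M (A n) < \<infinity>" "emeasure M (A n) = ennreal (measure M (A n))"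
    "filterlim (\<lambda>n. measure M (A n)) at_top sequentially"
proof -
  show 1: "A n \<in> sets M" "incseq A" "emeasure M (A n) < \<infinity>" for n
    using assms by (auto simp: mu_sequence_def)
  show 2: "emeasure M (A n) = ennreal (measure M (A n))" for n
    using 1(3)[of n] by (intro emeasure_eq_ennreal_measure) auto
  have "(\<lambda>n. emeasure M (A n)) \<longlonglongrightarrow> \<infinity>"
    using assms by (simp add: mu_sequence_def)
  then have lim: "(\<lambda>n. ennreal (measure M (A n))) \<longlonglongrightarrow> top"
    by (simp add: 2)
  show "filterlim (\<lambda>n. measure M (A n)) at_top sequentially"
    unfolding filterlim_at_top
  proof (rule allI, goal_cases)
    case (1 Z)
    have "eventually (\<lambda>n. ennreal (max 0 Z) < ennreal (measure M (A n))) sequentially"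
      by (rule order_tendstoD(1)[OF lim]) (simp add: less_top[symmetric])
    then show ?case
    proof eventually_elim
      case (elim n)
      then have "max 0 Z < measure M (A n)"
        by (subst (asm) ennreal_less_iff) auto
      then show ?case by simp
    qed
  qed
qed

lemma measure_ratio_eq:
  assumes "A n \<in> integrable_sets" "emeasure M (A n) < \<infinity>" "0 < measure M (A n)"
  shows "AE \<omega> in P. measure_ratio M \<xi> A n \<omega> = ereal (mass (A n) \<omega> / measure M (A n))"
  using AE_emeasure_eq[OF assms(1)]
proof eventually_elim
  case (elim \<omega>)
  have "emeasure M (A n) = ennreal (measure M (A n))"
    using assms(2) by (intro emeasure_eq_ennreal_measure) auto
  with elim show ?case
    using assms(3) by (simp add: measure_ratio_def divide_ennreal enn2ereal_ennreal)
qed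

theorem AE_convergent_measure_ratio:
  assumes A: "mu_sequence M A" and int: "integrable_sequence P \<xi> A"
  shows "\<exists>X :: 'w \<Rightarrow> real. integrable P X \<and> (AE \<omega> in P. (\<lambda>n. measure_ratio M \<xi> A n \<omega>) \<longlonglongrightarrow> ereal (X \<omega>))"
proof -
  note A' = mu_sequence_measure[OF A]
  have I: "A n \<in> integrable_sets" for n
    using int A' by (simp add: integrable_sequence_def integrable_sets_def)
  have [measurable]: "mass (A n) \<in> borel_measurable P" for n
    using I by (intro measurable_mass integrable_sets_D)
  have large: "\<exists>n0. \<forall>n\<ge>n0. b < measure M (A n)" for b
    using A'(5) by (auto simp: filterlim_at_top_dense eventually_sequentially)
  obtain n0 where n0: "\<And>n. n \<ge> n0 \<Longrightarrow> 0 < measure M (A n)"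
    using large by blast
  define r where "r n \<omega> = mass (A n) \<omega> / measure M (A n)" for n \<omega>
  have [measurable]: "r n \<in> borel_measurable P" for n
    unfolding r_def by measurable
  have off: "AE \<omega> in P. 0 < mass (A k) \<omega> \<longrightarrow> convergent (\<lambda>n. r n \<omega>)" for k
  proof -
    obtain n1 where n1: "\<And>n. n \<ge> n1 \<Longrightarrow> measure M (A k) < measure M (A n)"
      using large by blast
    \<comment> \<open>Starting at \<open>n1 + k\<close> makes the sets contain \<open>A k\<close>
      and leaves a positive measure after its removal.\<close>
    define B where "B n = A (n1 + k + n) - A k" for n
    have sub: "A k \<subseteq> A (n1 + k + n)" for n
      using A'(2) by (simp add: incseq_def)
    have measure_B: "measure M (B n) = measure M (A (n1 + k + n)) - measure M (A k)" for n
      unfolding B_def using A'(1,3)[of "n1 + k + n"] A'(1) sub by (intro measure_Diff) auto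
    have B_I: "B n \<in> integrable_sets" for n
      unfolding B_def using A'(1) by (intro integrable_sets_subset[OF I]) auto
    have pos: "0 < measure M (B n)" for n
      unfolding measure_B using n1[of "n1 + k + n"] by simp
    have "AE \<omega> in P. 0 < mass (A k) \<omega> \<longrightarrow> convergent (\<lambda>n. mass (B n) \<omega> / measure M (B n))"
    proof (rule AE_convergent_off)
      show "incseq B"
      proof (rule incseq_SucI)
        show "B i \<subseteq> B (Suc i)" for i
          using incseqD[OF A'(2), of "n1 + k + i" "n1 + k + Suc i"] by (auto simp: B_def)
      qed
      show "emeasure M (B n) < \<infinity>" for n
        using emeasure_mono[of "B n" "A (n1 + k + n)" M] A'(1,3)[of "n1 + k + n"] by (auto simp: B_def intro: le_less_trans)
    qed (use I B_I pos in \<open>auto simp: B_def\<close>)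
    moreover have "AE \<omega> in P. \<forall>n. mass (A (n1 + k + n)) \<omega> = mass (A k) \<omega> + mass (B n) \<omega>"
      unfolding AE_all_countable
    proof
      fix n
      have "A k \<union> B n = A (n1 + k + n)"
        using sub[of n] by (auto simp: B_def)
      then show "AE \<omega> in P. mass (A (n1 + k + n)) \<omega> = mass (A k) \<omega> + mass (B n) \<omega>"
        using mass_Un[OF I[of k] B_I[of n]] by (auto simp: B_def)
    qed
    ultimately show ?thesis
    proof eventually_elim
      case (elim \<omega>)
      show ?case
      proof
        assume "0 < mass (A k) \<omega>"
        with elim obtain l where l: "(\<lambda>n. mass (B n) \<omega> / measure M (B n)) \<longlonglongrightarrow> l"
          by (auto simp: convergent_def)
        let ?a = "\<lambda>n. measure M (A (n1 + k + n))"
        have a: "filterlim ?a at_top sequentially"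
          using filterlim_compose[OF A'(5) filterlim_add_const_nat_at_top[of "n1 + k"]] by (simp add: add.commute)
        have lim0: "(\<lambda>n. c / ?a n) \<longlonglongrightarrow> 0" for c
          using a by (rule tendsto_divide_0[OF tendsto_const filterlim_at_top_imp_at_infinity])
        \<comment> \<open>Putting \<open>A k\<close> back changes neither the limit of the masses
          nor that of the measures, since \<open>?a\<close> tends to infinity.\<close>
        have "(\<lambda>n. mass (A k) \<omega> / ?a n + mass (B n) \<omega> / measure M (B n) * (1 - measure M (A k) / ?a n)) \<longlonglongrightarrow> 0 + l * (1 - 0)"
          by (intro tendsto_intros l lim0)
        moreover have "mass (A k) \<omega> / ?a n + mass (B n) \<omega> / measure M (B n) * (1 - measure M (A k) / ?a n) = r (n + (n1 + k)) \<omega>" for n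
        proof -
          have "0 < ?a n"
            using pos[of n] measure_B[of n] by (smt (verit) measure_nonneg)
          then have "1 - measure M (A k) / ?a n = measure M (B n) / ?a n"
            by (simp add: measure_B diff_divide_distrib)
          then have "mass (A k) \<omega> / ?a n + mass (B n) \<omega> / measure M (B n) * (1 - measure M (A k) / ?a n)
              = (mass (A k) \<omega> + mass (B n) \<omega>) / ?a n"
            using pos[of n] by (simp add: add_divide_distrib)
          moreover have idx: "n + (n1 + k) = n1 + k + n"
            by simp
          ultimately show ?thesis
            unfolding r_def idx elim(2)[rule_format] by simp
        qed
        ultimately have "(\<lambda>n. r (n + (n1 + k)) \<omega>) \<longlonglongrightarrow> l"
          by simp
        then have "(\<lambda>n. r n \<omega>) \<longlonglongrightarrow> l"
          by (rule LIMSEQ_offset)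
        then show "convergent (\<lambda>n. r n \<omega>)"
          by (rule convergentI)
      qed
    qed
  qed
  have conv: "AE \<omega> in P. convergent (\<lambda>n. r n \<omega>)"
  proof -
    have "AE \<omega> in P. \<forall>k. 0 < mass (A k) \<omega> \<longrightarrow> convergent (\<lambda>n. r n \<omega>)"
      unfolding AE_all_countable using off by blast
    then show ?thesis
    proof eventually_elim
      case (elim \<omega>)
      show ?case
      proof (cases "\<exists>k. 0 < mass (A k) \<omega>")
        \<comment> \<open>On paths that no weight \<open>mass (A k)\<close> sees, all quotients are
          0.\<close>
        case False
        then have "mass (A n) \<omega> = 0" for n
          using mass_nonneg[of "A n" \<omega>] by (metis less_le)
        then show ?thesis
          by (simp add: r_def convergent_const)
      qed (use elim in blast)
    qed
  qed
  define X where "X \<omega> = lim (\<lambda>n. r n \<omega>)" for \<omega>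
  have [measurable]: "X \<in> borel_measurable P"
    unfolding X_def by measurable
  have lim: "AE \<omega> in P. (\<lambda>n. r n \<omega>) \<longlonglongrightarrow> X \<omega>"
    using conv by eventually_elim (simp add: X_def convergent_LIMSEQ_iff)
  have r_nonneg: "0 \<le> r n \<omega>" for n \<omega>
    by (simp add: r_def)
  \<comment> \<open>The mean of \<open>r n\<close> does not depend on \<open>n\<close> once the
    denominators are positive, so Fatou's lemma bounds the mean of
    \<open>\<bar>X\<bar>\<close>.\<close>
  have int_r: "(\<integral>\<^sup>+\<omega>. ennreal (r n \<omega>) \<partial>P) = ennreal (expectation (mass (A n0)) / measure M (A n0))" if "n \<ge> n0" for n
  proof -
    have "measure M (A n) * expectation (mass (A n0)) = measure M (A n0) * expectation (mass (A n))"
      using A' I that by (intro expectation_mass_linear) (auto simp: incseq_def)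
    then have "expectation (r n) = expectation (mass (A n0)) / measure M (A n0)"
      using n0[OF that] n0[of n0] unfolding r_def by (simp add: field_simps)
    moreover have "integrable P (r n)"
      unfolding r_def[abs_def] using integrable_mass[OF I[of n]] by simp
    ultimately show ?thesis
      using r_nonneg by (subst nn_integral_eq_integral) auto
  qed
  have "(\<integral>\<^sup>+\<omega>. ennreal \<bar>X \<omega>\<bar> \<partial>P) = (\<integral>\<^sup>+\<omega>. liminf (\<lambda>n. ennreal (r n \<omega>)) \<partial>P)"
  proof (rule nn_integral_cong_AE)
    show "AE \<omega> in P. ennreal \<bar>X \<omega>\<bar> = liminf (\<lambda>n. ennreal (r n \<omega>))"
      using lim
    proof eventually_elim
      case (elim \<omega>)
      then have "0 \<le> X \<omega>"
        using r_nonneg by (intro LIMSEQ_le_const[OF elim]) auto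
      moreover have "(\<lambda>n. ennreal (r n \<omega>)) \<longlonglongrightarrow> ennreal (X \<omega>)"
        using elim by (rule tendsto_ennrealI)
      ultimately show ?case
        by (simp add: lim_imp_Liminf)
    qed
  qed
  also have "\<dots> \<le> liminf (\<lambda>n. \<integral>\<^sup>+\<omega>. ennreal (r n \<omega>) \<partial>P)"
    by (intro nn_integral_liminf) measurable
  also have "\<dots> = liminf (\<lambda>n. ennreal (expectation (mass (A n0)) / measure M (A n0)))"
    using int_r by (intro Liminf_eq) (auto simp: eventually_sequentially)
  also have "\<dots> < \<infinity>"
    by (simp add: Liminf_const)
  finally have "integrable P X"
    by (intro integrableI_bounded) auto
  moreover have "AE \<omega> in P. (\<lambda>n. measure_ratio M \<xi> A n \<omega>) \<longlonglongrightarrow> ereal (X \<omega>)"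
  proof -
    have "AE \<omega> in P. \<forall>n\<in>{n0..}. measure_ratio M \<xi> A n \<omega> = ereal (r n \<omega>)"
      unfolding r_def using measure_ratio_eq I A'(3) n0 by (subst AE_ball_countable) auto
    with lim show ?thesis
    proof eventually_elim
      case (elim \<omega>)
      have "(\<lambda>n. ereal (r n \<omega>)) \<longlonglongrightarrow> ereal (X \<omega>)"
        using elim(1) by simp
      then show ?case
        by (rule Lim_transform_eventually) (use elim(2) in \<open>auto simp: eventually_sequentially intro!: exI[of _ n0]\<close>)
    qed
  qed
  ultimately show ?thesis by blast
qed

end

section \<open>Convergence in mean\<close>

locale swap_invariant_limit = swap_invariant_measure P M \<xi>
  for P :: "'w measure" and M :: "'s measure" and \<xi> :: "'w \<Rightarrow> 's measure" +
  fixes A :: "nat \<Rightarrow> 's set" and X :: "'w \<Rightarrow> real"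
  assumes sigma_finite_M: "sigma_finite_measure M"
    and sigma_finite_intensity: "sigma_finite_measure (intensity P M \<xi>)"
    and mu_sequence: "mu_sequence M A" and constant_increments: "constant_increments M A"
    and tendsto_X: "tendsto_L1 P (measure_ratio M \<xi> A) X"
    and expectation_X_pos: "0 < expectation X"
begin

lemma integrable_X: "integrable P X"
  using tendsto_X by (simp add: tendsto_L1_def)

lemma measurable_X [measurable]: "X \<in> borel_measurable P"
  using integrable_X by auto

lemmas A = mu_sequence_measure[OF mu_sequence]

text \<open>The measures form an arithmetic progression that begins with its own step,
  \<open>A 0\<close> being the first increment. Hence the measures of \<open>A n\<close> and
  \<open>A m\<close> add up to that of \<open>A (n + m + 1)\<close>.\<close>

lemma measure_A: "\<exists>c>0. \<forall>n. measure M (A n) = real (Suc n) * c"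
proof -
  obtain c where c: "0 < c" "c < \<infinity>" "\<And>n. emeasure M (increment A n) = c"
    using constant_increments by (auto simp: constant_increments_def)
  have m: "measure M (increment A n) = enn2real c" for n
    by (simp add: measure_def c(3))
  have "measure M (A n) = real (Suc n) * enn2real c" for n
  proof (induction n)
    case 0
    then show ?case using m[of 0] by (simp add: increment_def)
  next
    case (Suc n)
    have "measure M (A (Suc n) - A n) = measure M (A (Suc n)) - measure M (A n)"
      using A(1) A(3)[of "Suc n"] A(2) by (intro measure_Diff) (auto simp: incseq_Suc_iff)
    then show ?case
      using m[of "Suc n"] Suc by (simp add: increment_def algebra_simps)
  qed
  moreover have "0 < enn2real c"
    using c by (simp add: enn2real_positive_iff)
  ultimately show ?thesis by blast
qed

definition step :: real where
  "step = (SOME c. 0 < c \<and> (\<forall>n. measure M (A n) = real (Suc n) * c))"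

lemma step: "0 < step" "measure M (A n) = real (Suc n) * step"
proof -
  have "0 < step \<and> (\<forall>n. measure M (A n) = real (Suc n) * step)"
    unfolding step_def by (rule someI_ex[OF measure_A])
  then show "0 < step" "measure M (A n) = real (Suc n) * step"
    by auto
qed

text \<open>Closeness to the integrable \<open>X\<close> bounds the mean of \<xi>(A k) for one large
  \<open>k\<close>, and \<open>A n\<close> lies in \<open>A k\<close>.\<close>

lemma A_integrable: "A n \<in> integrable_sets"
proof -
  have "(\<lambda>n. \<integral>\<^sup>+\<omega>. e2ennreal \<bar>measure_ratio M \<xi> A n \<omega> - ereal (X \<omega>)\<bar> \<partial>P) \<longlonglongrightarrow> 0"
    using tendsto_X by (simp add: tendsto_L1_def)
  then have "eventually (\<lambda>n. (\<integral>\<^sup>+\<omega>. e2ennreal \<bar>measure_ratio M \<xi> A n \<omega> - ereal (X \<omega>)\<bar> \<partial>P) < 1) sequentially"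
    by (rule order_tendstoD(2)) simp
  then obtain N where N: "\<And>n. n \<ge> N \<Longrightarrow> (\<integral>\<^sup>+\<omega>. e2ennreal \<bar>measure_ratio M \<xi> A n \<omega> - ereal (X \<omega>)\<bar> \<partial>P) < 1"
    by (auto simp: eventually_sequentially)
  define k where "k = max n N"
  have [measurable]: "measure_ratio M \<xi> A k \<in> borel_measurable P"
    using tendsto_X by (simp add: tendsto_L1_def)
  have [measurable]: "A k \<in> sets M"
    by (rule A(1))
  \<comment> \<open>Triangle inequality that also holds for \<open>y = \<infinity>\<close>, where
    the first term on the right is infinite.\<close>
  have bound: "y \<le> e2ennreal \<bar>enn2ereal y - ereal x\<bar> + ennreal \<bar>x\<bar>" for y x
  proof (cases y)
    case (real r)
    then have "e2ennreal \<bar>enn2ereal y - ereal x\<bar> = ennreal \<bar>r - x\<bar>"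
      by (simp add: enn2ereal_ennreal e2ennreal_ereal)
    then show ?thesis
      using real by (simp flip: ennreal_plus)
  next
    case top
    then show ?thesis by simp
  qed
  have "(\<integral>\<^sup>+\<omega>. emeasure (\<xi> \<omega>) (A k) / emeasure M (A k) \<partial>P)
      \<le> (\<integral>\<^sup>+\<omega>. e2ennreal \<bar>measure_ratio M \<xi> A k \<omega> - ereal (X \<omega>)\<bar> + ennreal \<bar>X \<omega>\<bar> \<partial>P)"
    unfolding measure_ratio_def by (intro nn_integral_mono bound)
  also have "\<dots> = (\<integral>\<^sup>+\<omega>. e2ennreal \<bar>measure_ratio M \<xi> A k \<omega> - ereal (X \<omega>)\<bar> \<partial>P) + (\<integral>\<^sup>+\<omega>. ennreal \<bar>X \<omega>\<bar> \<partial>P)"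
    by (intro nn_integral_add) measurable
  also have "\<dots> < \<infinity>"
  proof -
    have "(\<integral>\<^sup>+\<omega>. e2ennreal \<bar>measure_ratio M \<xi> A k \<omega> - ereal (X \<omega>)\<bar> \<partial>P) < 1"
      by (rule N) (simp add: k_def)
    then have "(\<integral>\<^sup>+\<omega>. e2ennreal \<bar>measure_ratio M \<xi> A k \<omega> - ereal (X \<omega>)\<bar> \<partial>P) < \<infinity>"
      by (rule less_trans) simp
    moreover have "(\<integral>\<^sup>+\<omega>. ennreal \<bar>X \<omega>\<bar> \<partial>P) < \<infinity>"
      using integrable_X by (simp add: integrable_iff_bounded)
    ultimately show ?thesis by simp
  qed
  finally have "(\<integral>\<^sup>+\<omega>. emeasure (\<xi> \<omega>) (A k) \<partial>P) / emeasure M (A k) < \<infinity>"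
    by (subst (asm) nn_integral_divide) auto
  moreover have "0 < emeasure M (A k)" "emeasure M (A k) < \<infinity>"
    using step(1) step(2)[of k] A(3,4)[of k] by simp_all
  ultimately have "(\<integral>\<^sup>+\<omega>. emeasure (\<xi> \<omega>) (A k) \<partial>P) \<noteq> \<infinity>"
    by (auto simp: ennreal_top_divide split: if_splits)
  then have "(\<integral>\<^sup>+\<omega>. emeasure (\<xi> \<omega>) (A k) \<partial>P) < \<infinity>"
    by (simp add: less_top)
  then have "A k \<in> integrable_sets"
    using A(1) by (simp add: integrable_sets_def)
  moreover have "A n \<subseteq> A k"
    by (rule incseqD[OF A(2)]) (simp add: k_def)
  ultimately show ?thesis
    by (rule integrable_sets_subset[OF _ A(1)])
qed

section \<open>Mean distance to the limit\<close>

definition deviation :: "'s set \<Rightarrow> real" where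
  "deviation B = expectation (\<lambda>\<omega>. \<bar>mass B \<omega> / measure M B - X \<omega>\<bar>)"

lemma integrable_quotient: "B \<in> integrable_sets \<Longrightarrow> integrable P (\<lambda>\<omega>. mass B \<omega> / r)"
  using integrable_mass[of B] by (rule integrable_divide)

lemma nn_integral_deviation:
  assumes B: "B n \<in> integrable_sets" "emeasure M (B n) < \<infinity>" "0 < measure M (B n)"
  shows "(\<integral>\<^sup>+\<omega>. e2ennreal \<bar>measure_ratio M \<xi> B n \<omega> - ereal (X \<omega>)\<bar> \<partial>P) = ennreal (deviation (B n))"
proof -
  have "(\<integral>\<^sup>+\<omega>. e2ennreal \<bar>measure_ratio M \<xi> B n \<omega> - ereal (X \<omega>)\<bar> \<partial>P)
      = (\<integral>\<^sup>+\<omega>. ennreal \<bar>mass (B n) \<omega> / measure M (B n) - X \<omega>\<bar> \<partial>P)"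
    using measure_ratio_eq[of B n, OF B] by (intro nn_integral_cong_AE) (auto elim!: eventually_mono simp: e2ennreal_ereal)
  also have "\<dots> = ennreal (deviation (B n))"
    unfolding deviation_def using B integrable_X
    by (intro nn_integral_eq_integral integrable_abs Bochner_Integration.integrable_diff integrable_quotient) auto
  finally show ?thesis .
qed

lemma deviation_A: "(\<lambda>n. deviation (A n)) \<longlonglongrightarrow> 0"
proof -
  have "0 < measure M (A n)" for n
    unfolding step(2) using step(1) by simp
  then have "(\<integral>\<^sup>+\<omega>. e2ennreal \<bar>measure_ratio M \<xi> A n \<omega> - ereal (X \<omega>)\<bar> \<partial>P) = ennreal (deviation (A n))" for n
    by (rule nn_integral_deviation[of A n, OF A_integrable A(3)])
  then have "(\<lambda>n. ennreal (deviation (A n))) \<longlonglongrightarrow> ennreal 0"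
    using tendsto_X unfolding tendsto_L1_def by (simp only: ennreal_0)
  then show ?thesis
    by (subst (asm) tendsto_ennreal_iff) (auto simp: deviation_def)
qed

text \<open>All quotients \<xi>(A n) / \<mu>(A n) have the same mean \<open>q\<close>, and their
  limit in mean is \<open>X\<close>.\<close>

lemma expectation_mass_A: "expectation (mass (A n)) = expectation X * measure M (A n)"
proof -
  define q where "q = expectation (mass (A 0)) / step"
  have q: "expectation (mass (A n)) = q * measure M (A n)" for n
  proof -
    have "measure M (A n) * expectation (mass (A 0)) = measure M (A 0) * expectation (mass (A n))"
      using incseqD[OF A(2), of 0 n] by (intro expectation_mass_linear A_integrable A) auto
    then show ?thesis
      using step(1) unfolding step(2) q_def by (simp add: field_simps)
  qed
  have "\<bar>q - expectation X\<bar> \<le> deviation (A n)" for n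
  proof -
    have "q - expectation X = expectation (\<lambda>\<omega>. mass (A n) \<omega> / measure M (A n) - X \<omega>)"
      using integrable_X integrable_quotient[OF A_integrable] q[of n] step(1) step(2)[of n] by simp
    then show ?thesis
      unfolding deviation_def by (simp only: integral_abs_bound)
  qed
  then have "\<bar>q - expectation X\<bar> \<le> 0"
    by (intro LIMSEQ_le_const[OF deviation_A]) auto
  with q show ?thesis by simp
qed

lemma expectation_mass:
  assumes B: "B \<in> integrable_sets" "emeasure M B < \<infinity>"
  shows "expectation (mass B) = expectation X * measure M B"
proof -
  obtain n where n: "measure M B / step < real n"
    using reals_Archimedean2 by blast
  then have "measure M B \<le> real n * step"
    using step(1) by (simp add: field_simps)
  also have "\<dots> \<le> measure M (A n)"
    unfolding step(2) using step(1) by simp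
  finally obtain C where C: "C \<in> sets M" "C \<subseteq> A n" "measure M C = measure M B"
    by (rule_tac atomless_subset_of_measure[OF atomless A(1) A(3), of "measure M B" n]) auto
  have "emeasure M C < \<infinity>"
    using emeasure_mono[OF C(2) A(1)] A(3) by (rule le_less_trans)
  then have "emeasure M B = emeasure M C"
    using B C by (simp add: emeasure_eq_ennreal_measure)
  then have "expectation (mass B) = expectation (mass C)"
    by (rule expectation_mass_cong[OF B(1) integrable_sets_subset[OF A_integrable C(1,2)]])
  moreover have "measure M (A n) * expectation (mass C) = measure M C * expectation (mass (A n))"
    by (rule expectation_mass_linear[OF A_integrable A(3) C(1,2)])
  moreover have "measure M (A n) > 0"
    unfolding step(2) using step(1) by simp
  ultimately show ?thesis
    unfolding expectation_mass_A C(3) by simp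
qed

text \<open>Exhaust \<open>B\<close> by sets of finite intensity. Each part has intensity at most
  \<open>expectation X\<close> times the measure of \<open>B\<close>, a bound that passes to the
  union by monotone convergence.\<close>

lemma finite_measure_integrable:
  assumes B: "B \<in> sets M" "emeasure M B < \<infinity>"
  shows "B \<in> integrable_sets"
proof -
  interpret I: sigma_finite_measure "intensity P M \<xi>"
    by (rule sigma_finite_intensity)
  obtain S :: "nat \<Rightarrow> 's set" where S: "range S \<subseteq> sets (intensity P M \<xi>)"
    "(\<Union>i. S i) = space (intensity P M \<xi>)" "\<And>i. emeasure (intensity P M \<xi>) (S i) \<noteq> \<infinity>" "incseq S"
    using I.sigma_finite_incseq by blast
  have S_sets: "S i \<in> sets M" for i
    using S(1) by auto
  have part: "emeasure (intensity P M \<xi>) (B \<inter> S i) \<le> ennreal (expectation X) * emeasure M B" for i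
  proof -
    have "S i \<in> integrable_sets"
      using S(3)[of i] S_sets emeasure_intensity[OF random_measure S_sets] by (simp add: integrable_sets_def less_top)
    then have I: "B \<inter> S i \<in> integrable_sets"
      by (rule integrable_sets_subset) (use B S_sets in auto)
    have le: "emeasure M (B \<inter> S i) \<le> emeasure M B"
      using B by (intro emeasure_mono) auto
    then have fin: "emeasure M (B \<inter> S i) < \<infinity>"
      using B(2) by (rule le_less_trans)
    have "emeasure (intensity P M \<xi>) (B \<inter> S i) = ennreal (expectation (mass (B \<inter> S i)))"
      using B S_sets nn_integral_emeasure_eq[OF I] by (simp add: emeasure_intensity[OF random_measure])
    also have "\<dots> = ennreal (expectation X) * emeasure M (B \<inter> S i)"
      using fin expectation_X_pos by (simp add: expectation_mass[OF I fin] ennreal_mult emeasure_eq_ennreal_measure)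
    also have "\<dots> \<le> ennreal (expectation X) * emeasure M B"
      using le by (rule mult_left_mono) simp
    finally show ?thesis .
  qed
  have "B = (\<Union>i. B \<inter> S i)"
    using S(2) sets.sets_into_space[OF B(1)] by auto
  moreover have "incseq (\<lambda>i. B \<inter> S i)"
    using S(4) by (auto simp: incseq_def)
  ultimately have "emeasure (intensity P M \<xi>) B = (SUP i. emeasure (intensity P M \<xi>) (B \<inter> S i))"
    using B S_sets by (subst SUP_emeasure_incseq) auto
  also have "\<dots> \<le> ennreal (expectation X) * emeasure M B"
    using part by (intro SUP_least) auto
  also have "\<dots> < \<infinity>"
    using B by (simp add: ennreal_mult_less_top)
  finally show ?thesis
    using B by (simp add: integrable_sets_def emeasure_intensity[OF random_measure])
qed

text \<open>A nested pair is a linear combination of the disjoint sets \<open>C\<close> and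
  \<open>D - C\<close>, whose measures are determined by those of \<open>C\<close> and
  \<open>D\<close>.\<close>

lemma expectation_abs_cong_nested:
  assumes C: "C \<in> sets M" "C \<subseteq> D" "D \<in> sets M" "emeasure M D < \<infinity>"
    and C': "C' \<in> sets M" "C' \<subseteq> D'" "D' \<in> sets M" "emeasure M D' < \<infinity>"
    and eq: "measure M C = measure M C'" "measure M D = measure M D'"
  shows "expectation (\<lambda>\<omega>. \<bar>mass C \<omega> / s - mass D \<omega> / t\<bar>) = expectation (\<lambda>\<omega>. \<bar>mass C' \<omega> / s - mass D' \<omega> / t\<bar>)"
proof -
  define F :: "'s set \<Rightarrow> 's set \<Rightarrow> nat \<Rightarrow> 's set" where "F E G j = (if j = 0 then E else G - E)" for E G j
  define u where "u j = (if j = 0 then 1 / s - 1 / t else - (1 / t))" for j :: nat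
  have *: "expectation (\<lambda>\<omega>. \<bar>mass E \<omega> / s - mass G \<omega> / t\<bar>) = expectation (\<lambda>\<omega>. \<bar>\<Sum>j<2. u j * mass (F E G j) \<omega>\<bar>)"
    and I: "\<And>j. F E G j \<in> integrable_sets"
    and m: "\<And>j. emeasure M (F E G j) = (if j = 0 then ennreal (measure M E) else ennreal (measure M G - measure M E))"
    if E: "E \<in> sets M" "E \<subseteq> G" "G \<in> sets M" "emeasure M G < \<infinity>" for E G
  proof -
    have fin: "emeasure M E' < \<infinity>" if "E' \<subseteq> G" for E'
      using emeasure_mono[OF that E(3)] E(4) by (rule le_less_trans)
    show I: "F E G j \<in> integrable_sets" for j
      unfolding F_def using E fin by (auto intro!: finite_measure_integrable)
    have "AE \<omega> in P. mass (E \<union> (G - E)) \<omega> = mass E \<omega> + mass (G - E) \<omega>"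
      using I[of 0] I[of 1] by (intro mass_Un) (auto simp: F_def)
    moreover have "E \<union> (G - E) = G"
      using E by auto
    ultimately have "AE \<omega> in P. \<bar>mass E \<omega> / s - mass G \<omega> / t\<bar> = \<bar>\<Sum>j<2. u j * mass (F E G j) \<omega>\<bar>"
      by (auto elim!: eventually_mono simp: u_def F_def numeral_2_eq_2 field_simps diff_divide_distrib add_divide_distrib)
    then show "expectation (\<lambda>\<omega>. \<bar>mass E \<omega> / s - mass G \<omega> / t\<bar>) = expectation (\<lambda>\<omega>. \<bar>\<Sum>j<2. u j * mass (F E G j) \<omega>\<bar>)"
      using E I by (intro integral_cong_AE borel_measurable_abs borel_measurable_diff borel_measurable_divide
        borel_measurable_sum borel_measurable_times borel_measurable_const measurable_mass) (auto intro: integrable_sets_D)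
    have "measure M (G - E) = measure M G - measure M E"
      using E by (intro measure_Diff) auto
    then show "emeasure M (F E G j) = (if j = 0 then ennreal (measure M E) else ennreal (measure M G - measure M E))" for j
      using fin[of E] fin[of "G - E"] E by (auto simp: F_def emeasure_eq_ennreal_measure)
  qed
  have disj: "disjoint_family_on (F E G) {..<2}" for E G
    by (auto simp: disjoint_family_on_def F_def)
  show ?thesis
    unfolding *[OF C] *[OF C'] using C C' disj I m eq by (intro swap) auto
qed

lemma expectation_abs_triangle:
  fixes f g h :: "'w \<Rightarrow> real"
  assumes "integrable P f" "integrable P g" "integrable P h"
  shows "expectation (\<lambda>\<omega>. \<bar>f \<omega> - h \<omega>\<bar>) \<le> expectation (\<lambda>\<omega>. \<bar>f \<omega> - g \<omega>\<bar>) + expectation (\<lambda>\<omega>. \<bar>g \<omega> - h \<omega>\<bar>)"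
proof -
  have "expectation (\<lambda>\<omega>. \<bar>f \<omega> - h \<omega>\<bar>) \<le> expectation (\<lambda>\<omega>. \<bar>f \<omega> - g \<omega>\<bar> + \<bar>g \<omega> - h \<omega>\<bar>)"
    using assms by (intro integral_mono) auto
  then show ?thesis
    using assms by simp
qed

text \<open>\<open>B\<close> and \<open>A m\<close> are compared through a set \<open>D\<close> containing both, whose measure is that of some
  \<open>A k\<close>; the nested pairs \<open>(B, D)\<close> and \<open>(A m, D)\<close> can be moved to \<open>(A n, A k)\<close> and \<open>(A m, A k)\<close>.\<close>

lemma deviation_le_deviation_A:
  assumes B: "B \<in> sets M" "emeasure M B < \<infinity>" "measure M B = measure M (A n)"
  shows "deviation B \<le> deviation (A n)"
proof -
  define a where "a k = measure M (A k)" for k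
  have int: "integrable P (\<lambda>\<omega>. mass C \<omega> / r)" if "C \<in> sets M" "emeasure M C < \<infinity>" for C r
    using finite_measure_integrable[OF that] by (rule integrable_quotient)
  have "deviation B \<le> deviation (A n) + 2 * deviation (A (n + m + 1)) + 2 * deviation (A m)" for m
  proof -
    \<comment> \<open>Then \<open>a k = a n + a m\<close>, which leaves room in measure for
      \<open>B\<close> and \<open>A m\<close> together. As \<open>B \<union> A k\<close> has at
      least this measure, atomlessness provides a \<open>D\<close> of measure exactly
      \<open>a k\<close>.\<close>
    define k where "k = n + m + 1"
    have a_k: "a k = a n + a m"
      by (simp add: a_def step k_def algebra_simps)
    have fin: "emeasure M (B \<union> A j) < \<infinity>" for j
      using emeasure_subadditive[OF B(1) A(1), of j] B(2) A(3)[of j] by (auto intro: le_less_trans)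
    have "measure M (B \<union> A m) \<le> a k"
      using measure_Un_le[OF B(1) A(1), of m] B(3) unfolding a_k by (simp add: a_def)
    moreover have "a k \<le> measure M (B \<union> A k)"
      unfolding a_def using A(1) B(1) fin by (intro measure_mono_fmeasurable fmeasurableI) auto
    moreover have "B \<union> A m \<subseteq> B \<union> A k"
      using incseqD[OF A(2), of m k] by (auto simp: k_def)
    ultimately obtain D where D: "D \<in> sets M" "B \<union> A m \<subseteq> D" "D \<subseteq> B \<union> A k" "measure M D = a k"
      using atomless_between[OF atomless, of "B \<union> A m" "B \<union> A k" "a k"] A(1) B(1) fin by auto
    have finD: "emeasure M D < \<infinity>"
      using emeasure_mono[OF D(3)] A(1) B(1) fin[of k] by (auto intro: le_less_trans)
    have sub: "A n \<subseteq> A k" "A m \<subseteq> A k"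
      using incseqD[OF A(2)] by (simp_all add: k_def)
    have BD: "expectation (\<lambda>\<omega>. \<bar>mass B \<omega> / a n - mass D \<omega> / a k\<bar>) \<le> deviation (A n) + deviation (A k)"
    proof -
      have "expectation (\<lambda>\<omega>. \<bar>mass B \<omega> / a n - mass D \<omega> / a k\<bar>) = expectation (\<lambda>\<omega>. \<bar>mass (A n) \<omega> / a n - mass (A k) \<omega> / a k\<bar>)"
        using B D finD A sub by (intro expectation_abs_cong_nested) (auto simp: a_def)
      also have "\<dots> \<le> deviation (A n) + expectation (\<lambda>\<omega>. \<bar>X \<omega> - mass (A k) \<omega> / a k\<bar>)"
        unfolding deviation_def a_def
        by (rule expectation_abs_triangle) (use A integrable_X in \<open>auto intro!: int\<close>)
      finally show ?thesis
        by (simp add: deviation_def a_def abs_minus_commute)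
    qed
    have AD: "expectation (\<lambda>\<omega>. \<bar>mass (A m) \<omega> / a m - mass D \<omega> / a k\<bar>) \<le> deviation (A m) + deviation (A k)"
    proof -
      have "expectation (\<lambda>\<omega>. \<bar>mass (A m) \<omega> / a m - mass D \<omega> / a k\<bar>) = expectation (\<lambda>\<omega>. \<bar>mass (A m) \<omega> / a m - mass (A k) \<omega> / a k\<bar>)"
        using D finD A sub by (intro expectation_abs_cong_nested) (auto simp: a_def)
      also have "\<dots> \<le> deviation (A m) + expectation (\<lambda>\<omega>. \<bar>X \<omega> - mass (A k) \<omega> / a k\<bar>)"
        unfolding deviation_def a_def
        by (rule expectation_abs_triangle) (use A integrable_X in \<open>auto intro!: int\<close>)
      finally show ?thesis
        by (simp add: deviation_def a_def abs_minus_commute)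
    qed
    have "deviation B \<le> expectation (\<lambda>\<omega>. \<bar>mass B \<omega> / a n - mass D \<omega> / a k\<bar>) + expectation (\<lambda>\<omega>. \<bar>mass D \<omega> / a k - X \<omega>\<bar>)"
      unfolding deviation_def B(3) a_def
      by (rule expectation_abs_triangle) (use A B D finD integrable_X in \<open>auto intro!: int\<close>)
    also have "expectation (\<lambda>\<omega>. \<bar>mass D \<omega> / a k - X \<omega>\<bar>)
        \<le> expectation (\<lambda>\<omega>. \<bar>mass D \<omega> / a k - mass (A m) \<omega> / a m\<bar>) + deviation (A m)"
      unfolding deviation_def a_def
      by (rule expectation_abs_triangle) (use A D finD integrable_X in \<open>auto intro!: int\<close>)
    finally show ?thesis
      using BD AD by (simp add: abs_minus_commute k_def)
  qed
  moreover have "(\<lambda>m. deviation (A n) + 2 * deviation (A (n + m + 1)) + 2 * deviation (A m)) \<longlonglongrightarrow> deviation (A n) + 2 * 0 + 2 * 0"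
  proof (intro tendsto_intros deviation_A)
    show "(\<lambda>m. deviation (A (n + m + 1))) \<longlonglongrightarrow> 0"
      using LIMSEQ_ignore_initial_segment[OF deviation_A, of "n + 1"] by (simp add: ac_simps)
  qed
  ultimately show ?thesis
    using LIMSEQ_le_const by fastforce
qed

text \<open>\<open>B\<close> contains a set \<open>C\<close> as big as the largest
  \<open>A n\<close> whose measure does not exceed that of \<open>B\<close>. The two measures differ
  by at most one \<open>step\<close>, which is negligible relative to a large
  \<open>B\<close>.\<close>

lemma deviation_small:
  assumes "0 < e"
  obtains K where "0 < K" "\<And>B. B \<in> sets M \<Longrightarrow> emeasure M B < \<infinity> \<Longrightarrow> K \<le> measure M B \<Longrightarrow> deviation B < e"
proof -
  define l where "l = expectation X"
  have l: "l > 0" using expectation_X_pos by (simp add: l_def)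
  obtain N where N: "\<And>n. n \<ge> N \<Longrightarrow> deviation (A n) < e / 2"
    using order_tendstoD(2)[OF deviation_A, of "e / 2"] assms by (auto simp: eventually_sequentially)
  \<comment> \<open>The first entry forces \<open>n \<ge> N\<close>; the second makes
    \<open>2 * l * step / b\<close>, the bound for the distance between the quotients of
    \<open>B\<close> and \<open>C\<close>, at most \<open>e / 2\<close>.\<close>
  define K where "K = max (measure M (A N)) (4 * l * step / e)"
  show ?thesis
  proof
    show "0 < K"
      using l step(1) assms by (simp add: K_def less_max_iff_disj)
    fix B assume B: "B \<in> sets M" "emeasure M B < \<infinity>" and K: "K \<le> measure M B"
    define b where "b = measure M B"
    have b: "b > 0" using K \<open>0 < K\<close> by (simp add: b_def)
    \<comment> \<open>Minus 1 because \<open>A n\<close> consists of \<open>Suc n\<close>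
      steps.\<close>
    define n where "n = nat \<lfloor>b / step\<rfloor> - 1"
    have "real (Suc N) \<le> b / step"
      using K step by (simp add: K_def b_def pos_le_divide_eq)
    then have "int (Suc N) \<le> \<lfloor>b / step\<rfloor>"
      by (simp add: le_floor_iff)
    then have n: "n \<ge> N" "real (Suc n) = of_int \<lfloor>b / step\<rfloor>"
      unfolding n_def by linarith+
    have le: "real (Suc n) \<le> b / step" "b / step \<le> real (Suc n) + 1"
      unfolding n by linarith+
    then have an: "measure M (A n) \<le> b" "b \<le> measure M (A n) + step"
      using step by (simp_all add: field_simps)
    define a where "a = measure M (A n)"
    have a: "a > 0"
      unfolding a_def step(2) using step(1) by simp
    obtain C where C: "C \<in> sets M" "C \<subseteq> B" "measure M C = a"
      using atomless_subset_of_measure[OF atomless B, of a] an a by (auto simp: a_def b_def)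
    have finC: "emeasure M C < \<infinity>"
      using emeasure_mono[OF C(2) B(1)] B(2) by (rule le_less_trans)
    have I: "B \<in> integrable_sets" "C \<in> integrable_sets"
      using B C finC by (auto intro: finite_measure_integrable)
    have "deviation C \<le> deviation (A n)"
      using C finC by (intro deviation_le_deviation_A) (auto simp: a_def)
    also have "\<dots> < e / 2"
      using n by (intro N)
    finally have dC: "deviation C < e / 2" .
    \<comment> \<open>The difference of the quotients is a difference of two nonnegative terms, each
      with mean \<open>l * (b - a) / b\<close>; their sum bounds its absolute value.\<close>
    have "expectation (\<lambda>\<omega>. \<bar>mass B \<omega> / b - mass C \<omega> / a\<bar>)
        \<le> expectation (\<lambda>\<omega>. (mass B \<omega> - mass C \<omega>) / b + mass C \<omega> * (1 / a - 1 / b))"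
    proof (rule integral_mono_AE)
      have "1 / b \<le> 1 / a"
        using a an by (simp add: a_def frac_le)
      then have nonneg: "0 \<le> mass C \<omega> * (1 / a - 1 / b)" for \<omega>
        by simp
      show "AE \<omega> in P. \<bar>mass B \<omega> / b - mass C \<omega> / a\<bar> \<le> (mass B \<omega> - mass C \<omega>) / b + mass C \<omega> * (1 / a - 1 / b)"
        using mass_mono[OF I(1) C(1,2)]
      proof eventually_elim
        case (elim \<omega>)
        have "0 \<le> (mass B \<omega> - mass C \<omega>) / b"
          using elim b by simp
        moreover have "mass B \<omega> / b - mass C \<omega> / a = (mass B \<omega> - mass C \<omega>) / b - mass C \<omega> * (1 / a - 1 / b)"
          by (simp add: diff_divide_distrib right_diff_distrib)
        ultimately show ?case
          using nonneg[of \<omega>] by linarith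
      qed
    qed (use I integrable_mass in auto)
    also have "\<dots> = (l * b - l * a) / b + l * a * (1 / a - 1 / b)"
      using I integrable_mass expectation_mass[OF I(1) B(2)] expectation_mass[OF I(2) finC] C(3)
      by (simp add: l_def b_def)
    also have "\<dots> = 2 * l * (b - a) / b"
      using a b by (simp add: field_simps)
    also have "\<dots> \<le> 2 * l * step / b"
      using an l b by (intro divide_right_mono mult_left_mono) (auto simp: a_def)
    also have "\<dots> \<le> e / 2"
      using K b assms by (simp add: K_def b_def field_simps)
    finally have BC: "expectation (\<lambda>\<omega>. \<bar>mass B \<omega> / b - mass C \<omega> / a\<bar>) \<le> e / 2" .
    have "deviation B \<le> expectation (\<lambda>\<omega>. \<bar>mass B \<omega> / b - mass C \<omega> / a\<bar>) + deviation C"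
      unfolding deviation_def C(3) b_def[symmetric] using I integrable_X
      by (intro expectation_abs_triangle integrable_quotient)
    with BC dC show "deviation B < e" by simp
  qed
qed

lemma deviation_tendsto:
  assumes B: "\<And>n. B n \<in> sets M" "\<And>n. emeasure M (B n) < \<infinity>"
    and lim: "filterlim (\<lambda>n. measure M (B n)) at_top sequentially"
  shows "(\<lambda>n. deviation (B n)) \<longlonglongrightarrow> 0"
proof (rule order_tendstoI)
  fix e :: real assume "0 < e"
  then obtain K where K: "\<And>B. B \<in> sets M \<Longrightarrow> emeasure M B < \<infinity> \<Longrightarrow> K \<le> measure M B \<Longrightarrow> deviation B < e"
    using deviation_small by blast
  have "eventually (\<lambda>n. K \<le> measure M (B n)) sequentially"
    using lim by (auto simp: filterlim_at_top)
  then show "eventually (\<lambda>n. deviation (B n) < e) sequentially"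
    by eventually_elim (use B K in auto)
next
  fix e :: real assume "e < 0"
  then show "eventually (\<lambda>n. e < deviation (B n)) sequentially"
    by (intro always_eventually) (auto simp: deviation_def intro: less_le_trans)
qed

theorem tendsto_L1_measure_ratio:
  assumes B: "mu_sequence M B"
  shows "tendsto_L1 P (measure_ratio M \<xi> B) X"
proof -
  note B' = mu_sequence_measure[OF B]
  have "measure_ratio M \<xi> B n \<in> borel_measurable P" for n
    using B'(1)[of n] unfolding measure_ratio_def[abs_def] by measurable
  moreover have "(\<lambda>n. \<integral>\<^sup>+\<omega>. e2ennreal \<bar>measure_ratio M \<xi> B n \<omega> - ereal (X \<omega>)\<bar> \<partial>P) \<longlonglongrightarrow> 0"
  proof (rule Lim_transform_eventually)
    show "(\<lambda>n. ennreal (deviation (B n))) \<longlonglongrightarrow> 0"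
      using tendsto_ennrealI[OF deviation_tendsto[OF B'(1,3,5)]] by simp
    have "eventually (\<lambda>n. 0 < measure M (B n)) sequentially"
      using B'(5) by (auto simp: filterlim_at_top_dense)
    then show "eventually (\<lambda>n. ennreal (deviation (B n)) = (\<integral>\<^sup>+\<omega>. e2ennreal \<bar>measure_ratio M \<xi> B n \<omega> - ereal (X \<omega>)\<bar> \<partial>P)) sequentially"
      by eventually_elim (use B' finite_measure_integrable in \<open>auto intro!: nn_integral_deviation[symmetric]\<close>)
  qed
  ultimately show ?thesis
    using integrable_X by (simp add: tendsto_L1_def)
qed

end

section \<open>Exchangeability of the quotient\<close>

context swap_invariant_limit
begin

text \<open>A version of \<open>X\<close> that is nonnegative everywhere, as the lemmas on weighted
  laws require; for \<open>X\<close> itself this holds almost surely.\<close>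

definition W :: "'w \<Rightarrow> real" where
  "W \<omega> = max 0 (X \<omega>)"

lemma W_nonneg [simp]: "0 \<le> W \<omega>"
  by (simp add: W_def)

lemma integrable_W: "integrable P W"
  unfolding W_def[abs_def] using integrable_X by (intro integrable_max) auto

lemma measurable_W [measurable]: "W \<in> borel_measurable P"
  using integrable_W by auto

text \<open>The negative part of \<open>X\<close> is at most its distance from any nonnegative
  quotient.\<close>

lemma AE_X_nonneg: "AE \<omega> in P. 0 \<le> X \<omega>"
proof -
  have int: "integrable P (\<lambda>\<omega>. max 0 (- X \<omega>))"
    using integrable_X by (intro integrable_max) auto
  have "expectation (\<lambda>\<omega>. max 0 (- X \<omega>)) \<le> deviation (A n)" for n
    unfolding deviation_def
  proof (rule integral_mono[OF int])
    show "integrable P (\<lambda>\<omega>. \<bar>mass (A n) \<omega> / measure M (A n) - X \<omega>\<bar>)"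
      using integrable_quotient[OF A_integrable] integrable_X by auto
    fix \<omega>
    have "0 \<le> mass (A n) \<omega> / measure M (A n)"
      by simp
    then show "max 0 (- X \<omega>) \<le> \<bar>mass (A n) \<omega> / measure M (A n) - X \<omega>\<bar>"
      by linarith
  qed
  then have "expectation (\<lambda>\<omega>. max 0 (- X \<omega>)) \<le> 0"
    by (intro LIMSEQ_le_const[OF deviation_A]) auto
  moreover have "0 \<le> expectation (\<lambda>\<omega>. max 0 (- X \<omega>))"
    by (rule Bochner_Integration.integral_nonneg) simp
  ultimately have "expectation (\<lambda>\<omega>. max 0 (- X \<omega>)) = 0"
    by simp
  then have "AE \<omega> in P. max 0 (- X \<omega>) = 0"
    using int by (subst (asm) integral_nonneg_eq_0_iff_AE) auto
  then show ?thesis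
    by eventually_elim (simp add: max_def split: if_splits)
qed

lemma AE_W_eq: "AE \<omega> in P. W \<omega> = X \<omega>"
  using AE_X_nonneg by eventually_elim (simp add: W_def)

text \<open>\<open>X\<close> is the limit of \<open>\<xi>(C) / \<mu>(C)\<close> along sets \<open>C\<close> that avoid the given finitely many ones.\<close>

lemma expectation_abs_swap_limit:
  fixes n :: nat and B B' :: "nat \<Rightarrow> 's set" and t :: real and u :: "nat \<Rightarrow> real"
  assumes disj: "disjoint_family_on B {..<n}" "disjoint_family_on B' {..<n}"
    and B: "\<And>j. j < n \<Longrightarrow> B j \<in> sets M \<and> emeasure M (B j) < \<infinity>"
    and B': "\<And>j. j < n \<Longrightarrow> B' j \<in> sets M \<and> emeasure M (B' j) < \<infinity>"
    and eq: "\<And>j. j < n \<Longrightarrow> emeasure M (B j) = emeasure M (B' j)"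
  shows "expectation (\<lambda>\<omega>. \<bar>t * W \<omega> + (\<Sum>j<n. u j * mass (B j) \<omega>)\<bar>)
    = expectation (\<lambda>\<omega>. \<bar>t * W \<omega> + (\<Sum>j<n. u j * mass (B' j) \<omega>)\<bar>)"
proof -
  define U where "U = (\<Union>j<n. B j \<union> B' j)"
  have U: "U \<in> fmeasurable M"
    unfolding U_def using B B' by (intro fmeasurable.finite_UN fmeasurable.Un fmeasurableI) auto
  \<comment> \<open>Disjoint from all the given sets, so it can act as the weight. Removing the
    finite measure of \<open>U\<close> still lets the measures tend to infinity.\<close>
  define C where "C m = A m - U" for m
  have C_sets: "C m \<in> sets M" for m
    unfolding C_def using A(1) U by auto
  have C_fin: "emeasure M (C m) < \<infinity>" for m
    using emeasure_mono[of "C m" "A m" M] A(1,3)[of m] by (auto simp: C_def intro: le_less_trans)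
  have C_measure: "measure M (A m) - measure M U \<le> measure M (C m)" for m
  proof -
    have "measure M (A m) \<le> measure M (C m \<union> U)"
      by (rule measure_mono_fmeasurable[OF _ A(1) fmeasurable.Un[OF fmeasurableI[OF C_sets C_fin] U]])
        (auto simp: C_def)
    also have "\<dots> \<le> measure M (C m) + measure M U"
      using C_sets U by (intro measure_Un_le) auto
    finally show ?thesis by simp
  qed
  have C_lim: "filterlim (\<lambda>m. measure M (C m)) at_top sequentially"
    unfolding filterlim_at_top
  proof
    fix Z
    have "eventually (\<lambda>m. Z + measure M U \<le> measure M (A m)) sequentially"
      using A(5) by (auto simp: filterlim_at_top)
    then show "eventually (\<lambda>m. Z \<le> measure M (C m)) sequentially"
      by eventually_elim (use C_measure in \<open>smt (verit)\<close>)
  qed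
  define f where "f D m = expectation (\<lambda>\<omega>. \<bar>t * (mass (C m) \<omega> / measure M (C m)) + (\<Sum>j<n. u j * mass (D j) \<omega>)\<bar>)"
    for D :: "nat \<Rightarrow> 's set" and m
  have lim: "(\<lambda>m. f D m) \<longlonglongrightarrow> expectation (\<lambda>\<omega>. \<bar>t * W \<omega> + (\<Sum>j<n. u j * mass (D j) \<omega>)\<bar>)"
    if D: "\<And>j. j < n \<Longrightarrow> D j \<in> sets M \<and> emeasure M (D j) < \<infinity>" for D
  proof -
    define Z where "Z \<omega> = (\<Sum>j<n. u j * mass (D j) \<omega>)" for \<omega>
    have Z: "integrable P Z"
      unfolding Z_def[abs_def] using D finite_measure_integrable integrable_mass by auto
    have int_C: "integrable P (\<lambda>\<omega>. mass (C m) \<omega> / measure M (C m))" for m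
      using C_sets C_fin by (intro integrable_quotient finite_measure_integrable)
    have eq_X: "expectation (\<lambda>\<omega>. \<bar>t * W \<omega> + Z \<omega>\<bar>) = expectation (\<lambda>\<omega>. \<bar>t * X \<omega> + Z \<omega>\<bar>)"
      using AE_W_eq Z by (intro integral_cong_AE) (auto elim!: eventually_mono)
    have bound: "norm (f D m - expectation (\<lambda>\<omega>. \<bar>t * X \<omega> + Z \<omega>\<bar>)) \<le> \<bar>t\<bar> * deviation (C m)" for m
    proof -
      let ?r = "\<lambda>\<omega>. mass (C m) \<omega> / measure M (C m)"
      note tr = integrable_mult_right[OF int_C[of m], of t]
      have "f D m - expectation (\<lambda>\<omega>. \<bar>t * X \<omega> + Z \<omega>\<bar>) = expectation (\<lambda>\<omega>. \<bar>t * ?r \<omega> + Z \<omega>\<bar> - \<bar>t * X \<omega> + Z \<omega>\<bar>)"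
        unfolding f_def Z_def[symmetric] using Z tr integrable_X
        by (intro Bochner_Integration.integral_diff[symmetric]) auto
      also have "norm \<dots> \<le> expectation (\<lambda>\<omega>. \<bar>t\<bar> * \<bar>?r \<omega> - X \<omega>\<bar>)"
      proof (rule order_trans[OF integral_norm_bound integral_mono])
        fix \<omega>
        have "\<bar>\<bar>t * ?r \<omega> + Z \<omega>\<bar> - \<bar>t * X \<omega> + Z \<omega>\<bar>\<bar> \<le> \<bar>t * (?r \<omega> - X \<omega>)\<bar>"
          by (rule order_trans[OF abs_triangle_ineq3]) (simp add: algebra_simps)
        then show "norm (\<bar>t * ?r \<omega> + Z \<omega>\<bar> - \<bar>t * X \<omega> + Z \<omega>\<bar>) \<le> \<bar>t\<bar> * \<bar>?r \<omega> - X \<omega>\<bar>"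
          by (simp add: abs_mult)
      qed (use Z tr int_C[of m] integrable_X in auto)
      also have "\<dots> = \<bar>t\<bar> * deviation (C m)"
        by (simp add: deviation_def)
      finally show ?thesis .
    qed
    have "(\<lambda>m. \<bar>t\<bar> * deviation (C m)) \<longlonglongrightarrow> 0"
      by (rule tendsto_mult_right_zero[OF deviation_tendsto[OF C_sets C_fin C_lim]])
    with always_eventually[OF allI, OF bound]
    have "(\<lambda>m. f D m - expectation (\<lambda>\<omega>. \<bar>t * X \<omega> + Z \<omega>\<bar>)) \<longlonglongrightarrow> 0"
      by (rule Lim_null_comparison)
    then show ?thesis
      unfolding Z_def[symmetric] eq_X by (simp only: LIM_zero_iff)
  qed
  have "f B m = f B' m" for m
  proof -
    have "expectation (\<lambda>\<omega>. \<bar>t / measure M (C m) * mass (C m) \<omega> + (\<Sum>j<n. u j * mass (B j) \<omega>)\<bar>)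
        = expectation (\<lambda>\<omega>. \<bar>t / measure M (C m) * mass (C m) \<omega> + (\<Sum>j<n. u j * mass (B' j) \<omega>)\<bar>)"
    proof (rule expectation_abs_swap_off)
      show "C m \<in> integrable_sets"
        using C_sets C_fin by (rule finite_measure_integrable)
      show "B j \<in> integrable_sets \<and> B j \<inter> C m = {}" "B' j \<in> integrable_sets \<and> B' j \<inter> C m = {}" if "j < n" for j
        using that B B' by (auto simp: C_def U_def intro: finite_measure_integrable)
    qed (use disj eq in auto)
    then show ?thesis
      by (simp add: f_def)
  qed
  then have "(\<lambda>m. f B m) \<longlonglongrightarrow> expectation (\<lambda>\<omega>. \<bar>t * W \<omega> + (\<Sum>j<n. u j * mass (B' j) \<omega>)\<bar>)"
    using lim[of B', OF B'] by simp
  with lim[of B, OF B] show ?thesis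
    by (rule LIMSEQ_unique)
qed

section \<open>Zeros of the limit and sets of infinite measure\<close>

text \<open>The mean of \<open>mass C\<close> on the event \<open>W = 0\<close> depends on the
  measure of \<open>C\<close> only, so it is proportional to it, and its proportionality factor can
  be read off from arbitrarily large sets \<open>D\<close>. There it is at most
  \<open>deviation D\<close>, because \<open>X\<close> is at most 0 on this event.\<close>

lemma AE_mass_eq_0:
  assumes B: "B \<in> sets M" "emeasure M B < \<infinity>"
  shows "AE \<omega> in P. W \<omega> = 0 \<longrightarrow> mass B \<omega> = 0"
proof -
  define \<nu> where "\<nu> C = expectation (\<lambda>\<omega>. \<bar>mass C \<omega>\<bar> * indicator {0} (W \<omega>))" for C
  have int: "integrable P (mass C)" if "C \<in> sets M" "emeasure M C < \<infinity>" for C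
    using finite_measure_integrable[OF that] by (rule integrable_mass)
  have int_ind: "integrable P (\<lambda>\<omega>. mass C \<omega> * indicator {0} (W \<omega>))" if "C \<in> sets M" "emeasure M C < \<infinity>" for C
  proof (rule Bochner_Integration.integrable_bound[OF int[OF that]])
    have [measurable]: "mass C \<in> borel_measurable P"
      using that by (intro measurable_mass)
    show "(\<lambda>\<omega>. mass C \<omega> * indicator {0} (W \<omega>)) \<in> borel_measurable P"
      by measurable
  qed (auto simp: indicator_def)
  have bound: "\<nu> B \<le> measure M B * deviation (B \<union> A m)" for m
  proof -
    define D where "D = B \<union> A m"
    have D: "D \<in> sets M" "emeasure M D < \<infinity>"
      using emeasure_subadditive[OF B(1) A(1), of m] B A(1) A(3)[of m] by (auto simp: D_def intro: le_less_trans)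
    have "measure M (A m) \<le> measure M D"
      using D A by (intro measure_mono_fmeasurable fmeasurableI) (auto simp: D_def)
    then have pos: "0 < measure M D"
      using step(1) step(2)[of m] by (smt (verit) mult_pos_pos of_nat_0_less_iff zero_less_Suc)
    have "measure M D * \<nu> B = measure M B * \<nu> D"
    proof (rule additive_linear_in_measure[OF atomless D])
      show "0 \<le> \<nu> C" for C
        unfolding \<nu>_def by (rule Bochner_Integration.integral_nonneg) simp
      fix C C' assume C: "C \<in> sets M" "C' \<in> sets M" "C \<union> C' \<subseteq> D"
      have fin: "emeasure M E < \<infinity>" if "E \<subseteq> D" for E
        using emeasure_mono[OF that D(1)] D(2) by (rule le_less_trans)
      have finC: "emeasure M C < \<infinity>" "emeasure M C' < \<infinity>" "emeasure M (C \<union> C') < \<infinity>"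
        using C fin[of C] fin[of C'] fin[of "C \<union> C'"] by auto
      have I: "C \<in> integrable_sets" "C' \<in> integrable_sets"
        using C finC by (auto intro: finite_measure_integrable)
      {
        assume "C \<inter> C' = {}"
        have "\<nu> (C \<union> C') = expectation (\<lambda>\<omega>. mass C \<omega> * indicator {0} (W \<omega>) + mass C' \<omega> * indicator {0} (W \<omega>))"
          unfolding \<nu>_def abs_of_nonneg[OF mass_nonneg]
          using mass_Un[OF I \<open>C \<inter> C' = {}\<close>] int_ind[of "C \<union> C'"] int_ind[of C] int_ind[of C'] C finC
          by (intro integral_cong_AE borel_measurable_integrable Bochner_Integration.integrable_add)
            (auto elim!: eventually_mono simp: distrib_right)
        then show "\<nu> (C \<union> C') = \<nu> C + \<nu> C'"
          using int_ind[of C] int_ind[of C'] C finC by (simp add: \<nu>_def)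
      }
      assume eq: "measure M C = measure M C'"
      show "\<nu> C = \<nu> C'"
        unfolding \<nu>_def
      proof (rule integral_abs_on_zero_eq[OF integrable_W])
        fix t
        have "expectation (\<lambda>\<omega>. \<bar>t * W \<omega> + (\<Sum>j<1::nat. 1 * mass C \<omega>)\<bar>) = expectation (\<lambda>\<omega>. \<bar>t * W \<omega> + (\<Sum>j<1::nat. 1 * mass C' \<omega>)\<bar>)"
          by (rule expectation_abs_swap_limit)
            (use C finC eq in \<open>auto simp: disjoint_family_on_def emeasure_eq_ennreal_measure\<close>)
        then show "expectation (\<lambda>\<omega>. \<bar>t * W \<omega> + mass C \<omega>\<bar>) = expectation (\<lambda>\<omega>. \<bar>t * W \<omega> + mass C' \<omega>\<bar>)"
          by simp
      qed (use C finC int in auto)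
    qed (use B D_def in auto)
    then have "\<nu> B = measure M B * (\<nu> D / measure M D)"
      using pos by (simp add: field_simps)
    also have "\<nu> D / measure M D \<le> deviation D"
    proof -
      have "\<nu> D / measure M D = expectation (\<lambda>\<omega>. mass D \<omega> * indicator {0} (W \<omega>) / measure M D)"
        by (simp add: \<nu>_def)
      also have "\<dots> \<le> deviation D"
        unfolding deviation_def
      proof (rule integral_mono)
        show "integrable P (\<lambda>\<omega>. \<bar>mass D \<omega> / measure M D - X \<omega>\<bar>)"
          using int[OF D] integrable_X by auto
        show "integrable P (\<lambda>\<omega>. mass D \<omega> * indicator {0} (W \<omega>) / measure M D)"
          using int_ind[OF D] by simp
        fix \<omega>
        have "0 \<le> mass D \<omega> / measure M D" by simp
        moreover have "X \<omega> \<le> 0" if "W \<omega> = 0"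
          using that by (simp add: W_def max_def split: if_splits)
        ultimately show "mass D \<omega> * indicator {0} (W \<omega>) / measure M D \<le> \<bar>mass D \<omega> / measure M D - X \<omega>\<bar>"
        proof (cases "W \<omega> = 0")
          case True
          with \<open>W \<omega> = 0 \<Longrightarrow> X \<omega> \<le> 0\<close> have "X \<omega> \<le> 0" by simp
          with True \<open>0 \<le> mass D \<omega> / measure M D\<close> show ?thesis
            by simp
        qed simp
      qed
      finally show ?thesis .
    qed
    finally show ?thesis
      by (simp add: D_def mult_left_mono)
  qed
  have fin: "emeasure M (B \<union> A m) < \<infinity>" for m
    using emeasure_subadditive[OF B(1) A(1), of m] B A(3)[of m] by (auto intro: le_less_trans)
  have "(\<lambda>m. deviation (B \<union> A m)) \<longlonglongrightarrow> 0"
  proof (rule deviation_tendsto)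
    show "filterlim (\<lambda>m. measure M (B \<union> A m)) at_top sequentially"
    proof (rule filterlim_at_top_mono[OF A(5) always_eventually], rule allI)
      show "measure M (A m) \<le> measure M (B \<union> A m)" for m
        using B A(1) fin by (intro measure_mono_fmeasurable fmeasurableI) auto
    qed
  qed (use B A(1) fin in auto)
  then have "(\<lambda>m. measure M B * deviation (B \<union> A m)) \<longlonglongrightarrow> measure M B * 0"
    by (rule tendsto_mult_left)
  then have "\<nu> B \<le> 0"
    using bound by (intro LIMSEQ_le_const[of _ 0]) auto
  moreover have "0 \<le> \<nu> B"
    unfolding \<nu>_def by (rule Bochner_Integration.integral_nonneg) simp
  ultimately have "\<nu> B = 0"
    by simp
  then have "expectation (\<lambda>\<omega>. mass B \<omega> * indicator {0} (W \<omega>)) = 0"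
    by (simp add: \<nu>_def)
  then have "AE \<omega> in P. mass B \<omega> * indicator {0} (W \<omega>) = 0"
    using int_ind[OF B] by (subst (asm) integral_nonneg_eq_0_iff_AE) auto
  then show ?thesis
    by eventually_elim (auto simp: indicator_def)
qed

text \<open>A countable cover by sets of finite measure yields one exceptional null event that is
  valid for all measurable sets simultaneously.\<close>

lemma AE_null: "AE \<omega> in P. W \<omega> = 0 \<longrightarrow> \<xi> \<omega> = null_measure M"
proof -
  interpret M: sigma_finite_measure M by (rule sigma_finite_M)
  obtain S :: "nat \<Rightarrow> 's set" where S: "range S \<subseteq> sets M" "(\<Union>i. S i) = space M" "\<And>i. emeasure M (S i) \<noteq> \<infinity>"
    using M.sigma_finite by blast
  have S': "S i \<in> sets M" "emeasure M (S i) < \<infinity>" for i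
    using S by (auto simp: less_top)
  have "AE \<omega> in P. \<forall>i. (W \<omega> = 0 \<longrightarrow> mass (S i) \<omega> = 0) \<and> emeasure (\<xi> \<omega>) (S i) = ennreal (mass (S i) \<omega>)"
    unfolding AE_all_countable
    using AE_mass_eq_0[OF S'] AE_emeasure_eq[OF finite_measure_integrable[OF S']] by auto
  then show ?thesis
    using AE_space
  proof eventually_elim
    case (elim \<omega>)
    show ?case
    proof
      assume "W \<omega> = 0"
      with elim have "emeasure (\<xi> \<omega>) (\<Union>i. S i) = 0"
        using S'(1) by (intro emeasure_UN_eq_0) (auto simp: sets_\<xi>)
      then have "emeasure (\<xi> \<omega>) (space M) = 0"
        by (simp add: S)
      show "\<xi> \<omega> = null_measure M"
      proof (rule measure_eqI)
        show "sets (\<xi> \<omega>) = sets (null_measure M)"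
          using elim by (simp add: sets_\<xi>)
        fix B assume "B \<in> sets (\<xi> \<omega>)"
        then have "emeasure (\<xi> \<omega>) B \<le> emeasure (\<xi> \<omega>) (space M)"
          using elim sets_eq_imp_space_eq[OF sets_\<xi>] by (metis emeasure_mono sets.sets_into_space sets.top sets_\<xi>)
        then show "emeasure (\<xi> \<omega>) B = emeasure (null_measure M) B"
          using \<open>emeasure (\<xi> \<omega>) (space M) = 0\<close> by simp
      qed
    qed
  qed
qed

text \<open>Exhaust \<open>B\<close> by sets \<open>C i\<close> of finite measure. Where \<xi>(B) is
  at most \<open>k\<close>, the quotients are at most \<open>k / measure M (C i)\<close> and tend to
  0, although they approach \<open>X\<close> in mean; so \<open>W\<close> vanishes almost surely
  there.\<close>

lemma AE_infinite:
  assumes B: "B \<in> sets M" "emeasure M B = \<infinity>"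
  shows "AE \<omega> in P. 0 < W \<omega> \<longrightarrow> emeasure (\<xi> \<omega>) B = \<infinity>"
proof -
  interpret M: sigma_finite_measure M by (rule sigma_finite_M)
  obtain S :: "nat \<Rightarrow> 's set" where S: "range S \<subseteq> sets M" "(\<Union>i. S i) = space M" "\<And>i. emeasure M (S i) \<noteq> \<infinity>" "incseq S"
    using M.sigma_finite_incseq by blast
  define C where "C i = B \<inter> S i" for i
  have C_sets: "C i \<in> sets M" for i
    using B S by (auto simp: C_def)
  have C_fin: "emeasure M (C i) < \<infinity>" for i
    using emeasure_mono[of "C i" "S i" M] S(1,3) by (auto simp: C_def less_top[symmetric] top_unique)
  have "incseq C"
    using S(4) by (auto simp: C_def incseq_def)
  moreover have "(\<Union>i. C i) = B"
    using S(2) sets.sets_into_space[OF B(1)] by (auto simp: C_def)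
  ultimately have "(\<lambda>i. emeasure M (C i)) \<longlonglongrightarrow> \<infinity>"
    using Lim_emeasure_incseq[of C M] C_sets B(2) by auto
  then have "mu_sequence M C"
    using C_sets C_fin \<open>incseq C\<close> by (auto simp: mu_sequence_def)
  note C = mu_sequence_measure[OF this]
  have "AE \<omega> in P. W \<omega> * indicator {\<omega>\<in>space P. emeasure (\<xi> \<omega>) B \<le> of_nat k} \<omega> = 0" for k :: nat
  proof -
    define G where "G = {\<omega>\<in>space P. emeasure (\<xi> \<omega>) B \<le> of_nat k}"
    have [measurable]: "G \<in> sets P"
      unfolding G_def using B(1) by measurable
    have int: "integrable P (\<lambda>\<omega>. W \<omega> * indicator G \<omega>)"
      using integrable_W by (intro integrable_real_mult_indicator) auto
    have "expectation (\<lambda>\<omega>. W \<omega> * indicator G \<omega>) \<le> deviation (C i) + real k / measure M (C i)" for i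
    proof -
      have intC: "integrable P (\<lambda>\<omega>. \<bar>mass (C i) \<omega> / measure M (C i) - X \<omega>\<bar>)"
        using integrable_quotient[OF finite_measure_integrable[OF C_sets C_fin]] integrable_X by auto
      have "expectation (\<lambda>\<omega>. W \<omega> * indicator G \<omega>) \<le> expectation (\<lambda>\<omega>. \<bar>mass (C i) \<omega> / measure M (C i) - X \<omega>\<bar> + real k / measure M (C i))"
      proof (rule integral_mono_AE[OF int])
        show "integrable P (\<lambda>\<omega>. \<bar>mass (C i) \<omega> / measure M (C i) - X \<omega>\<bar> + real k / measure M (C i))"
          using intC by simp
        show "AE \<omega> in P. W \<omega> * indicator G \<omega> \<le> \<bar>mass (C i) \<omega> / measure M (C i) - X \<omega>\<bar> + real k / measure M (C i)"
          using AE_W_eq AE_space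
        proof eventually_elim
          case (elim \<omega>)
          show ?case
          proof (cases "\<omega> \<in> G")
            case True
            have "emeasure (\<xi> \<omega>) (C i) \<le> emeasure (\<xi> \<omega>) B"
              using elim B(1) by (intro emeasure_mono) (auto simp: C_def sets_\<xi>)
            also have "\<dots> \<le> ennreal (real k)"
              using True by (simp add: G_def ennreal_of_nat_eq_real_of_nat)
            finally have "mass (C i) \<omega> \<le> real k"
              unfolding mass_def measure_def by (intro enn2real_leI) auto
            then have "mass (C i) \<omega> / measure M (C i) \<le> real k / measure M (C i)"
              by (intro divide_right_mono) auto
            then show ?thesis
              using True elim by simp
          qed simp
        qed
      qed
      also have "\<dots> = deviation (C i) + real k / measure M (C i)"
        using intC by (simp add: deviation_def prob_space)
      finally show ?thesis .
    qed
    moreover have "(\<lambda>i. deviation (C i) + real k / measure M (C i)) \<longlonglongrightarrow> 0 + 0"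
      by (intro tendsto_add deviation_tendsto C_sets C_fin C(5)
        tendsto_divide_0[OF tendsto_const filterlim_at_top_imp_at_infinity])
    ultimately have "expectation (\<lambda>\<omega>. W \<omega> * indicator G \<omega>) \<le> 0"
      by (intro LIMSEQ_le_const[of _ 0]) auto
    moreover have "0 \<le> expectation (\<lambda>\<omega>. W \<omega> * indicator G \<omega>)"
      by (rule Bochner_Integration.integral_nonneg) simp
    ultimately have "expectation (\<lambda>\<omega>. W \<omega> * indicator G \<omega>) = 0"
      by simp
    then show ?thesis
      using int unfolding G_def[symmetric] by (subst (asm) integral_nonneg_eq_0_iff_AE) auto
  qed
  then have "AE \<omega> in P. \<forall>k::nat. W \<omega> * indicator {\<omega>\<in>space P. emeasure (\<xi> \<omega>) B \<le> of_nat k} \<omega> = 0"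
    unfolding AE_all_countable by (rule allI)
  then show ?thesis
    using AE_space
  proof eventually_elim
    case (elim \<omega>)
    show ?case
    proof
      assume "0 < W \<omega>"
      with elim have "\<not> emeasure (\<xi> \<omega>) B \<le> of_nat k" for k :: nat
        by (auto simp: indicator_def split: if_splits)
      then have "of_nat k \<le> emeasure (\<xi> \<omega>) B" for k :: nat
        using nle_le by blast
      then have "(SUP k. of_nat k) \<le> emeasure (\<xi> \<omega>) B"
        by (intro SUP_least)
      then show "emeasure (\<xi> \<omega>) B = \<infinity>"
        by (simp add: ennreal_SUP_of_nat_eq_top top_unique)
    qed
  qed
qed

section \<open>The normalised random measure\<close>

text \<open>Where \<open>W\<close> vanishes, the null measure keeps the values measurable. This
  event is not charged by the measure with density proportional to \<open>X\<close>, and \<xi> is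
  null there.\<close>

definition \<eta> :: "'w \<Rightarrow> 's measure" where
  "\<eta> \<omega> = (if 0 < W \<omega> then scale_measure (ennreal (1 / W \<omega>)) (\<xi> \<omega>) else null_measure M)"

lemma random_measure_\<eta>: "random_measure P M \<eta>"
  unfolding random_measure_def
proof (intro conjI ballI)
  show "sets (\<eta> \<omega>) = sets M" if "\<omega> \<in> space P" for \<omega>
    using that by (simp add: \<eta>_def sets_\<xi>)
  fix B assume [measurable]: "B \<in> sets M"
  have "(\<lambda>\<omega>. emeasure (\<eta> \<omega>) B) = (\<lambda>\<omega>. if 0 < W \<omega> then ennreal (1 / W \<omega>) * emeasure (\<xi> \<omega>) B else 0)"
    by (auto simp: \<eta>_def)
  then show "(\<lambda>\<omega>. emeasure (\<eta> \<omega>) B) \<in> borel_measurable P"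
    by simp
qed

lemma AE_\<xi>_eq_scale: "AE \<omega> in P. \<xi> \<omega> = scale_measure (ennreal (X \<omega>)) (\<eta> \<omega>)"
  using AE_W_eq AE_null
proof eventually_elim
  case (elim \<omega>)
  show ?case
  proof (cases "0 < W \<omega>")
    case True
    then have "ennreal (W \<omega>) * ennreal (1 / W \<omega>) = 1"
      by (simp flip: ennreal_mult)
    then show ?thesis
      using True elim by (simp add: \<eta>_def)
  next
    case False
    then have "W \<omega> = 0"
      using W_nonneg[of \<omega>] by simp
    then show ?thesis
      using elim by (simp add: \<eta>_def)
  qed
qed

text \<open>Coordinates of infinite measure have the value \<infinity> almost surely on both sides.
  The others are quotients \<open>mass / W\<close>, whose joint law is determined by the absolute
  moments with \<open>W\<close> as the weight.\<close>

theorem exchangeable_\<eta>: "exchangeable (density P (\<lambda>\<omega>. ennreal (X \<omega> / expectation X))) M \<eta>"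
  unfolding exchangeable_def
proof (intro allI impI)
  fix n :: nat and B B' :: "nat \<Rightarrow> 's set"
  assume sets: "\<forall>j<n. B j \<in> sets M \<and> B' j \<in> sets M"
    and disj: "disjoint_family_on B {..<n}" "disjoint_family_on B' {..<n}"
    and eq: "\<forall>j<n. emeasure M (B j) = emeasure M (B' j)"
  define c where "c = expectation X"
  have c: "0 < c"
    using expectation_X_pos by (simp add: c_def)
  define Q where "Q = density P (\<lambda>\<omega>. ennreal (W \<omega> / c))"
  have Q: "density P (\<lambda>\<omega>. ennreal (X \<omega> / expectation X)) = Q"
    unfolding Q_def c_def using AE_W_eq by (intro density_cong) (auto elim!: eventually_mono)
  \<comment> \<open>Sets of infinite measure are emptied, so that the results on finite measure
    apply to the whole family; \<Phi> restores their value \<infinity> afterwards.\<close>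
  define F where "F D j = (if emeasure M (D j) = \<infinity> then {} else D j)" for D :: "nat \<Rightarrow> 's set" and j
  have F: "F D j \<in> sets M" "emeasure M (F D j) < \<infinity>" if "D j \<in> sets M" for D j
    using that by (auto simp: F_def less_top)
  have F_I: "F D j \<in> integrable_sets" if "D j \<in> sets M" for D j
    using F[of D j, OF that] by (rule finite_measure_integrable)
  have disj_F: "disjoint_family_on (F D) {..<n}" if "disjoint_family_on D {..<n}" for D
    using that unfolding disjoint_family_on_def F_def by auto
  have eq_F: "emeasure M (F B j) = emeasure M (F B' j)" if "j < n" for j
    using eq that by (simp add: F_def)
  \<comment> \<open>Masses and weight are both divided by \<open>c\<close>, since the density of the
    probability measure \<open>Q\<close> is \<open>W / c\<close>.\<close>
  have distr_F: "distr Q (\<Pi>\<^sub>M j\<in>{..<n}. borel) (\<lambda>\<omega>. \<lambda>j\<in>{..<n}. mass (F B j) \<omega> / c / (W \<omega> / c))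
      = distr Q (\<Pi>\<^sub>M j\<in>{..<n}. borel) (\<lambda>\<omega>. \<lambda>j\<in>{..<n}. mass (F B' j) \<omega> / c / (W \<omega> / c))"
    unfolding Q_def
  proof (rule distr_weighted_eqI_abs_moments[where Y="\<lambda>j \<omega>. mass (F B j) \<omega> / c" and Y'="\<lambda>j \<omega>. mass (F B' j) \<omega> / c"])
    fix t :: real and u :: "nat \<Rightarrow> real"
    have "expectation (\<lambda>\<omega>. \<bar>t / c * W \<omega> + (\<Sum>j<n. u j / c * mass (F B j) \<omega>)\<bar>)
        = expectation (\<lambda>\<omega>. \<bar>t / c * W \<omega> + (\<Sum>j<n. u j / c * mass (F B' j) \<omega>)\<bar>)"
      by (rule expectation_abs_swap_limit) (use sets disj disj_F F eq_F in auto)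
    then show "expectation (\<lambda>\<omega>. \<bar>t * (W \<omega> / c) + (\<Sum>j<n. u j * (mass (F B j) \<omega> / c))\<bar>)
        = expectation (\<lambda>\<omega>. \<bar>t * (W \<omega> / c) + (\<Sum>j<n. u j * (mass (F B' j) \<omega> / c))\<bar>)"
      by simp
  qed (use c sets F_I integrable_mass integrable_W in auto)
  \<comment> \<open>One map serves both families, since \<open>B j\<close> and \<open>B' j\<close>
    are of infinite measure for the same \<open>j\<close>.\<close>
  define \<Phi> where "\<Phi> y = (\<lambda>j\<in>{..<n}. if emeasure M (B j) = \<infinity> then \<infinity> else ennreal (y j))" for y :: "nat \<Rightarrow> real"
  have \<Phi>: "\<Phi> \<in> measurable (\<Pi>\<^sub>M j\<in>{..<n}. borel) (\<Pi>\<^sub>M j\<in>{..<n}. borel)"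
    unfolding \<Phi>_def
  proof (rule measurable_restrict)
    fix j assume "j \<in> {..<n}"
    then have [measurable]: "(\<lambda>y. y j :: real) \<in> borel_measurable (\<Pi>\<^sub>M j\<in>{..<n}. borel)"
      using measurable_component_singleton[of j "{..<n}" "\<lambda>_. borel"] by simp
    show "(\<lambda>y. if emeasure M (B j) = \<infinity> then \<infinity> else ennreal (y j)) \<in> borel_measurable (\<Pi>\<^sub>M j\<in>{..<n}. borel)"
      by measurable
  qed
  have distr: "distr Q (\<Pi>\<^sub>M j\<in>{..<n}. borel) (\<lambda>\<omega>. \<lambda>j\<in>{..<n}. emeasure (\<eta> \<omega>) (D j))
      = distr (distr Q (\<Pi>\<^sub>M j\<in>{..<n}. borel) (\<lambda>\<omega>. \<lambda>j\<in>{..<n}. mass (F D j) \<omega> / c / (W \<omega> / c))) (\<Pi>\<^sub>M j\<in>{..<n}. borel) \<Phi>"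
    if D: "\<And>j. j < n \<Longrightarrow> D j \<in> sets M" and eq: "\<And>j. j < n \<Longrightarrow> emeasure M (D j) = emeasure M (B j)" for D
  proof -
    have meas: "(\<lambda>\<omega>. \<lambda>j\<in>{..<n}. mass (F D j) \<omega> / c / (W \<omega> / c)) \<in> measurable Q (\<Pi>\<^sub>M j\<in>{..<n}. borel)"
    proof (rule measurable_restrict)
      fix j assume "j \<in> {..<n}"
      then have [measurable]: "mass (F D j) \<in> borel_measurable P"
        using D F by (intro measurable_mass) auto
      show "(\<lambda>\<omega>. mass (F D j) \<omega> / c / (W \<omega> / c)) \<in> measurable Q borel"
        unfolding Q_def by measurable
    qed
    have meas_\<eta>: "(\<lambda>\<omega>. \<lambda>j\<in>{..<n}. emeasure (\<eta> \<omega>) (D j)) \<in> measurable Q (\<Pi>\<^sub>M j\<in>{..<n}. borel)"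
      unfolding Q_def using D random_measure_\<eta> by (intro measurable_restrict) (auto simp: random_measure_def)
    have "AE \<omega> in P. \<forall>j\<in>{..<n}. 0 < W \<omega> \<longrightarrow>
        emeasure (\<eta> \<omega>) (D j) = (if emeasure M (B j) = \<infinity> then \<infinity> else ennreal (mass (F D j) \<omega> / c / (W \<omega> / c)))"
    proof (rule AE_finite_allI)
      fix j assume j: "j \<in> {..<n}"
      show "AE \<omega> in P. 0 < W \<omega> \<longrightarrow>
        emeasure (\<eta> \<omega>) (D j) = (if emeasure M (B j) = \<infinity> then \<infinity> else ennreal (mass (F D j) \<omega> / c / (W \<omega> / c)))"
      proof (cases "emeasure M (B j) = \<infinity>")
        case True
        then have "AE \<omega> in P. 0 < W \<omega> \<longrightarrow> emeasure (\<xi> \<omega>) (D j) = \<infinity>"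
          using D eq j by (intro AE_infinite) auto
        then show ?thesis
          by eventually_elim (simp add: \<eta>_def True ennreal_mult_top)
      next
        case False
        then have FD: "F D j = D j"
          using eq j by (simp add: F_def)
        have "AE \<omega> in P. emeasure (\<xi> \<omega>) (D j) = ennreal (mass (D j) \<omega>)"
          using F_I[of D j] D j unfolding FD by (intro AE_emeasure_eq) auto
        then show ?thesis
        proof eventually_elim
          case (elim \<omega>)
          then show ?case
            using False c unfolding FD by (auto simp: \<eta>_def simp flip: ennreal_mult)
        qed
      qed
    qed simp
    then have "AE \<omega> in Q. (\<lambda>j\<in>{..<n}. emeasure (\<eta> \<omega>) (D j)) = \<Phi> (\<lambda>j\<in>{..<n}. mass (F D j) \<omega> / c / (W \<omega> / c))"
      unfolding Q_def using c by (subst AE_density) (auto simp: \<Phi>_def fun_eq_iff zero_less_divide_iff elim!: eventually_mono)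
    then have "distr Q (\<Pi>\<^sub>M j\<in>{..<n}. borel) (\<lambda>\<omega>. \<lambda>j\<in>{..<n}. emeasure (\<eta> \<omega>) (D j))
        = distr Q (\<Pi>\<^sub>M j\<in>{..<n}. borel) (\<Phi> \<circ> (\<lambda>\<omega>. \<lambda>j\<in>{..<n}. mass (F D j) \<omega> / c / (W \<omega> / c)))"
      using meas_\<eta> measurable_comp[OF meas \<Phi>] by (intro distr_cong_AE) auto
    also have "\<dots> = distr (distr Q (\<Pi>\<^sub>M j\<in>{..<n}. borel) (\<lambda>\<omega>. \<lambda>j\<in>{..<n}. mass (F D j) \<omega> / c / (W \<omega> / c))) (\<Pi>\<^sub>M j\<in>{..<n}. borel) \<Phi>"
      by (rule distr_distr[OF \<Phi> meas, symmetric])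
    finally show ?thesis .
  qed
  show "distr (density P (\<lambda>\<omega>. ennreal (X \<omega> / expectation X))) (\<Pi>\<^sub>M j\<in>{..<n}. borel) (\<lambda>\<omega>. \<lambda>j\<in>{..<n}. emeasure (\<eta> \<omega>) (B j))
      = distr (density P (\<lambda>\<omega>. ennreal (X \<omega> / expectation X))) (\<Pi>\<^sub>M j\<in>{..<n}. borel) (\<lambda>\<omega>. \<lambda>j\<in>{..<n}. emeasure (\<eta> \<omega>) (B' j))"
    unfolding Q using sets eq by (simp only: distr distr_F simp_thms)
qed

end

theorem theorem4p5:
  fixes P :: "'w measure" and M :: "'s measure" and \<xi> :: "'w \<Rightarrow> 's measure"
  assumes "prob_space P"
    and "atomless M"
    and "random_measure P M \<xi>"
    and "swap_invariant P M \<xi>"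
  shows
    "(\<forall>A. mu_sequence M A \<and> integrable_sequence P \<xi> A \<longrightarrow>
        (\<exists>X :: 'w \<Rightarrow> real. integrable P X \<and>
           (AE \<omega> in P. (\<lambda>n. measure_ratio M \<xi> A n \<omega>) \<longlonglongrightarrow> ereal (X \<omega>)))) \<and>
     (sigma_finite_measure M \<and> sigma_finite_measure (intensity P M \<xi>) \<longrightarrow>
        (\<forall>A (X :: 'w \<Rightarrow> real).
           mu_sequence M A \<and> constant_increments M A \<and> X \<in> borel_measurable P \<and>
           emeasure M (space M - (\<Union>n. A n)) = \<infinity> \<and>
           tendsto_L1 P (measure_ratio M \<xi> A) X \<and> (\<integral>\<omega>. X \<omega> \<partial>P) > 0 \<longrightarrow>
           (\<forall>B. mu_sequence M B \<longrightarrow> tendsto_L1 P (measure_ratio M \<xi> B) X) \<and>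
           (\<exists>\<eta>. random_measure P M \<eta> \<and>
              exchangeable (density P (\<lambda>\<omega>. ennreal (X \<omega> / (\<integral>\<omega>'. X \<omega>' \<partial>P)))) M \<eta> \<and>
              (AE \<omega> in P. \<xi> \<omega> = scale_measure (ennreal (X \<omega>)) (\<eta> \<omega>)))))"
proof -
  interpret swap_invariant_measure P M \<xi>
    using assms by (simp add: swap_invariant_measure_def swap_invariant_measure_axioms_def)
  show ?thesis
  proof (intro conjI allI impI; (elim conjE)?)
    fix A assume "mu_sequence M A" "integrable_sequence P \<xi> A"
    then show "\<exists>X :: 'w \<Rightarrow> real. integrable P X \<and> (AE \<omega> in P. (\<lambda>n. measure_ratio M \<xi> A n \<omega>) \<longlonglongrightarrow> ereal (X \<omega>))"
      by (rule AE_convergent_measure_ratio)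
  next
    fix A X
    assume "sigma_finite_measure M" "sigma_finite_measure (intensity P M \<xi>)" "mu_sequence M A"
      "constant_increments M A" "tendsto_L1 P (measure_ratio M \<xi> A) X" "0 < (\<integral>\<omega>. X \<omega> \<partial>P)"
    then interpret L: swap_invariant_limit P M \<xi> A X
      by (intro swap_invariant_limit.intro swap_invariant_limit_axioms.intro swap_invariant_measure_axioms)
    show "tendsto_L1 P (measure_ratio M \<xi> B) X" if "mu_sequence M B" for B
      using that by (rule L.tendsto_L1_measure_ratio)
    show "\<exists>\<eta>. random_measure P M \<eta> \<and>
        exchangeable (density P (\<lambda>\<omega>. ennreal (X \<omega> / (\<integral>\<omega>'. X \<omega>' \<partial>P)))) M \<eta> \<and>
        (AE \<omega> in P. \<xi> \<omega> = scale_measure (ennreal (X \<omega>)) (\<eta> \<omega>))"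
      using L.random_measure_\<eta> L.exchangeable_\<eta> L.AE_\<xi>_eq_scale by blast
  qed
qed

end
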